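(* Let $m,n\ge 1$ be integers. Let $T=(T_1,\dots,T_n)$ and $S=(S_1,\dots,S_n)$ be pure $m$-hypercontractions on Hilbert spaces $\mathcal H$ and $\mathcal K$ respectively, and let $X\in\mathcal B(\mathcal H,\mathcal K)$ be a contraction such that $XT_i=S_iX$ for all $i=1,\dots,n$. Let $\pi_T:\mathcal H\to\mathbb H_m(\mathbb B^n,\mathcal D_{m,T^*})$ and $\pi_S:\mathcal K\to\mathbb H_m(\mathbb B^n,\mathcal D_{m,S^*})$ be the canonical dilation maps of $T$ and $S$. Then there exists a Schur-Agler function $\Phi:\mathbb B^n\to\mathcal B(\mathcal D_{m,T^*},\mathcal D_{m,S^*})$ such that $\pi_TX^*=M_\Phi^*\pi_S$ if and only if $$(1-\sigma_S)^{m-1}(I_{\mathcal K}-XX^* )\ge 0.$$ Moreover, when $(1-\sigma_S)^{m-1}(I_{\mathcal K}-XX^* )\ge 0$, set $\Delta_{S,X}=\big[(1-\sigma_S)^{m-1}(I_{\mathcal K}-XX^* )\big]^{1/2}$. Then there are a Hilbert space $\mathcal E$ and, with $\mathcal R=\overline{\mathrm{ran}}\,\Delta_{S,X}\oplus\mathcal E$, a unitary $$U=\begin{bmatrix}A&B\\ C&D\end{bmatrix}:\mathcal D_{m,S^*}\oplus\mathcal R^n\to\mathcal D_{m,T^*}\oplus\mathcal R$$ such that for all $k\in\mathcal K$ $$U\big(D_{m,S^*}k,(\Delta_{S,X}S_1^*k,0_{\mathcal E}),\dots,(\Delta_{S,X}S_n^*k,0_{\mathcal E})\big)=\big(D_{m,T^*}X^*k,(\Delta_{S,X}k,0_{\mathcal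 E})\big),$$ and the Schur-Agler function $\Phi$ above can be taken to be the transfer function of $U^*$, that is, $$\Phi(\boldsymbol z)=A^*+C^*(I_{\mathcal R}-ZD^* )^{-1}ZB^*\qquad(\boldsymbol z\in\mathbb B^n),$$ where $Z=(z_1I_{\mathcal R},\dots,z_nI_{\mathcal R}):\mathcal R^n\to\mathcal R$ is the row operator $Z(h_1,\dots,h_n)=\sum_{i=1}^n z_ih_i$.
   Context: All Hilbert spaces are complex; $\mathbb B^n$ is the open unit ball of $\mathbb C^n$; $\mathbb Z_+^n$ denotes the $n$-tuples of nonnegative integers. For a Hilbert space $\mathcal E$, $\mathbb H_m(\mathbb B^n,\mathcal E)$ is the $\mathcal E$-valued reproducing kernel Hilbert space on $\mathbb B^n$ with kernel $(1-\langle\boldsymbol z,\boldsymbol w\rangle)^{-m}I_{\mathcal E}$; equivalently, holomorphic functions $f=\sum_{\alpha\in\mathbb Z_+^n}a_\alpha\boldsymbol z^\alpha$ with $\|f\|^2=\sum_\alpha\|a_\alpha\|^2/\rho_m(\alpha)<\infty$, where $\rho_m(\alpha)=\frac{(m+|\alpha|-1)!}{\alpha!\,(m-1)!}$. $H^2_n(\mathcal E):=\mathbb H_1(\mathbb B^n,\mathcal E)$ is the Drury-Arveson space. $M_{z_i}$ denotes multiplication by the coordinate $z_i$. For an $n$-tuple $T$ on $\mathcal H$, $\sigma_T:\mathcal B(\mathcal H)\to\mathcal B(\mathcal H)$ is $\sigma_T(Y)=\sum_{i=1}^nT_iYT_i^*$, and $(1-\sigma_T)^j$ is the $j$-th power (composition)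 of $\mathrm{id}-\sigma_T$. A commuting $n$-tuple of contractions $T$ on $\mathcal H$ is an $m$-hypercontraction if $(1-\sigma_T)^i(I_{\mathcal H})\ge0$ for $i=1$ and $i=m$; it is pure if $\sigma_T^j(I_{\mathcal H})\to0$ in the strong operator topology as $j\to\infty$. Its defect operator and defect space are $D_{m,T^*}=[(1-\sigma_T)^m(I_{\mathcal H})]^{1/2}$ and $\mathcal D_{m,T^*}=\overline{\mathrm{ran}}\,D_{m,T^*}$. For a pure $m$-hypercontraction the canonical dilation map is the isometry $\pi_T:\mathcal H\to\mathbb H_m(\mathbb B^n,\mathcal D_{m,T^*})$, $(\pi_Th)(\boldsymbol z)=\sum_{\alpha\in\mathbb Z_+^n}\rho_m(\alpha)(D_{m,T^*}T^{*\alpha}h)\boldsymbol z^\alpha$, which satisfies $\pi_TT_i^*=M_{z_i}^*\pi_T$. A Schur-Agler function $\Phi:\mathbb B^n\to\mathcal B(\mathcal E_1,\mathcal E_2)$ is a holomorphic function for which multiplication by $\Phi$ is a contraction from $H^2_n(\mathcal E_1)$ to $H^2_n(\mathcal E_2)$. For such $\Phi$, $M_\Phi:\mathbb H_m(\mathbb B^n,\mathcal E_1)\to\mathbb H_m(\mathbb B^n,\mathcal E_2)$, $f\mapsto\Phi f$, is also a (well-defined) contraction. *)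

theory Defs
  imports "HOL-Analysis.Analysis"
begin

section \<open>Complex Hilbert spaces\<close>

text \<open>
  The inner product is linear in its first argument. The zero space is allowed.
\<close>

class complex_hilbert = banach +
  fixes scaleC :: "complex \<Rightarrow> 'a \<Rightarrow> 'a" (infixr "*\<^sub>C" 75)
    and cinner :: "'a \<Rightarrow> 'a \<Rightarrow> complex"
  assumes scaleC_add_right: "c *\<^sub>C (x + y) = c *\<^sub>C x + c *\<^sub>C y"
    and scaleC_add_left: "(c + d) *\<^sub>C x = c *\<^sub>C x + d *\<^sub>C x"
    and scaleC_scaleC: "c *\<^sub>C d *\<^sub>C x = (c * d) *\<^sub>C x"
    and scaleR_scaleC: "r *\<^sub>R x = complex_of_real r *\<^sub>C x"
    and cinner_commute: "cinner x y = cnj (cinner y x)"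
    and cinner_add_left: "cinner (x + y) z = cinner x z + cinner y z"
    and cinner_scaleC_left: "cinner (c *\<^sub>C x) y = c * cinner x y"
    and norm_sq_eq_cinner: "(norm x)\<^sup>2 = Re (cinner x x)"

lemma cinner_self: "cinner x x = complex_of_real ((norm x)\<^sup>2)"
  for x :: "'a::complex_hilbert"
  using cinner_commute[of x x] by (simp add: complex_eq_iff norm_sq_eq_cinner)

lemma cinner_add_right: "cinner x (y + z) = cinner x y + cinner x z"
  for x :: "'a::complex_hilbert"
  by (metis cinner_add_left cinner_commute complex_cnj_add)

lemma norm_scaleC: "norm (c *\<^sub>C x) = cmod c * norm x"
  for x :: "'a::complex_hilbert"
proof -
  have "cinner (c *\<^sub>C x) (c *\<^sub>C x) = c * cnj c * cinner x x"
    by (metis cinner_commute cinner_scaleC_left complex_cnj_mult mult.assoc)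
  then have "(norm (c *\<^sub>C x))\<^sup>2 = (cmod c * norm x)\<^sup>2"
    unfolding cinner_self complex_norm_square[symmetric] power_mult_distrib
    by (metis of_real_eq_iff of_real_mult)
  then show ?thesis
    by (metis mult_nonneg_nonneg norm_ge_zero power2_eq_imp_eq)
qed

lemma Re_cinner_le: "Re (cinner x y) \<le> norm x * norm y"
  for x :: "'a::complex_hilbert"
proof -
  have "(norm (x + y))\<^sup>2 = (norm x)\<^sup>2 + (norm y)\<^sup>2 + 2 * Re (cinner x y)"
    unfolding norm_sq_eq_cinner using cinner_commute[of x y]
    by (simp add: cinner_add_left cinner_add_right)
  moreover have "(norm (x + y))\<^sup>2 \<le> (norm x + norm y)\<^sup>2"
    by (simp add: norm_triangle_ineq power_mono)
  ultimately show ?thesis by (simp add: power2_sum)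
qed

lemma norm_cinner_le: "cmod (cinner x y) \<le> (norm x)\<^sup>2 + (norm y)\<^sup>2"
  for x :: "'a::complex_hilbert"
proof -
  have *: "Re (c * cinner x y) \<le> norm x * norm y" if "cmod c = 1" for c
    using Re_cinner_le[of "c *\<^sub>C x" y] that by (simp add: cinner_scaleC_left norm_scaleC)
  have "\<bar>Re (cinner x y)\<bar> \<le> norm x * norm y" "\<bar>Im (cinner x y)\<bar> \<le> norm x * norm y"
    using *[of 1] *[of "-1"] *[of \<i>] *[of "-\<i>"] by auto
  then have "cmod (cinner x y) \<le> 2 * norm x * norm y"
    using cmod_le[of "cinner x y"] by linarith
  also have "\<dots> \<le> (norm x)\<^sup>2 + (norm y)\<^sup>2"
    by (rule sum_squares_bound)
  finally show ?thesis .
qed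

instantiation complex :: complex_hilbert
begin

definition scaleC_complex_def: "c *\<^sub>C x = c * (x :: complex)"

definition cinner_complex_def: "cinner x y = x * cnj (y :: complex)"

instance
  by standard (simp_all add: scaleC_complex_def cinner_complex_def distrib_left distrib_right
      scaleR_conv_of_real cmod_power2 flip: power2_eq_square)

end

instantiation prod :: (complex_hilbert, complex_hilbert) complex_hilbert
begin

definition scaleC_prod_def: "c *\<^sub>C p = (c *\<^sub>C fst p, c *\<^sub>C snd p)"

definition cinner_prod_def: "cinner p q = cinner (fst p) (fst q) + cinner (snd p) (snd q)"

instance
proof
  fix p q :: "'a \<times> 'b"
  show "cinner p q = cnj (cinner q p)"
    by (metis cinner_commute cinner_prod_def complex_cnj_add)
qed (auto simp: scaleC_prod_def cinner_prod_def scaleC_add_right scaleC_add_left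
    scaleC_scaleC scaleR_scaleC[symmetric] scaleR_prod_def cinner_add_left cinner_scaleC_left
    algebra_simps norm_prod_def norm_sq_eq_cinner[symmetric])

end

instantiation vec :: (complex_hilbert, finite) complex_hilbert
begin

definition scaleC_vec_def: "c *\<^sub>C v = (\<chi> i. c *\<^sub>C (v $ i))"

definition cinner_vec_def: "cinner v w = (\<Sum>i\<in>UNIV. cinner (v $ i) (w $ i))"

instance
proof
  fix v w :: "'a ^ 'b"
  show "cinner v w = cnj (cinner w v)"
    unfolding cinner_vec_def cnj_sum by (metis cinner_commute)
qed (auto simp: scaleC_vec_def cinner_vec_def vec_eq_iff scaleC_add_right scaleC_add_left
    scaleC_scaleC scaleR_scaleC[symmetric] cinner_add_left cinner_scaleC_left sum.distrib
    sum_distrib_left norm_vec_def L2_set_def norm_sq_eq_cinner[symmetric] sum_nonneg)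

end


section \<open>Square-summable sequences\<close>

text \<open>
  The auxiliary Hilbert space of the dilation theorem is obtained as a closed subspace of
  \<open>\<ell>\<^sup>2(\<nat>; \<H> \<oplus> \<K>)\<close>, since an existential quantifier cannot range over types.
\<close>

typedef (overloaded) 'a l2seq =
    "{f :: nat \<Rightarrow> 'a::complex_hilbert. summable (\<lambda>i. (norm (f i))\<^sup>2)}"
  by (rule exI[of _ "\<lambda>_. 0"]) simp

setup_lifting type_definition_l2seq

lemma l2seq_partial_sum_add_le:
  fixes f g :: "nat \<Rightarrow> 'a::real_normed_vector"
  assumes "summable (\<lambda>i. (norm (f i))\<^sup>2)" "summable (\<lambda>i. (norm (g i))\<^sup>2)"
  shows "(\<Sum>i<N. (norm (f i + g i))\<^sup>2)
    \<le> (sqrt (\<Sum>i. (norm (f i))\<^sup>2) + sqrt (\<Sum>i. (norm (g i))\<^sup>2))\<^sup>2"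
proof -
  have "L2_set (\<lambda>i. norm (f i + g i)) {..<N}
      \<le> L2_set (\<lambda>i. norm (f i) + norm (g i)) {..<N}"
    by (rule L2_set_mono) (auto simp: norm_triangle_ineq)
  also have "\<dots> \<le> L2_set (\<lambda>i. norm (f i)) {..<N} + L2_set (\<lambda>i. norm (g i)) {..<N}"
    by (rule L2_set_triangle_ineq)
  also have "\<dots> \<le> sqrt (\<Sum>i. (norm (f i))\<^sup>2) + sqrt (\<Sum>i. (norm (g i))\<^sup>2)"
    unfolding L2_set_def
    by (intro add_mono real_sqrt_le_mono sum_le_suminf assms) auto
  finally have "(L2_set (\<lambda>i. norm (f i + g i)) {..<N})\<^sup>2
      \<le> (sqrt (\<Sum>i. (norm (f i))\<^sup>2) + sqrt (\<Sum>i. (norm (g i))\<^sup>2))\<^sup>2"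
    by (intro power_mono) (auto simp: L2_set_nonneg)
  then show ?thesis
    by (simp add: L2_set_def sum_nonneg)
qed

lemma l2seq_summable_add:
  fixes f g :: "nat \<Rightarrow> 'a::real_normed_vector"
  assumes "summable (\<lambda>i. (norm (f i))\<^sup>2)" "summable (\<lambda>i. (norm (g i))\<^sup>2)"
  shows "summable (\<lambda>i. (norm (f i + g i))\<^sup>2)"
  by (rule summableI_nonneg_bounded[OF _ l2seq_partial_sum_add_le[OF assms]]) simp

lemma l2seq_summable_scaleC:
  fixes f :: "nat \<Rightarrow> 'a::complex_hilbert"
  assumes "summable (\<lambda>i. (norm (f i))\<^sup>2)"
  shows "summable (\<lambda>i. (norm (c *\<^sub>C f i))\<^sup>2)"
  unfolding norm_scaleC power_mult_distrib by (intro summable_mult assms)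

lemma l2seq_summable_cinner:
  fixes f g :: "nat \<Rightarrow> 'a::complex_hilbert"
  assumes "summable (\<lambda>i. (norm (f i))\<^sup>2)" "summable (\<lambda>i. (norm (g i))\<^sup>2)"
  shows "summable (\<lambda>i. cinner (f i) (g i))"
  by (rule summable_comparison_test'[OF summable_add[OF assms]]) (simp add: norm_cinner_le)

instantiation l2seq :: (complex_hilbert) real_normed_vector
begin

lift_definition zero_l2seq :: "'a l2seq" is "\<lambda>_. 0" by simp

lift_definition plus_l2seq :: "'a l2seq \<Rightarrow> 'a l2seq \<Rightarrow> 'a l2seq" is "\<lambda>f g i. f i + g i"
  by (rule l2seq_summable_add)

lift_definition uminus_l2seq :: "'a l2seq \<Rightarrow> 'a l2seq" is "\<lambda>f i. - f i" by simp

lift_definition minus_l2seq :: "'a l2seq \<Rightarrow> 'a l2seq \<Rightarrow> 'a l2seq" is "\<lambda>f g i. f i - g i"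
  using l2seq_summable_add[where g = "\<lambda>i. - g i" for g] by fastforce

lift_definition scaleR_l2seq :: "real \<Rightarrow> 'a l2seq \<Rightarrow> 'a l2seq" is "\<lambda>r f i. r *\<^sub>R f i"
  unfolding scaleR_scaleC by (rule l2seq_summable_scaleC)

lift_definition norm_l2seq :: "'a l2seq \<Rightarrow> real" is "\<lambda>f. sqrt (\<Sum>i. (norm (f i))\<^sup>2)" .

definition dist_l2seq_def: "dist f g = norm (f - g)" for f g :: "'a l2seq"

definition sgn_l2seq_def: "sgn f = inverse (norm f) *\<^sub>R f" for f :: "'a l2seq"

definition uniformity_l2seq_def:
  "(uniformity :: ('a l2seq \<times> 'a l2seq) filter) =
     (INF e\<in>{0<..}. principal {(x, y). dist x y < e})"

definition open_l2seq_def: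
  "open (U :: 'a l2seq set) \<longleftrightarrow> (\<forall>x\<in>U. \<forall>\<^sub>F (x', y) in uniformity. x' = x \<longrightarrow> y \<in> U)"

lemma norm_l2seq_le_iff:
  assumes "0 \<le> c"
  shows "norm f \<le> c \<longleftrightarrow> (\<forall>N. (\<Sum>i<N. (norm (Rep_l2seq f i))\<^sup>2) \<le> c\<^sup>2)"
proof -
  have s: "summable (\<lambda>i. (norm (Rep_l2seq f i))\<^sup>2)"
    using Rep_l2seq[of f] by simp
  have "norm f \<le> c \<longleftrightarrow> (\<Sum>i. (norm (Rep_l2seq f i))\<^sup>2) \<le> c\<^sup>2"
    unfolding norm_l2seq.rep_eq using assms real_sqrt_le_iff[of _ "c\<^sup>2"] by simp
  also have "\<dots> \<longleftrightarrow> (\<forall>N. (\<Sum>i<N. (norm (Rep_l2seq f i))\<^sup>2) \<le> c\<^sup>2)"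
  proof
    assume "(\<Sum>i. (norm (Rep_l2seq f i))\<^sup>2) \<le> c\<^sup>2"
    then show "\<forall>N. (\<Sum>i<N. (norm (Rep_l2seq f i))\<^sup>2) \<le> c\<^sup>2"
      using sum_le_suminf[OF s finite_lessThan] order_trans by (metis zero_le_power2)
  next
    assume "\<forall>N. (\<Sum>i<N. (norm (Rep_l2seq f i))\<^sup>2) \<le> c\<^sup>2"
    then show "(\<Sum>i. (norm (Rep_l2seq f i))\<^sup>2) \<le> c\<^sup>2"
      by (intro suminf_le_const s) auto
  qed
  finally show ?thesis .
qed

lemma norm_Rep_l2seq_le: "norm (Rep_l2seq f i) \<le> norm f"
proof -
  have s: "summable (\<lambda>i. (norm (Rep_l2seq f i))\<^sup>2)"
    using Rep_l2seq[of f] by simp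
  have "(\<Sum>i\<in>{i}. (norm (Rep_l2seq f i))\<^sup>2) \<le> (\<Sum>i. (norm (Rep_l2seq f i))\<^sup>2)"
    by (rule sum_le_suminf[OF s]) auto
  then show ?thesis
    unfolding norm_l2seq.rep_eq by (intro real_le_rsqrt) simp
qed

instance
proof
  fix f g h :: "'a l2seq" and a b :: real
  show "f + g + h = f + (g + h)" by transfer (simp add: add.assoc)
  show "f + g = g + f" by transfer (simp add: add.commute)
  show "0 + f = f" by transfer simp
  show "- f + f = 0" by transfer simp
  show "f - g = f + - g" by transfer simp
  show "a *\<^sub>R (f + g) = a *\<^sub>R f + a *\<^sub>R g" by transfer (simp add: scaleR_add_right)
  show "(a + b) *\<^sub>R f = a *\<^sub>R f + b *\<^sub>R f" by transfer (simp add: scaleR_add_left)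
  show "a *\<^sub>R b *\<^sub>R f = (a * b) *\<^sub>R f" by transfer simp
  show "1 *\<^sub>R f = f" by transfer simp
  show "dist f g = norm (f - g)" by (rule dist_l2seq_def)
  show "sgn f = inverse (norm f) *\<^sub>R f" by (rule sgn_l2seq_def)
  show "(uniformity :: ('a l2seq \<times> 'a l2seq) filter) =
     (INF e\<in>{0<..}. principal {(x, y). dist x y < e})" by (rule uniformity_l2seq_def)
  show "open U \<longleftrightarrow> (\<forall>x\<in>U. \<forall>\<^sub>F (x', y) in uniformity. x' = x \<longrightarrow> y \<in> U)"
    for U :: "'a l2seq set" by (rule open_l2seq_def)
  show "norm f = 0 \<longleftrightarrow> f = 0"
    by transfer (auto simp: suminf_eq_zero_iff)
  show "norm (f + g) \<le> norm f + norm g"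
  proof -
    have "0 \<le> norm f + norm g"
      using norm_Rep_l2seq_le[of f 0] norm_Rep_l2seq_le[of g 0]
        norm_ge_zero[of "Rep_l2seq f 0"] norm_ge_zero[of "Rep_l2seq g 0"] by linarith
    then show ?thesis
      unfolding norm_l2seq_le_iff[OF \<open>0 \<le> norm f + norm g\<close>]
      using Rep_l2seq[of f] Rep_l2seq[of g]
      by (auto simp: plus_l2seq.rep_eq norm_l2seq.rep_eq intro!: l2seq_partial_sum_add_le)
  qed
  show "norm (a *\<^sub>R f) = \<bar>a\<bar> * norm f"
    by transfer (simp add: power_mult_distrib suminf_mult real_sqrt_mult)
qed

end

instantiation l2seq :: (complex_hilbert) complex_hilbert
begin

lift_definition scaleC_l2seq :: "complex \<Rightarrow> 'a l2seq \<Rightarrow> 'a l2seq" is "\<lambda>c f i. c *\<^sub>C f i"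
  by (rule l2seq_summable_scaleC)

lift_definition cinner_l2seq :: "'a l2seq \<Rightarrow> 'a l2seq \<Rightarrow> complex"
  is "\<lambda>f g. \<Sum>i. cinner (f i) (g i)" .

instance
proof
  fix f g h :: "'a l2seq" and a :: real and c d :: complex
  show "c *\<^sub>C (f + g) = c *\<^sub>C f + c *\<^sub>C g" by transfer (simp add: scaleC_add_right)
  show "(c + d) *\<^sub>C f = c *\<^sub>C f + d *\<^sub>C f" by transfer (simp add: scaleC_add_left)
  show "c *\<^sub>C d *\<^sub>C f = (c * d) *\<^sub>C f" by transfer (simp add: scaleC_scaleC)
  show "a *\<^sub>R f = complex_of_real a *\<^sub>C f" by transfer (simp add: scaleR_scaleC)
  show "cinner f g = cnj (cinner g f)"
  proof (transfer)
    fix f g :: "nat \<Rightarrow> 'a"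
    assume "summable (\<lambda>i. (norm (f i))\<^sup>2)" "summable (\<lambda>i. (norm (g i))\<^sup>2)"
    then have "summable (\<lambda>i. cinner (g i) (f i))"
      by (intro l2seq_summable_cinner)
    then have "(\<lambda>i. cnj (cinner (g i) (f i))) sums cnj (\<Sum>i. cinner (g i) (f i))"
      by (simp add: sums_cnj summable_sums)
    then show "(\<Sum>i. cinner (f i) (g i)) = cnj (\<Sum>i. cinner (g i) (f i))"
      unfolding cinner_commute[symmetric] by (rule sums_unique[symmetric])
  qed
  show "cinner (f + g) h = cinner f h + cinner g h"
    by transfer (simp add: cinner_add_left suminf_add l2seq_summable_cinner)
  show "cinner (c *\<^sub>C f) g = c * cinner f g"
    by transfer (simp add: cinner_scaleC_left suminf_mult l2seq_summable_cinner)
  show "(norm f)\<^sup>2 = Re (cinner f f)"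
    by transfer (simp add: cinner_self suminf_of_real[symmetric] suminf_nonneg del: of_real_power)
next
  fix X :: "nat \<Rightarrow> 'a l2seq"
  assume X: "Cauchy X"
  have "Cauchy (\<lambda>n. Rep_l2seq (X n) i)" for i
  proof (rule metric_CauchyI)
    fix e :: real
    assume "0 < e"
    then obtain M where "\<forall>m\<ge>M. \<forall>n\<ge>M. norm (X m - X n) < e"
      using X unfolding Cauchy_def dist_norm by blast
    then show "\<exists>M. \<forall>m\<ge>M. \<forall>n\<ge>M. dist (Rep_l2seq (X m) i) (Rep_l2seq (X n) i) < e"
      using norm_Rep_l2seq_le[of "X m - X n" i for m n]
      unfolding dist_norm minus_l2seq.rep_eq by (meson le_less_trans)
  qed
  then have "\<exists>l. (\<lambda>n. Rep_l2seq (X n) i) \<longlonglongrightarrow> l" for i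
    using Cauchy_convergent convergent_def by blast
  then obtain l where l: "\<And>i. (\<lambda>n. Rep_l2seq (X n) i) \<longlonglongrightarrow> l i"
    by metis
  have bound: "\<exists>M. \<forall>m\<ge>M. \<forall>N. (\<Sum>i<N. (norm (Rep_l2seq (X m) i - l i))\<^sup>2) \<le> e\<^sup>2"
    if "0 < e" for e :: real
  proof -
    obtain M where M: "\<forall>m\<ge>M. \<forall>n\<ge>M. norm (X m - X n) < e"
      using X \<open>0 < e\<close> unfolding Cauchy_def dist_norm by blast
    have "(\<Sum>i<N. (norm (Rep_l2seq (X m) i - l i))\<^sup>2) \<le> e\<^sup>2" if "m \<ge> M" for m N
    proof (rule LIMSEQ_le_const2)
      show "(\<lambda>n. \<Sum>i<N. (norm (Rep_l2seq (X m) i - Rep_l2seq (X n) i))\<^sup>2)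
          \<longlonglongrightarrow> (\<Sum>i<N. (norm (Rep_l2seq (X m) i - l i))\<^sup>2)"
        by (intro tendsto_intros l)
      show "\<exists>k. \<forall>n\<ge>k. (\<Sum>i<N. (norm (Rep_l2seq (X m) i - Rep_l2seq (X n) i))\<^sup>2) \<le> e\<^sup>2"
      proof (intro exI[of _ M] allI impI)
        fix n
        assume "M \<le> n"
        then have "norm (X m - X n) \<le> e"
          using M that by (simp add: less_imp_le)
        then show "(\<Sum>i<N. (norm (Rep_l2seq (X m) i - Rep_l2seq (X n) i))\<^sup>2) \<le> e\<^sup>2"
          using norm_l2seq_le_iff[of e "X m - X n"] \<open>0 < e\<close>
          by (simp add: minus_l2seq.rep_eq)
      qed
    qed
    then show ?thesis by blast
  qed
  obtain M where M: "\<And>N. (\<Sum>i<N. (norm (Rep_l2seq (X M) i - l i))\<^sup>2) \<le> 1"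
    using bound[of 1] by auto
  have "summable (\<lambda>i. (norm (Rep_l2seq (X M) i - l i))\<^sup>2)"
    by (rule summableI_nonneg_bounded[OF _ M]) simp
  then have "summable (\<lambda>i. (norm (l i - Rep_l2seq (X M) i))\<^sup>2)"
    by (simp add: norm_minus_commute)
  from l2seq_summable_add[OF this, of "Rep_l2seq (X M)"] Rep_l2seq[of "X M"]
  have sl: "summable (\<lambda>i. (norm (l i))\<^sup>2)"
    by simp
  define L where "L = Abs_l2seq l"
  have L: "Rep_l2seq L = l"
    unfolding L_def using sl by (simp add: Abs_l2seq_inverse)
  have "X \<longlonglongrightarrow> L"
  proof (rule metric_LIMSEQ_I)
    fix e :: real
    assume "0 < e"
    then obtain M where "\<forall>m\<ge>M. \<forall>N. (\<Sum>i<N. (norm (Rep_l2seq (X m) i - l i))\<^sup>2) \<le> (e/2)\<^sup>2"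
      using bound[of "e/2"] by auto
    then have "\<forall>m\<ge>M. norm (X m - L) \<le> e/2"
      using \<open>0 < e\<close> by (subst norm_l2seq_le_iff) (auto simp: minus_l2seq.rep_eq L)
    then show "\<exists>M. \<forall>m\<ge>M. dist (X m) L < e"
      unfolding dist_norm using \<open>0 < e\<close> by (intro exI[of _ M]) force
  qed
  then show "convergent X"
    unfolding convergent_def by blast
qed

end


section \<open>Operators between closed subspaces\<close>

text \<open>
  An operator between closed subspaces \<open>V\<close> and \<open>W\<close> of two Hilbert spaces is a function on the
  ambient types of which only the restriction to \<open>V\<close> matters.
\<close>

definition closed_csubspace :: "'a::complex_hilbert set \<Rightarrow> bool" where
  "closed_csubspace V \<longleftrightarrow> closed V \<and> 0 \<in> V \<and> (\<forall>x\<in>V. \<forall>y\<in>V. x + y \<in> V) \<and>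
     (\<forall>c. \<forall>x\<in>V. c *\<^sub>C x \<in> V)"

definition clinear_on :: "'a::complex_hilbert set \<Rightarrow> ('a \<Rightarrow> 'b::complex_hilbert) \<Rightarrow> bool" where
  "clinear_on V F \<longleftrightarrow> (\<forall>x\<in>V. \<forall>y\<in>V. F (x + y) = F x + F y) \<and>
     (\<forall>c. \<forall>x\<in>V. F (c *\<^sub>C x) = c *\<^sub>C F x)"

definition bounded_op ::
    "'a::complex_hilbert set \<Rightarrow> 'b::complex_hilbert set \<Rightarrow> ('a \<Rightarrow> 'b) \<Rightarrow> bool" where
  "bounded_op V W F \<longleftrightarrow> F ` V \<subseteq> W \<and> clinear_on V F \<and> (\<exists>M. \<forall>x\<in>V. norm (F x) \<le> M * norm x)"

definition contraction :: "('a::complex_hilbert \<Rightarrow> 'b::complex_hilbert) \<Rightarrow> bool" where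
  "contraction F \<longleftrightarrow> bounded_op UNIV UNIV F \<and> (\<forall>x. norm (F x) \<le> norm x)"

definition unitary_op ::
    "'a::complex_hilbert set \<Rightarrow> 'b::complex_hilbert set \<Rightarrow> ('a \<Rightarrow> 'b) \<Rightarrow> bool" where
  "unitary_op V W U \<longleftrightarrow> clinear_on V U \<and> bij_betw U V W \<and>
     (\<forall>x\<in>V. \<forall>y\<in>V. cinner (U x) (U y) = cinner x y)"

text \<open>
  Adjoint of an operator \<open>F\<close> defined on \<open>V\<close>, with respect to inner products \<open>ip\<close> on \<open>V\<close>
  and \<open>ip'\<close> on the codomain. It exists and is unique for bounded operators on Hilbert spaces.
  The inner products are arguments because those of the spaces of holomorphic functions below
  depend on the parameter \<open>m\<close>.
\<close>

definition adjoint_wrt ::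
    "'a set \<Rightarrow> ('a \<Rightarrow> 'a \<Rightarrow> complex) \<Rightarrow> ('b \<Rightarrow> 'b \<Rightarrow> complex) \<Rightarrow> ('a \<Rightarrow> 'b) \<Rightarrow> 'b \<Rightarrow> 'a" where
  "adjoint_wrt V ip ip' F y = (THE x. x \<in> V \<and> (\<forall>v\<in>V. ip' (F v) y = ip v x))"

abbreviation adjoint_on ::
    "'a::complex_hilbert set \<Rightarrow> ('a \<Rightarrow> 'b::complex_hilbert) \<Rightarrow> 'b \<Rightarrow> 'a" where
  "adjoint_on V \<equiv> adjoint_wrt V cinner cinner"

abbreviation adj :: "('a::complex_hilbert \<Rightarrow> 'b::complex_hilbert) \<Rightarrow> 'b \<Rightarrow> 'a" where
  "adj \<equiv> adjoint_on UNIV"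

definition positive_op :: "('a::complex_hilbert \<Rightarrow> 'a) \<Rightarrow> bool" where
  "positive_op A \<longleftrightarrow> bounded_op UNIV UNIV A \<and>
     (\<forall>x. Im (cinner (A x) x) = 0 \<and> 0 \<le> Re (cinner (A x) x))"

definition sqrt_op :: "('a::complex_hilbert \<Rightarrow> 'a) \<Rightarrow> 'a \<Rightarrow> 'a" where
  "sqrt_op A = (THE B. positive_op B \<and> B \<circ> B = A)"


section \<open>Hypercontractions\<close>

text \<open>An \<open>n\<close>-tuple is a family indexed by a finite type with \<open>n\<close> elements.\<close>

definition sigma_op ::
    "('n::finite \<Rightarrow> 'h::complex_hilbert \<Rightarrow> 'h) \<Rightarrow> ('h \<Rightarrow> 'h) \<Rightarrow> 'h \<Rightarrow> 'h" where
  "sigma_op T Y = (\<lambda>h. \<Sum>i\<in>UNIV. T i (Y (adj (T i) h)))"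

definition one_minus_sigma ::
    "('n::finite \<Rightarrow> 'h::complex_hilbert \<Rightarrow> 'h) \<Rightarrow> ('h \<Rightarrow> 'h) \<Rightarrow> 'h \<Rightarrow> 'h" where
  "one_minus_sigma T Y = (\<lambda>h. Y h - sigma_op T Y h)"

definition hypercontraction ::
    "nat \<Rightarrow> ('n::finite \<Rightarrow> 'h::complex_hilbert \<Rightarrow> 'h) \<Rightarrow> bool" where
  "hypercontraction m T \<longleftrightarrow> (\<forall>i. contraction (T i)) \<and> (\<forall>i j. T i \<circ> T j = T j \<circ> T i) \<and>
     positive_op (one_minus_sigma T id) \<and> positive_op ((one_minus_sigma T ^^ m) id)"

definition pure_tuple :: "('n::finite \<Rightarrow> 'h::complex_hilbert \<Rightarrow> 'h) \<Rightarrow> bool" where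
  "pure_tuple T \<longleftrightarrow> (\<forall>h. (\<lambda>j. (sigma_op T ^^ j) id h) \<longlonglongrightarrow> 0)"

definition defect_op ::
    "nat \<Rightarrow> ('n::finite \<Rightarrow> 'h::complex_hilbert \<Rightarrow> 'h) \<Rightarrow> 'h \<Rightarrow> 'h" where
  "defect_op m T = sqrt_op ((one_minus_sigma T ^^ m) id)"

definition defect_space ::
    "nat \<Rightarrow> ('n::finite \<Rightarrow> 'h::complex_hilbert \<Rightarrow> 'h) \<Rightarrow> 'h set" where
  "defect_space m T = closure (range (defect_op m T))"


section \<open>The spaces \<open>\<bbbH>\<^sub>m(\<bbbB>\<^sup>n, E)\<close>\<close>

text \<open>Multi-indices are functions \<open>\<alpha> :: 'n \<Rightarrow> nat\<close>, and \<open>ball 0 1\<close> in \<open>complex ^ 'n\<close> is the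
  Euclidean unit ball.\<close>

definition rho :: "nat \<Rightarrow> ('n::finite \<Rightarrow> nat) \<Rightarrow> real" where
  "rho m \<alpha> = fact (m + sum \<alpha> UNIV - 1) / ((\<Prod>i\<in>UNIV. fact (\<alpha> i)) * fact (m - 1))"

definition zpow :: "complex ^ 'n \<Rightarrow> ('n::finite \<Rightarrow> nat) \<Rightarrow> complex" where
  "zpow z \<alpha> = (\<Prod>i\<in>UNIV. (z $ i) ^ \<alpha> i)"

text \<open>For commuting operators the fold does not depend on the order of the factors.\<close>

definition op_pow :: "('n::finite \<Rightarrow> 'h \<Rightarrow> 'h) \<Rightarrow> ('n \<Rightarrow> nat) \<Rightarrow> 'h \<Rightarrow> 'h" where
  "op_pow T \<alpha> = Finite_Set.fold (\<lambda>i F. (T i ^^ \<alpha> i) \<circ> F) id UNIV"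

definition has_power_series ::
    "(complex ^ 'n \<Rightarrow> 'a::complex_hilbert) \<Rightarrow> (('n::finite \<Rightarrow> nat) \<Rightarrow> 'a) \<Rightarrow> bool" where
  "has_power_series f a \<longleftrightarrow> (\<forall>z\<in>ball 0 1. ((\<lambda>\<alpha>. zpow z \<alpha> *\<^sub>C a \<alpha>) has_sum f z) UNIV)"

definition coeffs ::
    "(complex ^ 'n \<Rightarrow> 'a::complex_hilbert) \<Rightarrow> ('n::finite \<Rightarrow> nat) \<Rightarrow> 'a" where
  "coeffs f = (THE a. has_power_series f a)"

text \<open>
  Functions on the ball are represented by functions on all of \<open>complex ^ 'n\<close> that vanish outside
  the ball, so that they are equal as elements of the space only if they are equal.
\<close>

definition Hm ::
    "nat \<Rightarrow> 'a::complex_hilbert set \<Rightarrow> (complex ^ 'n::finite \<Rightarrow> 'a) set" where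
  "Hm m E = {f. (\<forall>z. z \<notin> ball 0 1 \<longrightarrow> f z = 0) \<and>
     (\<exists>a. has_power_series f a \<and> range a \<subseteq> E \<and>
       (\<lambda>\<alpha>. (norm (a \<alpha>))\<^sup>2 / rho m \<alpha>) summable_on UNIV)}"

definition Hm_inner ::
    "nat \<Rightarrow> (complex ^ 'n::finite \<Rightarrow> 'a::complex_hilbert) \<Rightarrow> (complex ^ 'n \<Rightarrow> 'a) \<Rightarrow> complex" where
  "Hm_inner m f g =
     (\<Sum>\<^sub>\<infinity>\<alpha>. cinner (coeffs f \<alpha>) (coeffs g \<alpha>) / complex_of_real (rho m \<alpha>))"

definition Hm_norm :: "nat \<Rightarrow> (complex ^ 'n::finite \<Rightarrow> 'a::complex_hilbert) \<Rightarrow> real" where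
  "Hm_norm m f = sqrt (\<Sum>\<^sub>\<infinity>\<alpha>. (norm (coeffs f \<alpha>))\<^sup>2 / rho m \<alpha>)"

definition canonical_dilation ::
    "nat \<Rightarrow> ('n::finite \<Rightarrow> 'h::complex_hilbert \<Rightarrow> 'h) \<Rightarrow> 'h \<Rightarrow> complex ^ 'n \<Rightarrow> 'h" where
  "canonical_dilation m T h = (\<lambda>z. if z \<in> ball 0 1
     then \<Sum>\<^sub>\<infinity>\<alpha>. zpow z \<alpha> *\<^sub>C rho m \<alpha> *\<^sub>R defect_op m T (op_pow (\<lambda>i. adj (T i)) \<alpha> h)
     else 0)"


section \<open>Schur-Agler functions\<close>

text \<open>Complex differentiability on the ball with respect to the operator norm of \<open>\<B>(V, W)\<close>;
  the \<open>L i\<close> are the partial derivatives at \<open>z\<close>.\<close>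

definition op_holomorphic ::
    "'a::complex_hilbert set \<Rightarrow> 'b::complex_hilbert set \<Rightarrow> (complex ^ 'n::finite \<Rightarrow> 'a \<Rightarrow> 'b) \<Rightarrow> bool"
  where
  "op_holomorphic V W \<Phi> \<longleftrightarrow> (\<forall>z\<in>ball 0 1. bounded_op V W (\<Phi> z)) \<and>
     (\<forall>z\<in>ball 0 1. \<exists>L. (\<forall>i. bounded_op V W (L i)) \<and>
       (\<forall>e>0. \<exists>d>0. \<forall>w\<in>ball 0 1. dist w z < d \<longrightarrow>
         (\<forall>x\<in>V. norm (\<Phi> w x - \<Phi> z x - (\<Sum>i\<in>UNIV. (w $ i - z $ i) *\<^sub>C L i x))
            \<le> e * norm (w - z) * norm x)))"

definition mult_op ::
    "(complex ^ 'n::finite \<Rightarrow> 'a \<Rightarrow> 'b::zero) \<Rightarrow> (complex ^ 'n \<Rightarrow> 'a) \<Rightarrow> complex ^ 'n \<Rightarrow> 'b" where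
  "mult_op \<Phi> f = (\<lambda>z. if z \<in> ball 0 1 then \<Phi> z (f z) else 0)"

definition mult_op_adj ::
    "nat \<Rightarrow> 'a::complex_hilbert set \<Rightarrow> (complex ^ 'n::finite \<Rightarrow> 'a \<Rightarrow> 'b::complex_hilbert) \<Rightarrow>
      (complex ^ 'n \<Rightarrow> 'b) \<Rightarrow> complex ^ 'n \<Rightarrow> 'a" where
  "mult_op_adj m V \<Phi> = adjoint_wrt (Hm m V) (Hm_inner m) (Hm_inner m) (mult_op \<Phi>)"

definition schur_agler ::
    "'a::complex_hilbert set \<Rightarrow> 'b::complex_hilbert set \<Rightarrow> (complex ^ 'n::finite \<Rightarrow> 'a \<Rightarrow> 'b) \<Rightarrow> bool"
  where
  "schur_agler V W \<Phi> \<longleftrightarrow> op_holomorphic V W \<Phi> \<and>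
     (\<forall>f\<in>Hm 1 V. mult_op \<Phi> f \<in> Hm 1 W \<and> Hm_norm 1 (mult_op \<Phi> f) \<le> Hm_norm 1 f)"


section \<open>Transfer functions\<close>

definition vec_space :: "'a set \<Rightarrow> ('a ^ 'n) set" where
  "vec_space R = {v. \<forall>i. v $ i \<in> R}"

definition row_op :: "complex ^ 'n::finite \<Rightarrow> 'a::complex_hilbert ^ 'n \<Rightarrow> 'a" where
  "row_op z v = (\<Sum>i\<in>UNIV. (z $ i) *\<^sub>C (v $ i))"

definition block_op ::
    "('a \<Rightarrow> 'c) \<Rightarrow> ('b \<Rightarrow> 'c::plus) \<Rightarrow> ('a \<Rightarrow> 'd) \<Rightarrow> ('b \<Rightarrow> 'd::plus) \<Rightarrow> 'a \<times> 'b \<Rightarrow> 'c \<times> 'd" where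
  "block_op A B C D = (\<lambda>(x, y). (A x + B y, C x + D y))"

text \<open>
  The transfer function \<open>A\<^sup>* + C\<^sup>* (I - Z D\<^sup>*)\<inverse> Z B\<^sup>*\<close> of the adjoint of
  \<open>block_op A B C D\<close>, where \<open>A\<close>, \<open>C\<close> are defined on \<open>V\<close> and \<open>B\<close>, \<open>D\<close> on \<open>R\<^sup>n\<close>. When the block
  operator is unitary, \<open>I - Z D\<^sup>*\<close> is a bijection of \<open>R\<close> by the Neumann series, as \<open>\<parallel>Z D\<^sup>*\<parallel> < 1\<close>.
\<close>

definition adj_transfer ::
    "'a::complex_hilbert set \<Rightarrow> 'r::complex_hilbert set \<Rightarrow>
      ('a \<Rightarrow> 'b::complex_hilbert) \<Rightarrow> ('r ^ 'n \<Rightarrow> 'b) \<Rightarrow> ('a \<Rightarrow> 'r) \<Rightarrow> ('r ^ 'n \<Rightarrow> 'r) \<Rightarrow>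
      complex ^ 'n::finite \<Rightarrow> 'b \<Rightarrow> 'a" where
  "adj_transfer V R A B C D z = (\<lambda>x. adjoint_on V A x +
     adjoint_on V C (inv_into R (\<lambda>r. r - row_op z (adjoint_on (vec_space R) D r))
       (row_op z (adjoint_on (vec_space R) B x))))"

end

theory Submission
  imports Defs "HOL-Library.Function_Algebras"
begin

text \<open>
  Dividing the coefficients of a function in \<open>\<bbbH>\<^sub>m\<close> by \<open>\<rho>\<^sub>m\<close>, the relation
  \<open>\<pi>\<^sub>T X\<^sup>* = M\<^sub>\<Phi>\<^sup>* \<pi>\<^sub>S\<close> becomes \<open>D\<^sub>T X\<^sup>* k = \<Sum>\<^sub>\<beta> \<Phi>\<^sub>\<beta>\<^sup>* D\<^sub>S S\<^sup>*\<^sup>\<beta> k\<close> for all \<open>k\<close>, which does not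
  involve the weight. By purity \<open>\<Sum>\<^sub>\<alpha> \<rho>\<^sub>1(\<alpha>) \<parallel>D\<^sub>T T\<^sup>*\<^sup>\<alpha> h\<parallel>\<^sup>2\<close> is the quadratic form of
  \<open>(1 - \<sigma>\<^sub>T)\<^sup>m\<^sup>-\<^sup>1(I)\<close>, so that positivity of \<open>P = (1 - \<sigma>\<^sub>S)\<^sup>m\<^sup>-\<^sup>1(I - X X\<^sup>*)\<close> expresses the
  contractivity of \<open>M\<^sub>\<Phi>\<^sup>*\<close> in the space of weight \<open>m = 1\<close>.

  Conversely \<open>P - \<sigma>\<^sub>S(P) = D\<^sub>S\<^sup>2 - X D\<^sub>T\<^sup>2 X\<^sup>*\<close> says that
  \<open>(D\<^sub>S k, (\<Delta> S\<^sub>i\<^sup>* k)\<^sub>i) \<mapsto> (D\<^sub>T X\<^sup>* k, \<Delta> k)\<close> is isometric. It extends to a unitary after adding a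
  sufficiently large auxiliary space, and the coefficients of the transfer function satisfy the
  relation above by telescoping over the degree: the remainder in degree \<open>N\<close> is controlled by
  \<open>\<langle>\<sigma>\<^sub>S\<^sup>N(P) k, k\<rangle>\<close>, which tends to \<open>0\<close> by purity.
\<close>

section \<open>Geometry of complex Hilbert spaces\<close>

text \<open>The hypothesis on \<open>\<Phi>\<close> is contractivity at weight 1, while the
  dilations live at weight \<open>m\<close>. The bridge is the identity
  \<open>(1 - x)^(-m) = (1 - x)^(-(m-1)) (1 - x)^(-1)\<close> for
  \<open>x = z_1 + ... + z_n\<close>: for \<open>m \<ge> 2\<close> it says on coefficients that
  \<open>rho m\<close> is the convolution of \<open>rho (m - 1)\<close> and \<open>rho 1\<close>. It
  carries multiplier bounds from weight 1 to weight \<open>m\<close>, which is what makes the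
  adjoint at weight \<open>m\<close> available, and it bounds the weighted coefficients of the
  dilations. In the converse direction the obstacle is that the closed domain and range of the
  isometry may have orthogonal complements of different dimensions. The space of all square-summable
  sequences in \<open>H \<oplus> K\<close> absorbs \<open>n\<close> copies of itself together with
  the defect spaces, so each complement embeds isometrically into the other, and a
  Schroeder-Bernstein argument replaces any count of dimensions. It is \<open>U\<close> rather than
  its adjoint that is prescribed on vectors, because the relation to be proved involves the adjoints
  of the coefficients of \<open>\<Phi>\<close>.\<close>

lemma scaleC_one [simp]: "1 *\<^sub>C x = x"
  for x :: "'a::complex_hilbert"
  using scaleR_scaleC[of 1 x] by simp

lemma scaleC_zero_left [simp]: "0 *\<^sub>C x = 0"
  for x :: "'a::complex_hilbert"
  using scaleR_scaleC[of 0 x] by simp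

lemma scaleC_minus_one [simp]: "(-1) *\<^sub>C x = - x"
  for x :: "'a::complex_hilbert"
  using scaleR_scaleC[of "-1" x] by simp

lemma scaleC_zero_right [simp]: "c *\<^sub>C 0 = 0"
  for c :: complex
  using scaleC_add_right[of c 0 0] by simp

lemma scaleC_minus_right: "c *\<^sub>C (- x) = - (c *\<^sub>C x)"
  for x :: "'a::complex_hilbert"
  using scaleC_add_right[of c x "- x"] by (simp add: eq_neg_iff_add_eq_0 add.commute)

lemma scaleC_diff_right: "c *\<^sub>C (x - y) = c *\<^sub>C x - c *\<^sub>C y"
  for x :: "'a::complex_hilbert"
  using scaleC_add_right[of c x "- y"] by (simp add: scaleC_minus_right)

lemma scaleC_minus_left: "(- c) *\<^sub>C x = - (c *\<^sub>C x)"
  for x :: "'a::complex_hilbert"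
  using scaleC_add_left[of c "- c" x] by (simp add: eq_neg_iff_add_eq_0 add.commute)

lemma scaleC_diff_left: "(c - d) *\<^sub>C x = c *\<^sub>C x - d *\<^sub>C x"
  for x :: "'a::complex_hilbert"
  using scaleC_add_left[of c "- d" x] by (simp add: scaleC_minus_left)

lemma scaleC_sum_right: "c *\<^sub>C (\<Sum>i\<in>A. f i) = (\<Sum>i\<in>A. c *\<^sub>C f i)"
  for f :: "'i \<Rightarrow> 'a::complex_hilbert"
  by (induction A rule: infinite_finite_induct) (auto simp: scaleC_add_right)

lemma scaleC_complex [simp]: "c *\<^sub>C x = c * x" for x :: complex
  by (simp add: scaleC_complex_def)

lemma cinner_scaleC_right: "cinner x (c *\<^sub>C y) = cnj c * cinner x y"
  for x :: "'a::complex_hilbert"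
  by (metis cinner_commute cinner_scaleC_left complex_cnj_mult)

lemma cinner_zero_left [simp]: "cinner 0 x = 0"
  for x :: "'a::complex_hilbert"
  using cinner_add_left[of 0 0 x] by simp

lemma cinner_zero_right [simp]: "cinner x 0 = 0"
  for x :: "'a::complex_hilbert"
  using cinner_add_right[of x 0 0] by simp

lemma cinner_minus_left: "cinner (- x) y = - cinner x y"
  for x :: "'a::complex_hilbert"
  using cinner_scaleC_left[of "-1" x y] by simp

lemma cinner_minus_right: "cinner x (- y) = - cinner x y"
  for x :: "'a::complex_hilbert"
  using cinner_scaleC_right[of x "-1" y] by simp

lemma cinner_diff_left: "cinner (x - y) z = cinner x z - cinner y z"
  for x :: "'a::complex_hilbert"
  using cinner_add_left[of x "- y" z] by (simp add: cinner_minus_left)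

lemma cinner_diff_right: "cinner x (y - z) = cinner x y - cinner x z"
  for x :: "'a::complex_hilbert"
  using cinner_add_right[of x y "- z"] by (simp add: cinner_minus_right)

lemma cinner_sum_left: "cinner (\<Sum>i\<in>A. f i) x = (\<Sum>i\<in>A. cinner (f i) x)"
  for x :: "'a::complex_hilbert"
  by (induction A rule: infinite_finite_induct) (auto simp: cinner_add_left)

lemma cinner_sum_right: "cinner x (\<Sum>i\<in>A. f i) = (\<Sum>i\<in>A. cinner x (f i))"
  for x :: "'a::complex_hilbert"
  by (induction A rule: infinite_finite_induct) (auto simp: cinner_add_right)

lemma cinner_scaleR_left: "cinner (r *\<^sub>R x) y = of_real r * cinner x y"
  for x :: "'a::complex_hilbert"
  by (simp add: scaleR_scaleC cinner_scaleC_left)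

lemma cinner_scaleR_right: "cinner x (r *\<^sub>R y) = of_real r * cinner x y"
  for x :: "'a::complex_hilbert"
  by (simp add: scaleR_scaleC cinner_scaleC_right)

lemma cinner_eq_zero_iff [simp]: "cinner x x = 0 \<longleftrightarrow> x = 0"
  for x :: "'a::complex_hilbert"
  by (simp add: cinner_self)

lemma cinner_zero_commute: "cinner x y = 0 \<longleftrightarrow> cinner y x = 0"
  for x :: "'a::complex_hilbert"
  by (metis cinner_commute complex_cnj_zero)

lemma norm_scaleC_le: "cmod c \<le> 1 \<Longrightarrow> norm (c *\<^sub>C x) \<le> norm x"
  for x :: "'a::complex_hilbert"
  by (simp add: norm_scaleC mult_left_le_one_le)

text \<open>Rotating \<open>x\<close> by the conjugate phase of \<open>cinner x y\<close> makes the
  inner product real and nonnegative, which reduces the claim to the bound on real parts.\<close>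

lemma cauchy_schwarz: "cmod (cinner x y) \<le> norm x * norm y"
  for x :: "'a::complex_hilbert"
proof (cases "cinner x y = 0")
  case False
  define c where "c = cnj (cinner x y) / cmod (cinner x y)"
  have c: "cmod c = 1"
    using False by (simp add: c_def norm_divide)
  have "c * cinner x y = cmod (cinner x y)"
    using False complex_norm_square[of "cinner x y"]
    by (simp add: c_def power2_eq_square mult.commute field_simps)
  then have "cmod (cinner x y) = Re (cinner (c *\<^sub>C x) y)"
    by (simp add: cinner_scaleC_left)
  then show ?thesis
    using Re_cinner_le[of "c *\<^sub>C x" y] c by (simp add: norm_scaleC)
qed simp

lemma bounded_bilinear_cinner: "bounded_bilinear (cinner :: 'a::complex_hilbert \<Rightarrow> 'a \<Rightarrow> complex)"
  by (unfold_locales; (rule exI[of _ 1])?)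
    (auto simp: cinner_add_left cinner_add_right cinner_scaleR_left cinner_scaleR_right
      cauchy_schwarz scaleR_conv_of_real)

lemma bounded_bilinear_scaleC: "bounded_bilinear (scaleC :: complex \<Rightarrow> 'a::complex_hilbert \<Rightarrow> 'a)"
  by (unfold_locales; (rule exI[of _ 1])?)
    (auto simp: scaleC_add_left scaleC_add_right norm_scaleC scaleR_scaleC scaleC_scaleC
      scaleR_conv_of_real mult.commute)

lemmas tendsto_cinner [tendsto_intros] = bounded_bilinear.tendsto[OF bounded_bilinear_cinner]
lemmas tendsto_scaleC [tendsto_intros] = bounded_bilinear.tendsto[OF bounded_bilinear_scaleC]
lemmas bounded_linear_cinner_left = bounded_bilinear.bounded_linear_left[OF bounded_bilinear_cinner]
lemmas bounded_linear_scaleC_right =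
  bounded_bilinear.bounded_linear_right[OF bounded_bilinear_scaleC]

section \<open>Expansion of norms and polarization\<close>

lemma norm_add_sq: "(norm (x + y))\<^sup>2 = (norm x)\<^sup>2 + (norm y)\<^sup>2 + 2 * Re (cinner x y)"
  for x :: "'a::complex_hilbert"
  unfolding norm_sq_eq_cinner using cinner_commute[of x y]
  by (simp add: cinner_add_left cinner_add_right)

lemma norm_diff_sq: "(norm (x - y))\<^sup>2 = (norm x)\<^sup>2 + (norm y)\<^sup>2 - 2 * Re (cinner x y)"
  for x :: "'a::complex_hilbert"
  using norm_add_sq[of x "- y"] by (simp add: cinner_minus_right)

text \<open>Serves to recover inner products from norms, so that isometries need only be checked on
  norms.\<close>

lemma polarization:
  fixes x y :: "'a::complex_hilbert"
  shows "4 * cinner x y = (norm (x + y))\<^sup>2 - (norm (x - y))\<^sup>2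
    + \<i> * ((norm (x + \<i> *\<^sub>C y))\<^sup>2 - (norm (x - \<i> *\<^sub>C y))\<^sup>2)"
  by (simp add: norm_add_sq norm_diff_sq complex_eq_iff cinner_scaleC_right)

section \<open>Closed subspaces and the Riesz representation\<close>

definition orth :: "'a::complex_hilbert set \<Rightarrow> 'a set" where
  "orth V = {x. \<forall>v\<in>V. cinner x v = 0}"

lemma csubspace_zero: "closed_csubspace V \<Longrightarrow> 0 \<in> V"
  and csubspace_add: "closed_csubspace V \<Longrightarrow> x \<in> V \<Longrightarrow> y \<in> V \<Longrightarrow> x + y \<in> V"
  and csubspace_scaleC: "closed_csubspace V \<Longrightarrow> x \<in> V \<Longrightarrow> c *\<^sub>C x \<in> V"
  and csubspace_closed: "closed_csubspace V \<Longrightarrow> closed V"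
  unfolding closed_csubspace_def by auto

lemma csubspace_scaleR: "closed_csubspace V \<Longrightarrow> x \<in> V \<Longrightarrow> r *\<^sub>R x \<in> V"
  by (simp add: scaleR_scaleC csubspace_scaleC)

lemma csubspace_minus: "closed_csubspace V \<Longrightarrow> x \<in> V \<Longrightarrow> - x \<in> V"
  using csubspace_scaleC[of V x "-1"] by simp

lemma csubspace_diff: "closed_csubspace V \<Longrightarrow> x \<in> V \<Longrightarrow> y \<in> V \<Longrightarrow> x - y \<in> V"
  using csubspace_add[of V x "- y"] csubspace_minus[of V y] by simp

lemma csubspace_sum: "closed_csubspace V \<Longrightarrow> (\<And>i. i \<in> A \<Longrightarrow> f i \<in> V) \<Longrightarrow> (\<Sum>i\<in>A. f i) \<in> V"
  by (induction A rule: infinite_finite_induct) (auto simp: csubspace_zero csubspace_add)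

lemma csubspace_UNIV [simp]: "closed_csubspace UNIV"
  by (simp add: closed_csubspace_def)

lemma csubspace_Int: "closed_csubspace V \<Longrightarrow> closed_csubspace W \<Longrightarrow> closed_csubspace (V \<inter> W)"
  by (auto simp: closed_csubspace_def)

lemma csubspace_Times:
  assumes "closed_csubspace V" "closed_csubspace W"
  shows "closed_csubspace (V \<times> W)"
  using assms by (auto simp: closed_csubspace_def closed_Times scaleC_prod_def mem_Times_iff)

lemma csubspace_vec_space:
  assumes "closed_csubspace V"
  shows "closed_csubspace (vec_space V :: ('a::complex_hilbert ^ 'n::finite) set)"
proof -
  have "vec_space V = (\<Inter>i. (\<lambda>v :: 'a ^ 'n. v $ i) -` V)"
    by (auto simp: vec_space_def)
  moreover have "closed ((\<lambda>v :: 'a ^ 'n. v $ i) -` V)" for i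
    by (intro continuous_closed_vimage csubspace_closed assms) (simp add: isCont_vec_nth)
  ultimately have "closed (vec_space V :: ('a ^ 'n) set)"
    by auto
  then show ?thesis
    using assms by (auto simp: closed_csubspace_def vec_space_def scaleC_vec_def)
qed

lemma csubspace_closure:
  assumes "0 \<in> V" "\<And>x y. x \<in> V \<Longrightarrow> y \<in> V \<Longrightarrow> x + y \<in> V" "\<And>c x. x \<in> V \<Longrightarrow> c *\<^sub>C x \<in> V"
  shows "closed_csubspace (closure V)"
  unfolding closed_csubspace_def
proof (intro conjI ballI allI)
  show "0 \<in> closure V"
    using assms(1) closure_subset by blast
  fix x y c
  assume "x \<in> closure V" "y \<in> closure V"
  then obtain f g where f: "\<And>n. f n \<in> V" "f \<longlonglongrightarrow> x" and g: "\<And>n. g n \<in> V" "g \<longlonglongrightarrow> y"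
    unfolding closure_sequential by blast
  have "(\<lambda>n. f n + g n) \<longlonglongrightarrow> x + y" "(\<lambda>n. c *\<^sub>C f n) \<longlonglongrightarrow> c *\<^sub>C x"
    by (intro tendsto_intros f g)+
  then show "x + y \<in> closure V" "c *\<^sub>C x \<in> closure V"
    unfolding closure_sequential
    by (meson assms(2)[OF f(1) g(1)], meson assms(3)[OF f(1)])
qed simp

lemma csubspace_orth: "closed_csubspace (orth V)"
proof -
  have eq: "orth V = (\<Inter>v\<in>V. (\<lambda>x. cinner x v) -` {0})"
    by (auto simp: orth_def)
  have "closed ((\<lambda>x. cinner x v) -` {0})" for v :: 'a
    by (intro continuous_closed_vimage)
      (auto intro: linear_continuous_at bounded_linear_cinner_left)
  then have "closed (orth V)"
    unfolding eq by blast
  then show ?thesis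
    by (auto simp: closed_csubspace_def orth_def cinner_add_left cinner_scaleC_left)
qed

text \<open>Orthogonality to a fixed \<open>x\<close> is a closed condition: \<open>orth {x}\<close>
  is closed, so it contains \<open>closure V\<close> as soon as it contains
  \<open>V\<close>.\<close>

lemma orth_closure: "orth (closure V) = orth V"
proof
  show "orth V \<subseteq> orth (closure V)"
  proof
    fix x assume x: "x \<in> orth V"
    have "closed_csubspace (orth {x})"
      by (rule csubspace_orth)
    moreover have "V \<subseteq> orth {x}"
      using x by (auto simp: orth_def cinner_zero_commute[of x])
    ultimately have "closure V \<subseteq> orth {x}"
      by (simp add: closure_minimal csubspace_closed)
    then show "x \<in> orth (closure V)"
      by (auto simp: orth_def cinner_zero_commute[of x])
  qed
qed (use closure_subset in \<open>auto simp: orth_def\<close>)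

section \<open>Orthogonal projections\<close>

lemma nearest_point_orth:
  fixes x p :: "'a::complex_hilbert"
  assumes V: "closed_csubspace V" and p: "p \<in> V"
    and min: "\<And>q. q \<in> V \<Longrightarrow> norm (x - p) \<le> norm (x - q)"
  shows "x - p \<in> orth V"
  unfolding orth_def
proof (intro CollectI ballI)
  fix v assume v: "v \<in> V"
  show "cinner (x - p) v = 0"
  proof (cases "v = 0")
    case False
    \<comment> \<open>\<open>c v\<close> is the component of \<open>x - p\<close> along
      \<open>v\<close>, the displacement in this direction that shortens the distance most.
      Minimality of \<open>p\<close> leaves no gain, so this component vanishes.\<close>
    define c where "c = cinner (x - p) v / (norm v)\<^sup>2"
    have "(norm (x - p))\<^sup>2 \<le> (norm ((x - p) - c *\<^sub>C v))\<^sup>2"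
      using min[of "p + c *\<^sub>C v"] v p V
      by (auto intro!: power_mono simp: csubspace_add csubspace_scaleC diff_diff_eq)
    then have "2 * Re (cinner (x - p) (c *\<^sub>C v)) \<le> (norm (c *\<^sub>C v))\<^sup>2"
      by (simp add: norm_diff_sq)
    moreover have "cinner (x - p) (c *\<^sub>C v) = of_real ((cmod (cinner (x - p) v))\<^sup>2 / (norm v)\<^sup>2)"
      using False complex_norm_square[of "cinner (x - p) v"]
      by (simp add: cinner_scaleC_right c_def mult.commute)
    moreover have "(norm (c *\<^sub>C v))\<^sup>2 = (cmod (cinner (x - p) v))\<^sup>2 / (norm v)\<^sup>2"
      using False by (simp add: norm_scaleC c_def norm_divide power_mult_distrib power_divide
          norm_mult power2_eq_square)
    ultimately have "(cmod (cinner (x - p) v))\<^sup>2 / (norm v)\<^sup>2 \<le> 0"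
      by (simp del: of_real_divide of_real_power)
    then show ?thesis
      using False by (simp add: divide_le_0_iff zero_less_mult_iff)
  qed simp
qed

text \<open>A sequence in \<open>V\<close> whose distances to \<open>x\<close> tend to the infimum
  is Cauchy by the parallelogram law, and its limit is a nearest point.\<close>

theorem orth_projection:
  fixes x :: "'a::complex_hilbert"
  assumes V: "closed_csubspace V"
  shows "\<exists>p\<in>V. x - p \<in> orth V"
proof -
  define s where "s = infdist x V"
  have ne: "V \<noteq> {}"
    using csubspace_zero[OF V] by auto
  have s_le: "s \<le> norm (x - q)" if "q \<in> V" for q
    unfolding s_def dist_norm[symmetric] by (rule infdist_le[OF that])
  have "s \<ge> 0"
    by (simp add: s_def infdist_nonneg)
  have "\<exists>q\<in>V. norm (x - q) < s + inverse (Suc n)" for n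
  proof -
    have "Inf (dist x ` V) < s + inverse (Suc n)"
      using ne by (simp add: s_def infdist_def)
    then show ?thesis
      using ne cInf_lessD[of "dist x ` V"] by (auto simp: dist_norm)
  qed
  then obtain q where q: "\<And>n. q n \<in> V" "\<And>n. norm (x - q n) < s + inverse (Suc n)"
    by metis
  have lim: "(\<lambda>n. norm (x - q n)) \<longlonglongrightarrow> s"
  proof (rule tendsto_sandwich[of "\<lambda>_. s" _ _ "\<lambda>n. s + inverse (Suc n)"])
    show "(\<lambda>n. s + inverse (real (Suc n))) \<longlonglongrightarrow> s"
      using tendsto_add[OF tendsto_const LIMSEQ_inverse_real_of_nat] by simp
  qed (use q s_le in \<open>auto intro!: always_eventually less_imp_le\<close>)
  \<comment> \<open>Parallelogram law for \<open>x - q i\<close> and \<open>x - q j\<close>. Their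
    sum is twice the difference of \<open>x\<close> and the midpoint of \<open>q i\<close> and
    \<open>q j\<close>, which lies in \<open>V\<close> and is therefore at distance at least
    \<open>s\<close>.\<close>
  have par: "(norm (q i - q j))\<^sup>2 \<le> 2 * (norm (x - q i))\<^sup>2 + 2 * (norm (x - q j))\<^sup>2 - 4 * s\<^sup>2"
    for i j
  proof -
    have "s \<le> norm (x - (1/2) *\<^sub>R (q i + q j))"
      by (intro s_le csubspace_scaleR csubspace_add V q)
    also have "x - (1/2) *\<^sub>R (q i + q j) = (1/2) *\<^sub>R ((x - q i) + (x - q j))"
      by (simp add: algebra_simps flip: scaleR_add_left)
    finally have "2 * s \<le> norm ((x - q i) + (x - q j))"
      by simp
    then have "(2 * s)\<^sup>2 \<le> (norm ((x - q i) + (x - q j)))\<^sup>2"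
      using \<open>s \<ge> 0\<close> by (intro power_mono) auto
    moreover have "(norm (q i - q j))\<^sup>2 = (norm ((x - q i) - (x - q j)))\<^sup>2"
      by (simp add: norm_minus_commute)
    ultimately show ?thesis
      unfolding norm_add_sq norm_diff_sq by simp
  qed
  have "Cauchy q"
  proof (rule metric_CauchyI)
    fix e :: real assume "0 < e"
    have "(\<lambda>n. (norm (x - q n))\<^sup>2 - s\<^sup>2) \<longlonglongrightarrow> s\<^sup>2 - s\<^sup>2"
      by (intro tendsto_intros lim)
    then have "\<forall>\<^sub>F n in sequentially. (norm (x - q n))\<^sup>2 - s\<^sup>2 < e\<^sup>2 / 4"
      by (rule order_tendstoD(2)) (use \<open>0 < e\<close> in simp)
    then obtain M where M: "\<And>n. n \<ge> M \<Longrightarrow> (norm (x - q n))\<^sup>2 - s\<^sup>2 < e\<^sup>2 / 4"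
      unfolding eventually_sequentially by auto
    have "norm (q i - q j) < e" if "i \<ge> M" "j \<ge> M" for i j
    proof -
      have "(norm (q i - q j))\<^sup>2 < e\<^sup>2"
        using par[of i j] M[OF that(1)] M[OF that(2)] by linarith
      then show ?thesis
        using \<open>0 < e\<close> by (simp add: power_less_imp_less_base)
    qed
    then show "\<exists>M. \<forall>m\<ge>M. \<forall>n\<ge>M. dist (q m) (q n) < e"
      by (auto simp: dist_norm)
  qed
  then obtain p where p: "q \<longlonglongrightarrow> p"
    using Cauchy_convergent convergent_def by blast
  have "p \<in> V"
    using closed_sequentially[OF csubspace_closed[OF V]] q(1) p by blast
  have "(\<lambda>n. norm (x - q n)) \<longlonglongrightarrow> norm (x - p)"
    by (intro tendsto_intros p)
  then have "norm (x - p) = s"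
    using lim LIMSEQ_unique by blast
  then show ?thesis
    using nearest_point_orth[OF V \<open>p \<in> V\<close>] s_le \<open>p \<in> V\<close> by blast
qed

lemma clinear_on_add: "clinear_on V F \<Longrightarrow> x \<in> V \<Longrightarrow> y \<in> V \<Longrightarrow> F (x + y) = F x + F y"
  and clinear_on_scaleC: "clinear_on V F \<Longrightarrow> x \<in> V \<Longrightarrow> F (c *\<^sub>C x) = c *\<^sub>C F x"
  by (auto simp: clinear_on_def)

lemma clinear_on_zero: "clinear_on V F \<Longrightarrow> x \<in> V \<Longrightarrow> F 0 = 0"
  using clinear_on_scaleC[of V F x 0] by simp

lemma clinear_on_minus: "clinear_on V F \<Longrightarrow> x \<in> V \<Longrightarrow> F (- x) = - F x"
  using clinear_on_scaleC[of V F x "-1"] by simp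

lemma clinear_on_diff:
  assumes "closed_csubspace V" "clinear_on V F" "x \<in> V" "y \<in> V"
  shows "F (x - y) = F x - F y"
  using clinear_on_add[OF assms(2,3) csubspace_minus[OF assms(1,4)]]
    clinear_on_minus[OF assms(2,4)] by simp

lemma clinear_on_sum:
  assumes "closed_csubspace V" "clinear_on V F" "\<And>i. i \<in> A \<Longrightarrow> f i \<in> V"
  shows "F (\<Sum>i\<in>A. f i) = (\<Sum>i\<in>A. F (f i))"
  using assms(3)
proof (induction A rule: infinite_finite_induct)
  case (insert x B)
  then show ?case
    using clinear_on_add[OF assms(2), of "f x" "\<Sum>i\<in>B. f i"]
      csubspace_sum[OF assms(1), of B f] by simp
qed (use clinear_on_zero[OF assms(2) csubspace_zero[OF assms(1)]] in auto)

theorem riesz_representation: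
  fixes f :: "'a::complex_hilbert \<Rightarrow> complex"
  assumes V: "closed_csubspace V" and f: "clinear_on V f"
    and bd: "\<And>v. v \<in> V \<Longrightarrow> cmod (f v) \<le> M * norm v"
  shows "\<exists>x\<in>V. \<forall>v\<in>V. f v = cinner v x"
proof (cases "\<forall>v\<in>V. f v = 0")
  case True
  then show ?thesis
    using csubspace_zero[OF V] by force
next
  case False
  then obtain v0 where v0: "v0 \<in> V" "f v0 \<noteq> 0"
    by auto
  define N where "N = {v \<in> V. f v = 0}"
  have "closed N"
    unfolding closed_sequential_limits
  proof (intro allI impI, elim conjE)
    fix g l assume g: "\<forall>n. g n \<in> N" "g \<longlonglongrightarrow> l"
    then have "l \<in> V"
      using closed_sequentially[OF csubspace_closed[OF V]] unfolding N_def by blast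
    have "norm (f l) \<le> \<bar>M\<bar> * norm (l - g n)" for n
    proof -
      have "f (l - g n) = f l"
        using g \<open>l \<in> V\<close> by (simp add: clinear_on_diff[OF V f] N_def)
      then have "norm (f l) \<le> M * norm (l - g n)"
        using bd[of "l - g n"] g \<open>l \<in> V\<close> by (simp add: N_def csubspace_diff[OF V])
      also have "\<dots> \<le> \<bar>M\<bar> * norm (l - g n)"
        by (simp add: mult_right_mono)
      finally show ?thesis .
    qed
    moreover have "(\<lambda>n. \<bar>M\<bar> * norm (l - g n)) \<longlonglongrightarrow> \<bar>M\<bar> * norm (l - l)"
      by (intro tendsto_intros g)
    ultimately have "norm (f l) \<le> 0"
      using LIMSEQ_le_const by fastforce
    then show "l \<in> N"
      using \<open>l \<in> V\<close> by (simp add: N_def)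
  qed
  then have N: "closed_csubspace N"
    using V clinear_on_zero[OF f v0(1)]
    by (auto simp: closed_csubspace_def N_def clinear_on_add[OF f] clinear_on_scaleC[OF f])
  obtain p where p: "p \<in> N" "v0 - p \<in> orth N"
    using orth_projection[OF N] by blast
  define w where "w = v0 - p"
  have w: "w \<in> V" "f w \<noteq> 0"
    using v0 p by (auto simp: w_def N_def csubspace_diff[OF V] clinear_on_diff[OF V f])
  have "w \<noteq> 0"
    using w clinear_on_zero[OF f v0(1)] by auto
  \<comment> \<open>The scalar is forced by \<open>f w = cinner w x\<close>.\<close>
  define x where "x = (cnj (f w) / (norm w)\<^sup>2) *\<^sub>C w"
  have "f v = cinner v x" if v: "v \<in> V" for v
  proof -
    have "v - (f v / f w) *\<^sub>C w \<in> N"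
      using v w by (simp add: N_def csubspace_diff[OF V] csubspace_scaleC[OF V]
          clinear_on_diff[OF V f] clinear_on_scaleC[OF f])
    then have "cinner w (v - (f v / f w) *\<^sub>C w) = 0"
      using p(2) by (simp add: orth_def w_def)
    then have "cinner (v - (f v / f w) *\<^sub>C w) w = 0"
      by (metis cinner_commute complex_cnj_zero)
    then have "cinner v w = f v / f w * (norm w)\<^sup>2"
      by (simp add: cinner_diff_left cinner_scaleC_left cinner_self)
    then show ?thesis
      using \<open>w \<noteq> 0\<close> w by (simp add: x_def cinner_scaleC_right)
  qed
  then show ?thesis
    using w csubspace_scaleC[OF V] x_def by blast
qed

section \<open>Adjoints\<close>

lemma bounded_op_linear: "bounded_op V W F \<Longrightarrow> clinear_on V F"
  and bounded_op_in: "bounded_op V W F \<Longrightarrow> x \<in> V \<Longrightarrow> F x \<in> W"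
  by (auto simp: bounded_op_def)

lemma bounded_op_bound:
  assumes "bounded_op V W F"
  obtains M where "M \<ge> 0" "\<And>x. x \<in> V \<Longrightarrow> norm (F x) \<le> M * norm x"
proof -
  obtain M where M: "\<And>x. x \<in> V \<Longrightarrow> norm (F x) \<le> M * norm x"
    using assms by (auto simp: bounded_op_def)
  have "norm (F x) \<le> \<bar>M\<bar> * norm x" if "x \<in> V" for x
    using M[OF that] mult_right_mono[OF abs_ge_self[of M] norm_ge_zero[of x]] by linarith
  then show ?thesis
    using that[of "\<bar>M\<bar>"] by simp
qed

lemma bounded_op_mono: "bounded_op V W F \<Longrightarrow> V' \<subseteq> V \<Longrightarrow> F ` V' \<subseteq> W' \<Longrightarrow> bounded_op V' W' F"
  unfolding bounded_op_def clinear_on_def by blast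

lemma bounded_op_comp:
  assumes "bounded_op V W F" "bounded_op W Y G"
  shows "bounded_op V Y (\<lambda>x. G (F x))"
proof -
  obtain M where M: "M \<ge> 0" "\<And>x. x \<in> V \<Longrightarrow> norm (F x) \<le> M * norm x"
    using bounded_op_bound[OF assms(1)] by blast
  obtain N where N: "N \<ge> 0" "\<And>x. x \<in> W \<Longrightarrow> norm (G x) \<le> N * norm x"
    using bounded_op_bound[OF assms(2)] by blast
  have "norm (G (F x)) \<le> (N * M) * norm x" if "x \<in> V" for x
  proof -
    have "norm (G (F x)) \<le> N * norm (F x)"
      using N(2) bounded_op_in[OF assms(1) that] by blast
    also have "\<dots> \<le> N * (M * norm x)"
      by (intro mult_left_mono M that N)
    finally show ?thesis by (simp add: mult.assoc)
  qed
  then show ?thesis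
    using assms unfolding bounded_op_def clinear_on_def
    by (auto simp: image_subset_iff intro!: exI[of _ "N * M"])
qed

lemma bounded_op_add:
  assumes W: "closed_csubspace W" and F: "bounded_op V W F" and G: "bounded_op V W G"
  shows "bounded_op V W (\<lambda>x. F x + G x)"
proof -
  obtain M where M: "\<And>x. x \<in> V \<Longrightarrow> norm (F x) \<le> M * norm x"
    using bounded_op_bound[OF F] by blast
  obtain N where N: "\<And>x. x \<in> V \<Longrightarrow> norm (G x) \<le> N * norm x"
    using bounded_op_bound[OF G] by blast
  have "norm (F x + G x) \<le> (M + N) * norm x" if "x \<in> V" for x
    using norm_triangle_le[OF add_mono[OF M[OF that] N[OF that]]] by (simp add: distrib_right)
  then show ?thesis
    using F G csubspace_add[OF W] unfolding bounded_op_def clinear_on_def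
    by (auto simp: scaleC_add_right image_subset_iff)
qed

lemma bounded_op_scaleC:
  assumes W: "closed_csubspace W" and F: "bounded_op V W F"
  shows "bounded_op V W (\<lambda>x. c *\<^sub>C F x)"
proof -
  obtain M where M: "M \<ge> 0" "\<And>x. x \<in> V \<Longrightarrow> norm (F x) \<le> M * norm x"
    using bounded_op_bound[OF F] by blast
  have "norm (c *\<^sub>C F x) \<le> (cmod c * M) * norm x" if "x \<in> V" for x
    using mult_left_mono[OF M(2)[OF that] norm_ge_zero[of c]] by (simp add: norm_scaleC mult.assoc)
  then show ?thesis
    using F csubspace_scaleC[OF W] unfolding bounded_op_def clinear_on_def
    by (auto simp: scaleC_add_right scaleC_scaleC mult.commute[of c]
        intro!: exI[of _ "cmod c * M"])
qed

lemma bounded_op_diff: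
  assumes W: "closed_csubspace W" and F: "bounded_op V W F" and G: "bounded_op V W G"
  shows "bounded_op V W (\<lambda>x. F x - G x)"
  using bounded_op_add[OF W F bounded_op_scaleC[OF W G, of "-1"]] by simp

lemma bounded_op_zero: "0 \<in> W \<Longrightarrow> bounded_op V W (\<lambda>_. 0)"
  by (auto simp: bounded_op_def clinear_on_def intro!: exI[of _ 0])

lemma bounded_op_sum:
  assumes W: "closed_csubspace W" and F: "\<And>i. i \<in> A \<Longrightarrow> bounded_op V W (F i)"
  shows "bounded_op V W (\<lambda>x. \<Sum>i\<in>A. F i x)"
  using F
  by (induction A rule: infinite_finite_induct)
    (auto intro: bounded_op_zero bounded_op_add csubspace_zero W)

lemma bounded_op_id: "bounded_op V V (\<lambda>x. x)"
  by (auto simp: bounded_op_def clinear_on_def intro!: exI[of _ 1])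

lemma bounded_op_bounded_linear:
  assumes "bounded_op UNIV W F"
  shows "bounded_linear F"
proof -
  obtain M where "\<And>x. norm (F x) \<le> M * norm x"
    using assms by (auto simp: bounded_op_def)
  then show ?thesis
    using assms by (intro bounded_linear_intro[of F M])
      (auto simp: bounded_op_def clinear_on_def scaleR_scaleC mult.commute)
qed

lemma adjoint_onI:
  assumes V: "closed_csubspace V" and x: "x \<in> V" "\<And>v. v \<in> V \<Longrightarrow> cinner (F v) y = cinner v x"
  shows "adjoint_on V F y = x"
  unfolding adjoint_wrt_def
proof (rule the_equality)
  fix z assume z: "z \<in> V \<and> (\<forall>v\<in>V. cinner (F v) y = cinner v z)"
  then have "cinner (z - x) (z - x) = 0"
    using x csubspace_diff[OF V, of z x] by (metis cinner_diff_right diff_self)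
  then show "z = x" by simp
qed (use x in auto)

lemma adjoint_on:
  assumes V: "closed_csubspace V" and F: "bounded_op V W F"
  shows adjoint_on_in: "adjoint_on V F y \<in> V"
    and adjoint_on_cinner: "v \<in> V \<Longrightarrow> cinner (F v) y = cinner v (adjoint_on V F y)"
proof -
  obtain M where M: "\<And>x. x \<in> V \<Longrightarrow> norm (F x) \<le> M * norm x"
    using F by (auto simp: bounded_op_def)
  have "cmod (cinner (F v) y) \<le> (M * norm y) * norm v" if "v \<in> V" for v
    using cauchy_schwarz[of "F v" y] mult_right_mono[OF M[OF that] norm_ge_zero[of y]]
    by (simp add: mult_ac)
  moreover have "clinear_on V (\<lambda>v. cinner (F v) y)"
    using bounded_op_linear[OF F] by (simp add: clinear_on_def cinner_add_left cinner_scaleC_left)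
  ultimately obtain x where "x \<in> V" "\<And>v. v \<in> V \<Longrightarrow> cinner (F v) y = cinner v x"
    using riesz_representation[OF V, of "\<lambda>v. cinner (F v) y"] by blast
  moreover from this have "adjoint_on V F y = x"
    by (rule adjoint_onI[OF V])
  ultimately show "adjoint_on V F y \<in> V" "v \<in> V \<Longrightarrow> cinner (F v) y = cinner v (adjoint_on V F y)"
    by auto
qed

lemma norm_le_of_sq_le_mult:
  fixes a b :: real
  assumes "a\<^sup>2 \<le> b * a" "0 \<le> b"
  shows "a \<le> b"
  using assms by (cases "a \<le> 0") (auto simp: power2_eq_square)

text \<open>Testing the adjoint relation on the adjoint vector itself bounds its squared norm by
  \<open>M * norm y\<close> times its norm.\<close>

lemma adjoint_on_norm_le:
  assumes V: "closed_csubspace V" and F: "bounded_op V W F"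
    and M: "0 \<le> M" "\<And>x. x \<in> V \<Longrightarrow> norm (F x) \<le> M * norm x"
  shows "norm (adjoint_on V F y) \<le> M * norm y"
proof (rule norm_le_of_sq_le_mult)
  let ?x = "adjoint_on V F y"
  have x: "?x \<in> V" by (rule adjoint_on_in[OF V F])
  have "(norm ?x)\<^sup>2 = Re (cinner (F ?x) y)"
    by (simp add: norm_sq_eq_cinner adjoint_on_cinner[OF V F x])
  also have "\<dots> \<le> norm (F ?x) * norm y"
    by (rule Re_cinner_le)
  also have "\<dots> \<le> (M * norm ?x) * norm y"
    by (intro mult_right_mono M x) simp
  finally show "(norm ?x)\<^sup>2 \<le> (M * norm y) * norm ?x" by (simp add: mult_ac)
qed (use M in simp)

text \<open>The functional \<open>v \<mapsto> cinner (F v) y\<close> makes sense for every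
  \<open>y\<close> of the ambient type, so the domain \<open>W'\<close> is free. With
  \<open>W' = UNIV\<close> adjoints can be added and composed without side conditions of
  membership.\<close>

lemma bounded_op_adjoint_on:
  assumes V: "closed_csubspace V" and F: "bounded_op V W F"
  shows "bounded_op W' V (adjoint_on V F)"
proof -
  obtain M where "M \<ge> 0" "\<And>x. x \<in> V \<Longrightarrow> norm (F x) \<le> M * norm x"
    using bounded_op_bound[OF F] by blast
  then have "norm (adjoint_on V F y) \<le> M * norm y" for y
    using adjoint_on_norm_le[OF V F] by blast
  moreover have "adjoint_on V F (x + y) = adjoint_on V F x + adjoint_on V F y" for x y
    by (rule adjoint_onI[OF V])
      (auto simp: cinner_add_right adjoint_on_cinner[OF V F] adjoint_on_in[OF V F]
          csubspace_add[OF V])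
  moreover have "adjoint_on V F (c *\<^sub>C x) = c *\<^sub>C adjoint_on V F x" for c x
    by (rule adjoint_onI[OF V])
      (auto simp: cinner_scaleC_right adjoint_on_cinner[OF V F] adjoint_on_in[OF V F]
        csubspace_scaleC[OF V])
  ultimately show ?thesis
    using adjoint_on_in[OF V F] by (auto simp: bounded_op_def clinear_on_def)
qed

lemmas cinner_adj = adjoint_on_cinner[OF csubspace_UNIV _ UNIV_I]

lemma adj_comp:
  assumes F: "bounded_op UNIV UNIV F" and G: "bounded_op UNIV UNIV G"
  shows "adj (\<lambda>x. F (G x)) y = adj G (adj F y)"
  by (rule adjoint_onI) (auto simp: cinner_adj[OF F] cinner_adj[OF G])

section \<open>Positive operators and their square roots\<close>

lemma positive_op_bounded: "positive_op A \<Longrightarrow> bounded_op UNIV UNIV A"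
  and positive_op_Re: "positive_op A \<Longrightarrow> 0 \<le> Re (cinner (A x) x)"
  by (auto simp: positive_op_def)

lemmas bounded_op_UNIV_add = clinear_on_add[OF bounded_op_linear UNIV_I UNIV_I]
lemmas bounded_op_UNIV_scaleC = clinear_on_scaleC[OF bounded_op_linear UNIV_I]
lemmas bounded_op_UNIV_diff = clinear_on_diff[OF csubspace_UNIV bounded_op_linear UNIV_I UNIV_I]
lemmas bounded_op_UNIV_sum = clinear_on_sum[OF csubspace_UNIV bounded_op_linear UNIV_I]

lemma bounded_op_UNIV_scaleR: "bounded_op UNIV W F \<Longrightarrow> F (r *\<^sub>R x) = r *\<^sub>R F x"
  by (simp add: scaleR_scaleC bounded_op_UNIV_scaleC)

lemma bounded_op_UNIV_zero: "bounded_op UNIV W F \<Longrightarrow> F 0 = 0"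
  using clinear_on_zero[OF bounded_op_linear] by blast

text \<open>Complex polarization: reality of the form at \<open>x + y\<close> gives the imaginary
  part of the identity, and at \<open>x + \<i> y\<close> the real part.\<close>

lemma real_form_symmetric:
  assumes A: "bounded_op UNIV UNIV A" and real: "\<And>x. Im (cinner (A x) x) = 0"
  shows "cinner (A x) y = cinner x (A y)"
proof -
  have "Im (cinner (A x) y + cinner (A y) x) = 0"
    using real[of "x + y"] real[of x] real[of y]
    by (simp add: bounded_op_UNIV_add[OF A] cinner_add_left cinner_add_right)
  moreover have "Im (cinner (A x) (\<i> *\<^sub>C y) + cinner (A (\<i> *\<^sub>C y)) x) = 0"
    using real[of "x + \<i> *\<^sub>C y"] real[of x] real[of "\<i> *\<^sub>C y"]
    by (simp add: bounded_op_UNIV_add[OF A] cinner_add_left cinner_add_right)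
  ultimately have "cinner (A x) y = cnj (cinner (A y) x)"
    by (simp add: bounded_op_UNIV_scaleC[OF A] cinner_scaleC_left cinner_scaleC_right
        complex_eq_iff)
  then show ?thesis
    by (metis cinner_commute)
qed

lemma positive_op_symmetric: "positive_op A \<Longrightarrow> cinner (A x) y = cinner x (A y)"
  by (rule real_form_symmetric) (auto simp: positive_op_def)

text \<open>Nonnegativity of the form at \<open>x - (1/M) A x\<close>. This is the operator
  inequality \<open>A^2 \<le> M A\<close>, obtained before square roots are available.\<close>

lemma positive_op_norm_sq_le:
  assumes A: "positive_op A" and M: "M > 0" "\<And>x. norm (A x) \<le> M * norm x"
  shows "(norm (A x))\<^sup>2 \<le> M * Re (cinner (A x) x)"
proof -
  have bA: "bounded_op UNIV UNIV A"
    by (rule positive_op_bounded[OF A])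
  define y where "y = A x"
  have "0 \<le> Re (cinner (A (x - (1/M) *\<^sub>R y)) (x - (1/M) *\<^sub>R y))"
    by (rule positive_op_Re[OF A])
  also have "\<dots> = Re (cinner (A x) x) - 2 * (1/M) * (norm y)\<^sup>2 + (1/M)\<^sup>2 * Re (cinner (A y) y)"
    using positive_op_symmetric[OF A, of y x]
    by (simp add: bounded_op_UNIV_diff[OF bA] bounded_op_UNIV_scaleR[OF bA] cinner_diff_left
        cinner_diff_right cinner_scaleR_left cinner_scaleR_right y_def[symmetric] cinner_self
        power2_eq_square diff_divide_distrib)
  also have "Re (cinner (A y) y) \<le> M * (norm y)\<^sup>2"
    using Re_cinner_le[of "A y" y] mult_right_mono[OF M(2)[of y] norm_ge_zero[of y]]
    by (simp add: power2_eq_square mult.assoc)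
  finally have "0 \<le> Re (cinner (A x) x) - 2 * (1/M) * (norm y)\<^sup>2 + (1/M)\<^sup>2 * (M * (norm y)\<^sup>2)"
    by (simp add: mult_left_mono)
  also have "\<dots> = Re (cinner (A x) x) - (norm y)\<^sup>2 / M"
    using M(1) by (simp add: field_simps power2_eq_square)
  finally show ?thesis
    using M(1) by (simp add: y_def field_simps)
qed

lemma bounded_op_UNIV_bound:
  assumes "bounded_op UNIV W F"
  obtains M where "M > 0" "\<And>x. norm (F x) \<le> M * norm x"
proof -
  obtain M where M: "\<And>x. norm (F x) \<le> M * norm x"
    using assms by (auto simp: bounded_op_def)
  have "norm (F x) \<le> (\<bar>M\<bar> + 1) * norm x" for x
    by (rule order_trans[OF M]) (auto intro: mult_right_mono)
  then show ?thesis
    using that[of "\<bar>M\<bar> + 1"] by simp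
qed

lemma positive_op_eq_zero:
  assumes A: "positive_op A" and "Re (cinner (A x) x) = 0"
  shows "A x = 0"
proof -
  obtain M where "M > 0" "\<And>x. norm (A x) \<le> M * norm x"
    using bounded_op_UNIV_bound[OF positive_op_bounded[OF A]] by blast
  then show ?thesis
    using positive_op_norm_sq_le[OF A, of M x] assms(2) by simp
qed

section \<open>The iteration for the square root\<close>

primrec sqrt_iter :: "('a::complex_hilbert \<Rightarrow> 'a) \<Rightarrow> nat \<Rightarrow> 'a \<Rightarrow> 'a" where
  "sqrt_iter X 0 = (\<lambda>x. 0)"
| "sqrt_iter X (Suc n) = (\<lambda>x. (1/2) *\<^sub>R (X x + sqrt_iter X n (sqrt_iter X n x)))"

primrec sqrt_iter_bound :: "nat \<Rightarrow> real" where
  "sqrt_iter_bound 0 = 0"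
| "sqrt_iter_bound (Suc n) = (1 + (sqrt_iter_bound n)\<^sup>2) / 2"

lemma sqrt_iter_bound_mono: "0 \<le> sqrt_iter_bound n \<and> sqrt_iter_bound n \<le> sqrt_iter_bound (Suc n)"
proof (induction n)
  case (Suc n)
  then show ?case
    using power_mono[of "sqrt_iter_bound n" "sqrt_iter_bound (Suc n)" 2] by auto
qed simp

lemma sqrt_iter_bound_le_1: "sqrt_iter_bound n \<le> 1"
proof (induction n)
  case (Suc n)
  then show ?case
    using power_mono[of "sqrt_iter_bound n" 1 2] sqrt_iter_bound_mono[of n] by auto
qed simp

text \<open>
  The iterates \<open>Y\<^sub>0 = 0\<close>, \<open>Y\<^sub>n\<^sub>+\<^sub>1 = (X + Y\<^sub>n\<^sup>2)/2\<close> are polynomials in \<open>X\<close> with nonnegative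
  coefficients, so their increments are dominated in norm by those of the scalar iteration
  at \<open>X = 1\<close>. The limit \<open>G\<close> solves \<open>(1 - G)\<^sup>2 = 1 - X\<close>.
\<close>

context
  fixes X :: "'a::complex_hilbert \<Rightarrow> 'a"
  assumes X: "bounded_op UNIV UNIV X" and X_le: "\<And>x. norm (X x) \<le> norm x"
    and X_sym: "\<And>x y. cinner (X x) y = cinner x (X y)"
begin

lemma bounded_op_sqrt_iter: "bounded_op UNIV UNIV (sqrt_iter X n)"
proof (induction n)
  case (Suc n)
  have "bounded_op UNIV UNIV (\<lambda>x. complex_of_real (1/2) *\<^sub>C (X x + sqrt_iter X n (sqrt_iter X n x)))"
    by (intro bounded_op_scaleC bounded_op_add bounded_op_comp[OF Suc Suc] X csubspace_UNIV)
  then show ?case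
    by (simp only: sqrt_iter.simps scaleR_scaleC)
qed (simp add: bounded_op_zero)

text \<open>Whatever commutes with \<open>X\<close> commutes with polynomials in \<open>X\<close>.
  This allows a difference of squares of two iterates to be factored, and in the limit it makes any
  other positive square root commute with the constructed one.\<close>

lemma sqrt_iter_commute:
  assumes F: "bounded_op UNIV UNIV F" and "\<And>x. F (X x) = X (F x)"
  shows "F (sqrt_iter X n x) = sqrt_iter X n (F x)"
proof (induction n arbitrary: x)
  case (Suc n)
  show ?case
    by (simp add: bounded_op_UNIV_scaleR[OF F] bounded_op_UNIV_add[OF F] assms(2) Suc)
qed (simp add: bounded_op_UNIV_zero[OF F])

lemma sqrt_iter_sym: "cinner (sqrt_iter X n x) y = cinner x (sqrt_iter X n y)"
proof (induction n arbitrary: x y)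
  case (Suc n)
  show ?case
    by (simp add: cinner_add_left cinner_add_right cinner_scaleR_left cinner_scaleR_right X_sym Suc)
qed simp

lemma norm_sqrt_iter_le: "norm (sqrt_iter X n x) \<le> sqrt_iter_bound n * norm x"
proof (induction n arbitrary: x)
  case (Suc n)
  have "norm (sqrt_iter X n (sqrt_iter X n x)) \<le> sqrt_iter_bound n * (sqrt_iter_bound n * norm x)"
    using Suc[of "sqrt_iter X n x"] mult_left_mono[OF Suc[of x], of "sqrt_iter_bound n"]
      sqrt_iter_bound_mono[of n] by auto
  then have "norm (X x + sqrt_iter X n (sqrt_iter X n x))
      \<le> norm x + (sqrt_iter_bound n)\<^sup>2 * norm x"
    using norm_triangle_le[OF add_mono[OF X_le[of x]]] by (simp add: power2_eq_square mult.assoc)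
  moreover have "norm (sqrt_iter X (Suc n) x) = norm (X x + sqrt_iter X n (sqrt_iter X n x)) / 2"
    by (simp flip: scaleR_add_right)
  ultimately show ?case
    by (simp add: algebra_simps del: sqrt_iter.simps)
qed simp

text \<open>For consecutive iterates \<open>Y\<close>, \<open>Z\<close> the next increment is
  \<open>(Z^2 - Y^2)/2 = (Z + Y)(Z - Y)/2\<close>, as they commute. Bounding each factor gives
  exactly the increment of the scalar iteration.\<close>

lemma norm_sqrt_iter_step:
  "norm (sqrt_iter X (Suc n) x - sqrt_iter X n x)
    \<le> (sqrt_iter_bound (Suc n) - sqrt_iter_bound n) * norm x"
proof (induction n arbitrary: x)
  case 0
  show ?case using X_le[of x] by simp
next
  case (Suc n)
  let ?Y = "sqrt_iter X n" and ?Z = "sqrt_iter X (Suc n)"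
  let ?s = "sqrt_iter_bound n" and ?t = "sqrt_iter_bound (Suc n)"
  note Y = bounded_op_sqrt_iter[of n] and Z = bounded_op_sqrt_iter[of "Suc n"]
  have comm: "?Z (?Y x) = ?Y (?Z x)" for x
    by (rule sqrt_iter_commute[OF Y, symmetric]) (rule sqrt_iter_commute[OF X refl, symmetric])
  have eq: "sqrt_iter X (Suc (Suc n)) x - ?Z x
      = (1/2) *\<^sub>R (?Z (?Z x - ?Y x) + ?Y (?Z x - ?Y x))"
  proof -
    have "?Z (?Z x - ?Y x) + ?Y (?Z x - ?Y x) = ?Z (?Z x) - ?Y (?Y x)"
      by (simp add: bounded_op_UNIV_diff[OF Z] bounded_op_UNIV_diff[OF Y] comm
          del: sqrt_iter.simps)
    moreover have "sqrt_iter X (Suc (Suc n)) x = (1/2) *\<^sub>R (X x + ?Z (?Z x))"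
      "?Z x = (1/2) *\<^sub>R (X x + ?Y (?Y x))"
      by (rule sqrt_iter.simps(2)[THEN fun_cong])+
    ultimately show ?thesis
      by (simp add: scaleR_add_right scaleR_diff_right del: sqrt_iter.simps)
  qed
  have "norm (?Z (?Z x - ?Y x)) \<le> ?t * ((?t - ?s) * norm x)"
    using norm_sqrt_iter_le[of "Suc n" "?Z x - ?Y x"]
      mult_left_mono[OF Suc[of x], of ?t] sqrt_iter_bound_mono[of "Suc n"] by linarith
  moreover have "norm (?Y (?Z x - ?Y x)) \<le> ?s * ((?t - ?s) * norm x)"
    using norm_sqrt_iter_le[of n "?Z x - ?Y x"]
      mult_left_mono[OF Suc[of x], of ?s] sqrt_iter_bound_mono[of n] by linarith
  ultimately have "norm (?Z (?Z x - ?Y x) + ?Y (?Z x - ?Y x)) \<le> (?t\<^sup>2 - ?s\<^sup>2) * norm x"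
    using norm_triangle_le[OF add_mono, of "?Z (?Z x - ?Y x)" "?t * ((?t - ?s) * norm x)"
        "?Y (?Z x - ?Y x)" "?s * ((?t - ?s) * norm x)"]
    by (simp add: power2_eq_square algebra_simps del: sqrt_iter.simps sqrt_iter_bound.simps)
  moreover have inc: "sqrt_iter_bound (Suc (Suc n)) - ?t = (?t\<^sup>2 - ?s\<^sup>2) / 2"
    by (simp add: field_simps)
  ultimately show ?case
    unfolding eq inc by (simp del: sqrt_iter.simps sqrt_iter_bound.simps)
qed

lemma norm_sqrt_iter_diff:
  assumes "n \<le> k"
  shows "norm (sqrt_iter X k x - sqrt_iter X n x) \<le> (sqrt_iter_bound k - sqrt_iter_bound n)
      * norm x"
  using assms
proof (induction k rule: dec_induct)
  case (step k)
  show ?case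
    using norm_triangle_ineq[of "sqrt_iter X (Suc k) x - sqrt_iter X k x"
        "sqrt_iter X k x - sqrt_iter X n x"] norm_sqrt_iter_step[of k x] step(3)
    by (simp add: left_diff_distrib del: sqrt_iter.simps sqrt_iter_bound.simps)
qed simp

lemma Cauchy_sqrt_iter: "Cauchy (\<lambda>n. sqrt_iter X n x)"
proof (rule metric_CauchyI)
  fix e :: real assume "0 < e"
  have "incseq sqrt_iter_bound"
    using sqrt_iter_bound_mono by (intro incseq_SucI) auto
  then have "convergent sqrt_iter_bound"
    using sqrt_iter_bound_le_1 incseq_convergent[of sqrt_iter_bound 1] unfolding convergent_def
    by blast
  then have "Cauchy sqrt_iter_bound"
    by (rule convergent_Cauchy)
  then obtain M where M: "\<And>m n. m \<ge> M \<Longrightarrow> n \<ge> M \<Longrightarrow>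
      \<bar>sqrt_iter_bound m - sqrt_iter_bound n\<bar> < e / (norm x + 1)"
    using \<open>0 < e\<close> metric_CauchyD[of sqrt_iter_bound "e / (norm x + 1)"]
    by (fastforce simp: dist_real_def intro!: divide_pos_pos add_nonneg_pos)
  have *: "norm (sqrt_iter X m x - sqrt_iter X n x) < e" if "M \<le> n" "n \<le> m" for m n
  proof -
    have "norm (sqrt_iter X m x - sqrt_iter X n x)
        \<le> (sqrt_iter_bound m - sqrt_iter_bound n) * norm x"
      using that by (intro norm_sqrt_iter_diff)
    also have "\<dots> \<le> e / (norm x + 1) * norm x"
      using M[of m n] that by (intro mult_right_mono) auto
    also have "\<dots> < e"
      using \<open>0 < e\<close> by (simp add: pos_divide_less_eq add_nonneg_pos distrib_left)
    finally show ?thesis .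
  qed
  show "\<exists>M. \<forall>m\<ge>M. \<forall>n\<ge>M. dist (sqrt_iter X m x) (sqrt_iter X n x) < e"
  proof (intro exI[of _ M] allI impI)
    fix m n assume "M \<le> m" "M \<le> n"
    then show "dist (sqrt_iter X m x) (sqrt_iter X n x) < e"
      using *[of n m] *[of m n] by (cases "n \<le> m") (auto simp: dist_norm norm_minus_commute)
  qed
qed

lemma sqrt_iter_limit:
  obtains G where "bounded_op UNIV UNIV G" "\<And>x. norm (G x) \<le> norm x"
    "\<And>x y. cinner (G x) y = cinner x (G y)" "\<And>x. G (G x) = 2 *\<^sub>R G x - X x"
    "\<And>F x. bounded_op UNIV UNIV F \<Longrightarrow> (\<And>x. F (X x) = X (F x)) \<Longrightarrow> F (G x) = G (F x)"
proof -
  have "\<exists>l. (\<lambda>n. sqrt_iter X n x) \<longlonglongrightarrow> l" for x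
    using Cauchy_sqrt_iter Cauchy_convergent convergent_def by blast
  then obtain G where G: "\<And>x. (\<lambda>n. sqrt_iter X n x) \<longlonglongrightarrow> G x"
    by metis
  note Y = bounded_op_sqrt_iter
  have le: "norm (sqrt_iter X n x) \<le> norm x" for n x
    using norm_sqrt_iter_le[of n x] mult_right_mono[OF sqrt_iter_bound_le_1[of n]
        norm_ge_zero[of x]]
    by simp
  have G_le: "norm (G x) \<le> norm x" for x
    by (rule LIMSEQ_le_const2[OF tendsto_norm[OF G]]) (use le in auto)
  have G_add: "G (x + y) = G x + G y" for x y
    using LIMSEQ_unique[OF G[of "x + y"]] tendsto_add[OF G[of x] G[of y]]
    by (simp add: bounded_op_UNIV_add[OF Y])
  have G_scale: "G (c *\<^sub>C x) = c *\<^sub>C G x" for c x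
    using LIMSEQ_unique[OF G[of "c *\<^sub>C x"]] tendsto_scaleC[OF tendsto_const G[of x], of c]
    by (simp add: bounded_op_UNIV_scaleC[OF Y])
  have bG: "bounded_op UNIV UNIV G"
    using G_le by (auto simp: bounded_op_def clinear_on_def G_add G_scale intro!: exI[of _ 1])
  have G_sym: "cinner (G x) y = cinner x (G y)" for x y
    using LIMSEQ_unique[OF tendsto_cinner[OF G[of x] tendsto_const]]
      tendsto_cinner[OF tendsto_const G[of y]] by (simp add: sqrt_iter_sym)
  have G_comm: "F (G x) = G (F x)"
    if F: "bounded_op UNIV UNIV F" "\<And>x. F (X x) = X (F x)" for F x
    using LIMSEQ_unique[OF bounded_linear.tendsto[OF bounded_op_bounded_linear[OF F(1)] G[of x]]]
      G[of "F x"] by (simp add: sqrt_iter_commute[OF F])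
  have sq: "(\<lambda>n. sqrt_iter X n (sqrt_iter X n x)) \<longlonglongrightarrow> G (G x)" for x
  proof -
    \<comment> \<open>The iterates are contractions, so a vector tending to \<open>0\<close> is
      still sent to vectors tending to \<open>0\<close> although the operator varies with
      \<open>n\<close>.\<close>
    have "(\<lambda>n. sqrt_iter X n (sqrt_iter X n x - G x)) \<longlonglongrightarrow> 0"
    proof (rule tendsto_norm_zero_cancel, rule tendsto_sandwich[of "\<lambda>_. 0"])
      show "(\<lambda>n. norm (sqrt_iter X n x - G x)) \<longlonglongrightarrow> 0"
        using G[of x] by (simp add: LIM_zero tendsto_norm_zero)
    qed (use le in auto)
    from tendsto_add[OF this G[of "G x"]] show ?thesis
      by (simp add: bounded_op_UNIV_diff[OF Y])
  qed
  have "(\<lambda>n. sqrt_iter X (Suc n) x) \<longlonglongrightarrow> (1/2) *\<^sub>R (X x + G (G x))" for x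
    unfolding sqrt_iter.simps by (intro tendsto_intros sq)
  from LIMSEQ_unique[OF LIMSEQ_Suc[OF G] this] have fix_eq: "G x = (1/2) *\<^sub>R (X x + G (G x))" for x .
  have "G (G x) = 2 *\<^sub>R G x - X x" for x
    by (subst (3) fix_eq) simp
  then show ?thesis
    using that[of G] bG G_le G_sym G_comm by blast
qed

end

lemma positive_sqrt_exists:
  fixes A :: "'a::complex_hilbert \<Rightarrow> 'a"
  assumes A: "positive_op A"
  obtains B where "positive_op B" "\<And>x. B (B x) = A x"
    "\<And>F x. bounded_op UNIV UNIV F \<Longrightarrow> (\<And>x. F (A x) = A (F x)) \<Longrightarrow> F (B x) = B (F x)"
proof -
  have bA: "bounded_op UNIV UNIV A"
    by (rule positive_op_bounded[OF A])
  obtain M where M: "M > 0" "\<And>x. norm (A x) \<le> M * norm x"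
    using bounded_op_UNIV_bound[OF bA] by blast
  \<comment> \<open>For \<open>A\<close> scaled by \<open>1/M\<close>, the operator
    \<open>1 - A/M\<close> is a symmetric contraction, by the inequality
    \<open>A^2 \<le> M A\<close>; this is the form that the iteration requires.\<close>
  define X where "X = (\<lambda>x. x - (1/M) *\<^sub>R A x)"
  have X: "bounded_op UNIV UNIV X"
    unfolding X_def scaleR_scaleC
    by (intro bounded_op_diff bounded_op_scaleC bounded_op_id bA csubspace_UNIV)
  have X_le: "norm (X x) \<le> norm x" for x
  proof -
    have "(norm (X x))\<^sup>2 = (norm x)\<^sup>2 + (1/M)\<^sup>2 * (norm (A x))\<^sup>2 - 2 * (1/M) * Re (cinner (A x) x)"
      using positive_op_symmetric[OF A, of x x]
      by (simp add: X_def norm_diff_sq cinner_scaleR_right power_mult_distrib power_divide)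
    moreover have "(1/M)\<^sup>2 * (norm (A x))\<^sup>2 \<le> (1/M) * Re (cinner (A x) x)"
      using mult_left_mono[OF positive_op_norm_sq_le[OF A M, of x], of "(1/M)\<^sup>2"] M
      by (simp add: power2_eq_square)
    moreover have "0 \<le> (1/M) * Re (cinner (A x) x)"
      using positive_op_Re[OF A, of x] M by simp
    ultimately have "(norm (X x))\<^sup>2 \<le> (norm x)\<^sup>2"
      by linarith
    then show ?thesis
      by (rule power2_le_imp_le[OF _ norm_ge_zero])
  qed
  have X_sym: "cinner (X x) y = cinner x (X y)" for x y
    using positive_op_symmetric[OF A, of x y]
    by (simp add: X_def cinner_diff_left cinner_diff_right cinner_scaleR_left cinner_scaleR_right)
  obtain G where G: "bounded_op UNIV UNIV G" "\<And>x. norm (G x) \<le> norm x"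
    "\<And>x y. cinner (G x) y = cinner x (G y)" "\<And>x. G (G x) = 2 *\<^sub>R G x - X x"
    "\<And>F x. bounded_op UNIV UNIV F \<Longrightarrow> (\<And>x. F (X x) = X (F x)) \<Longrightarrow> F (G x) = G (F x)"
    using sqrt_iter_limit[OF X X_le X_sym] by blast
  \<comment> \<open>From \<open>(1 - G)^2 = 1 - X = A/M\<close> the square root of \<open>A\<close>
    is \<open>sqrt M (1 - G)\<close>; it is positive because \<open>G\<close> is a symmetric
    contraction.\<close>
  define B where "B = (\<lambda>x. sqrt M *\<^sub>R (x - G x))"
  have bB: "bounded_op UNIV UNIV B"
    unfolding B_def scaleR_scaleC
    by (intro bounded_op_diff bounded_op_scaleC bounded_op_id G csubspace_UNIV)
  show ?thesis
  proof
    have "Im (cinner (G x) x) = 0" for x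
      using G(3)[of x x] cinner_commute[of "G x" x] by (simp add: complex_eq_iff)
    moreover have "Re (cinner (G x) x) \<le> (norm x)\<^sup>2" for x
      using Re_cinner_le[of "G x" x] mult_right_mono[OF G(2)[of x] norm_ge_zero[of x]]
      by (simp add: power2_eq_square)
    ultimately show "positive_op B"
      using bB M(1)
      by (auto simp: positive_op_def B_def cinner_scaleR_left cinner_diff_left cinner_self
          simp del: of_real_power)
    show "B (B x) = A x" for x
    proof -
      have "B (B x) = (sqrt M * sqrt M) *\<^sub>R ((x - G x) - (G x - G (G x)))"
        unfolding B_def bounded_op_UNIV_scaleR[OF G(1)] bounded_op_UNIV_diff[OF G(1)]
        by (simp flip: scaleR_diff_right)
      also have "\<dots> = M *\<^sub>R (x - X x)"
        using M(1) by (simp add: G(4) algebra_simps scaleR_2)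
      also have "\<dots> = A x"
        using M(1) by (simp add: X_def)
      finally show ?thesis .
    qed
    fix F :: "'a \<Rightarrow> 'a" and x
    assume F: "bounded_op UNIV UNIV F" "\<And>x. F (A x) = A (F x)"
    then have "F (X x) = X (F x)" for x
      by (simp add: X_def bounded_op_UNIV_diff bounded_op_UNIV_scaleR)
    then show "F (B x) = B (F x)"
      using F(1) G(5)[OF F(1)]
      by (simp add: B_def bounded_op_UNIV_diff bounded_op_UNIV_scaleR)
  qed
qed

text \<open>Commutation gives \<open>(B + B')(B - B') = B^2 - B'^2 = 0\<close>. With
  \<open>y = (B - B') x\<close> the two nonnegative forms of \<open>B\<close> and \<open>B'\<close>
  at \<open>y\<close> add up to zero, so \<open>B y = B' y = 0\<close> and hence
  \<open>cinner y y = cinner x ((B - B') y) = 0\<close>.\<close>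

lemma positive_sqrt_unique:
  assumes B: "positive_op B" and B': "positive_op B'" and "\<And>x. B (B x) = B' (B' x)"
    and comm: "\<And>x. B' (B x) = B (B' x)"
  shows "B x = B' x"
proof -
  note bB = positive_op_bounded[OF B] and bB' = positive_op_bounded[OF B']
  define y where "y = B x - B' x"
  have "B y + B' y = 0"
    by (simp add: y_def bounded_op_UNIV_diff[OF bB] bounded_op_UNIV_diff[OF bB'] assms(3) comm)
  then have "Re (cinner (B y) y) + Re (cinner (B' y) y) = 0"
    by (metis cinner_add_left cinner_zero_left plus_complex.simps(1) zero_complex.simps(1))
  then have "Re (cinner (B y) y) = 0" "Re (cinner (B' y) y) = 0"
    using positive_op_Re[OF B, of y] positive_op_Re[OF B', of y] by linarith+
  then have "B y = 0" "B' y = 0"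
    using positive_op_eq_zero B B' by blast+
  then have "cinner y y = 0"
    by (subst (1) y_def)
      (simp add: cinner_diff_left positive_op_symmetric[OF B] positive_op_symmetric[OF B'])
  then show ?thesis
    by (simp add: y_def)
qed

text \<open>Any positive \<open>B'\<close> with \<open>B'^2 = A\<close> commutes with
  \<open>A\<close>, hence with the root \<open>B\<close> produced by the iteration, so uniqueness
  among commuting roots is uniqueness outright.\<close>

lemma sqrt_op:
  assumes A: "positive_op A"
  shows sqrt_op_positive: "positive_op (sqrt_op A)"
    and sqrt_op_sqrt_op: "sqrt_op A (sqrt_op A x) = A x"
proof -
  obtain B where B: "positive_op B" "\<And>x. B (B x) = A x"
    "\<And>F x. bounded_op UNIV UNIV F \<Longrightarrow> (\<And>x. F (A x) = A (F x)) \<Longrightarrow> F (B x) = B (F x)"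
    using positive_sqrt_exists[OF A] by blast
  have "sqrt_op A = B"
    unfolding sqrt_op_def
  proof (rule the_equality)
    fix B' assume B': "positive_op B' \<and> B' \<circ> B' = A"
    then have A': "A x = B' (B' x)" for x by auto
    have "B' (A x) = A (B' x)" for x by (simp add: A')
    then have "B' (B x) = B (B' x)" for x
      using B(3) B' positive_op_bounded by blast
    then have "B x = B' x" for x
      using positive_sqrt_unique[OF B(1)] B' B(2) A' by metis
    then show "B' = B" by auto
  qed (use B in auto)
  then show "positive_op (sqrt_op A)" "sqrt_op A (sqrt_op A x) = A x"
    using B by auto
qed

lemma cinner_sqrt_op: "positive_op A \<Longrightarrow> cinner (sqrt_op A x) (sqrt_op A y) = cinner (A x) y"
  by (metis positive_op_symmetric sqrt_op_positive sqrt_op_sqrt_op)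

lemma norm_sqrt_op: "positive_op A \<Longrightarrow> (norm (sqrt_op A x))\<^sup>2 = Re (cinner (A x) x)"
  by (simp add: norm_sq_eq_cinner cinner_sqrt_op)

lemma csubspace_closure_range:
  assumes "bounded_op UNIV UNIV F"
  shows "closed_csubspace (closure (range F))"
  using bounded_op_UNIV_zero[OF assms] bounded_op_UNIV_add[OF assms]
      bounded_op_UNIV_scaleC[OF assms]
  by (intro csubspace_closure) (auto simp: image_iff, metis+)

section \<open>Extending partial isometries to unitaries\<close>

lemma closure_sequentialI: "(\<And>n. f n \<in> S) \<Longrightarrow> f \<longlonglongrightarrow> l \<Longrightarrow> l \<in> closure S"
  for l :: "'a::metric_space"
  unfolding closure_sequential by auto

definition isometry_on :: "'a::complex_hilbert set \<Rightarrow> ('a \<Rightarrow> 'b::complex_hilbert) \<Rightarrow> bool" where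
  "isometry_on V F \<longleftrightarrow> clinear_on V F \<and> (\<forall>x\<in>V. norm (F x) = norm x)"

lemma isometry_on_cinner:
  assumes V: "closed_csubspace V" and F: "isometry_on V F" and xy: "x \<in> V" "y \<in> V"
  shows "cinner (F x) (F y) = cinner x y"
proof -
  have lin: "clinear_on V F" and n: "\<And>x. x \<in> V \<Longrightarrow> norm (F x) = norm x"
    using F by (auto simp: isometry_on_def)
  have iy: "\<i> *\<^sub>C y \<in> V" by (rule csubspace_scaleC[OF V xy(2)])
  have "4 * cinner (F x) (F y) = 4 * cinner x y"
    unfolding polarization
    using n[OF csubspace_add[OF V xy]] n[OF csubspace_diff[OF V xy]]
      n[OF csubspace_add[OF V xy(1) iy]] n[OF csubspace_diff[OF V xy(1) iy]]
    by (simp add: clinear_on_add[OF lin] clinear_on_diff[OF V lin] clinear_on_scaleC[OF lin] xy iy)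
  then show ?thesis by simp
qed

lemma unitary_op_isometry: "unitary_op V W U \<Longrightarrow> isometry_on V U"
  by (auto simp: unitary_op_def isometry_on_def norm_sq_eq_cinner
      intro!: power2_eq_imp_eq[OF _ norm_ge_zero norm_ge_zero])

lemma isometry_on_inj:
  assumes V: "closed_csubspace V" and F: "isometry_on V F"
  shows "inj_on F V"
proof (rule inj_onI)
  fix x y assume "x \<in> V" "y \<in> V" "F x = F y"
  then have "norm (x - y) = 0"
    using F csubspace_diff[OF V, of x y] clinear_on_diff[OF V, of F x y]
    by (metis isometry_on_def norm_zero right_minus_eq)
  then show "x = y" by simp
qed

lemma unitary_opI:
  assumes "closed_csubspace V" "isometry_on V U" "U ` V = W"
  shows "unitary_op V W U"
  using assms isometry_on_inj[OF assms(1,2)] isometry_on_cinner[OF assms(1,2)]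
  by (auto simp: unitary_op_def bij_betw_def isometry_on_def)

lemma isometry_on_mono: "isometry_on V F \<Longrightarrow> V' \<subseteq> V \<Longrightarrow> isometry_on V' F"
  unfolding isometry_on_def clinear_on_def by blast

lemma unitary_op_inv:
  assumes V: "closed_csubspace V" and U: "unitary_op V W U"
  shows "unitary_op W V (inv_into V U)"
proof -
  let ?G = "inv_into V U"
  have bij: "bij_betw U V W" and lin: "clinear_on V U" and ci: "\<And>x y. x \<in> V \<Longrightarrow> y
      \<in> V \<Longrightarrow> cinner (U x) (U y) = cinner x y"
    using U by (auto simp: unitary_op_def)
  have UG: "U (?G y) = y" and G: "?G y \<in> V" if "y \<in> W" for y
    using bij that by (auto simp: bij_betw_def f_inv_into_f inv_into_into)
  have GU: "?G (U x) = x" if "x \<in> V" for x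
    using bij that by (simp add: bij_betw_def)
  have "?G (x + y) = ?G x + ?G y" if "x \<in> W" "y \<in> W" for x y
    using GU[of "?G x + ?G y"] by (simp add: that clinear_on_add[OF lin] UG G csubspace_add[OF V])
  moreover have "?G (c *\<^sub>C x) = c *\<^sub>C ?G x" if "x \<in> W" for c x
    using GU[of "c *\<^sub>C ?G x"] by (simp add: that clinear_on_scaleC[OF lin] UG G
        csubspace_scaleC[OF V])
  moreover have "cinner (?G x) (?G y) = cinner x y" if "x \<in> W" "y \<in> W" for x y
    using ci[OF G[OF that(1)] G[OF that(2)]] by (simp add: UG that)
  ultimately show ?thesis
    using bij_betw_inv_into[OF bij] by (auto simp: unitary_op_def clinear_on_def)
qed

text \<open>Distances are preserved, so a convergent sequence of images comes from a Cauchy sequence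
  in \<open>V\<close>, which has a limit in \<open>V\<close> by completeness.\<close>

lemma closed_csubspace_isometry_image:
  assumes V: "closed_csubspace V" and F: "isometry_on V F"
  shows "closed_csubspace (F ` V)"
proof -
  have lin: "clinear_on V F" and n: "\<And>x. x \<in> V \<Longrightarrow> norm (F x) = norm x"
    using F by (auto simp: isometry_on_def)
  have dist_eq: "dist (F x) (F y) = dist x y" if "x \<in> V" "y \<in> V" for x y
    using n[OF csubspace_diff[OF V that]] by (simp add: dist_norm clinear_on_diff[OF V lin that])
  have "closed (F ` V)"
    unfolding closed_sequential_limits
  proof (intro allI impI, elim conjE)
    fix f l assume f: "\<forall>n. f n \<in> F ` V" "f \<longlonglongrightarrow> l"
    then have "\<forall>n. \<exists>y. y \<in> V \<and> f n = F y"
      by blast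
    then obtain x where x: "\<And>n. x n \<in> V" "\<And>n. f n = F (x n)"
      using choice by metis
    have "Cauchy f"
      using f(2) convergent_Cauchy convergent_def by blast
    then have "Cauchy x"
      unfolding Cauchy_def by (simp add: x dist_eq)
    then obtain y where y: "x \<longlonglongrightarrow> y"
      using Cauchy_convergent convergent_def by blast
    have yV: "y \<in> V"
      using closed_sequentially[OF csubspace_closed[OF V] _ y] x(1) by blast
    have "(\<lambda>n. dist (f n) (F y)) \<longlonglongrightarrow> 0"
      using y by (simp add: x dist_eq yV tendsto_dist_iff[symmetric])
    then have "f \<longlonglongrightarrow> F y"
      using tendsto_dist_iff by blast
    then show "l \<in> F ` V"
      using f(2) LIMSEQ_unique yV by blast
  qed
  moreover have "0 \<in> F ` V"
    using clinear_on_zero[OF lin csubspace_zero[OF V]] csubspace_zero[OF V] by force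
  moreover have "x + y \<in> F ` V" if "x \<in> F ` V" "y \<in> F ` V" for x y
    using that clinear_on_add[OF lin] csubspace_add[OF V]
        by (metis (no_types, lifting) imageE imageI)
  moreover have "c *\<^sub>C x \<in> F ` V" if "x \<in> F ` V" for x c
    using that clinear_on_scaleC[OF lin] csubspace_scaleC[OF V]
        by (metis (no_types, lifting) imageE imageI)
  ultimately show ?thesis
    by (auto simp: closed_csubspace_def)
qed

section \<open>Orthogonal sums of unitaries\<close>

definition proj :: "'a::complex_hilbert set \<Rightarrow> 'a \<Rightarrow> 'a" where
  "proj V x = (SOME p. p \<in> V \<and> x - p \<in> orth V)"

lemma proj:
  assumes "closed_csubspace V"
  shows proj_in: "proj V x \<in> V" and proj_orth: "x - proj V x \<in> orth V"
  using someI_ex[of "\<lambda>p. p \<in> V \<and> x - p \<in> orth V"] orth_projection[OF assms, of x]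
  unfolding proj_def by auto

lemma proj_eq:
  assumes V: "closed_csubspace V" and p: "p \<in> V" "x - p \<in> orth V"
  shows "proj V x = p"
proof -
  let ?q = "proj V x"
  have "(x - p) - (x - ?q) \<in> orth V"
    using p proj_orth[OF V] csubspace_orth csubspace_diff by blast
  moreover have "?q - p \<in> V"
    using p proj_in[OF V] csubspace_diff[OF V] by blast
  ultimately have "cinner (?q - p) (?q - p) = 0"
    by (simp add: orth_def)
  then show ?thesis by simp
qed

lemma proj_add: "closed_csubspace V \<Longrightarrow> proj V (x + y) = proj V x + proj V y"
  using csubspace_add[OF csubspace_orth proj_orth[of V x] proj_orth[of V y]]
  by (intro proj_eq csubspace_add proj_in) (auto simp: algebra_simps)

lemma proj_scaleC: "closed_csubspace V \<Longrightarrow> proj V (c *\<^sub>C x) = c *\<^sub>C proj V x"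
  using csubspace_scaleC[OF csubspace_orth proj_orth[of V x], of c]
  by (intro proj_eq csubspace_scaleC proj_in) (auto simp: scaleC_diff_right)

text \<open>Every vector of \<open>A\<close> splits into its projection onto \<open>M\<close> and a
  remainder in \<open>A \<inter> orth M\<close>. The two unitaries act on the two parts, and
  Pythagoras in \<open>B\<close> adds up the norms.\<close>

lemma unitary_glue:
  assumes A: "closed_csubspace A" and B: "closed_csubspace B"
    and M: "closed_csubspace M" "M \<subseteq> A" and N: "closed_csubspace N" "N \<subseteq> B"
    and U1: "unitary_op M N U1" and U2: "unitary_op (A \<inter> orth M) (B \<inter> orth N) U2"
  shows "\<exists>U. unitary_op A B U \<and> (\<forall>x\<in>M. U x = U1 x)"
proof -
  define U where "U x = U1 (proj M x) + U2 (x - proj M x)" for x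
  note oM = csubspace_Int[OF A csubspace_orth[of M]]
      and oN = csubspace_Int[OF B csubspace_orth[of N]]
  have lin1: "clinear_on M U1" and lin2: "clinear_on (A \<inter> orth M) U2"
    and iso1: "isometry_on M U1" and iso2: "isometry_on (A \<inter> orth M) U2"
    using U1 U2 unitary_op_isometry by (auto simp: unitary_op_def)
  have U1N: "U1 ` M = N" and U2N: "U2 ` (A \<inter> orth M) = B \<inter> orth N"
    using U1 U2 by (auto simp: unitary_op_def bij_betw_def)
  have pM: "proj M x \<in> M" for x by (rule proj_in[OF M(1)])
  have pO: "x - proj M x \<in> A \<inter> orth M" if "x \<in> A" for x
    using that proj_orth[OF M(1)] pM M(2) csubspace_diff[OF A] by blast
  have U_dec: "U (a + b) = U1 a + U2 b" if "a \<in> M" "b \<in> A \<inter> orth M" for a b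
  proof -
    have "proj M (a + b) = a"
      using that by (intro proj_eq[OF M(1)]) auto
    then show ?thesis by (simp add: U_def)
  qed
  have "clinear_on A U"
    unfolding clinear_on_def
  proof (intro conjI ballI allI)
    fix x y c assume x: "x \<in> A" and y: "y \<in> A"
    have "U (x + y) = U ((proj M x + proj M y) + ((x - proj M x) + (y - proj M y)))"
      by (simp add: algebra_simps)
    also have "\<dots> = U x + U y"
      by (subst U_dec)
        (use csubspace_add[OF M(1) pM pM] csubspace_add[OF oM pO[OF x] pO[OF y]] in
          \<open>auto simp: U_def clinear_on_add[OF lin1 pM pM] clinear_on_add[OF lin2 pO[OF x]
              pO[OF y]]\<close>)
    finally show "U (x + y) = U x + U y" .
    have "U (c *\<^sub>C x) = U (c *\<^sub>C proj M x + c *\<^sub>C (x - proj M x))"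
      by (simp add: scaleC_diff_right)
    also have "\<dots> = c *\<^sub>C U x"
      by (subst U_dec)
        (use csubspace_scaleC[OF M(1) pM] csubspace_scaleC[OF oM pO[OF x]] in
          \<open>auto simp: U_def clinear_on_scaleC[OF lin1 pM] clinear_on_scaleC[OF lin2 pO[OF x]]
              scaleC_add_right\<close>)
    finally show "U (c *\<^sub>C x) = c *\<^sub>C U x" .
  qed
  moreover have "norm (U x) = norm x" if x: "x \<in> A" for x
  proof -
    let ?a = "proj M x" and ?b = "x - proj M x"
    have "cinner (U2 ?b) (U1 ?a) = 0"
      using U1N U2N pM[of x] pO[OF x] unfolding orth_def by blast
    then have "(norm (U x))\<^sup>2 = (norm (U1 ?a))\<^sup>2 + (norm (U2 ?b))\<^sup>2"
      unfolding U_def norm_add_sq using cinner_zero_commute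
          by (metis mult_zero_right add.right_neutral zero_complex.simps(1))
    also have "\<dots> = (norm ?a)\<^sup>2 + (norm ?b)\<^sup>2"
      using iso1 iso2 pM[of x] pO[OF x] by (simp add: isometry_on_def)
    also have "\<dots> = (norm (?a + ?b))\<^sup>2"
    proof -
      have "cinner ?b ?a = 0"
        using pM[of x] pO[OF x] unfolding orth_def by blast
      then show ?thesis
        unfolding norm_add_sq using cinner_zero_commute
        by (metis mult_zero_right add.right_neutral zero_complex.simps(1))
    qed
    finally show ?thesis by simp
  qed
  moreover have "U ` A = B"
  proof (intro equalityI image_subsetI subsetI)
    fix x assume "x \<in> A"
    then show "U x \<in> B"
      unfolding U_def using U1N U2N pM[of x] pO N(2) by (intro csubspace_add[OF B]) auto
  next
    fix y assume y: "y \<in> B"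
    have "proj N y \<in> N" "y - proj N y \<in> B \<inter> orth N"
      using proj_in[OF N(1)] proj_orth[OF N(1)] y N(2) csubspace_diff[OF B] by blast+
    then obtain a b where "a \<in> M" "proj N y = U1 a" "b \<in> A \<inter> orth M" "y - proj N y = U2 b"
      using U1N U2N by (metis imageE)
    then have "y = U (a + b)" "a + b \<in> A"
      using U_dec[of a b] M(2) csubspace_add[OF A, of a b] by (auto simp: algebra_simps)
    then show "y \<in> U ` A" by blast
  qed
  ultimately have "unitary_op A B U"
    by (intro unitary_opI A) (auto simp: isometry_on_def)
  moreover have "U x = U1 x" if "x \<in> M" for x
    using U_dec[OF that csubspace_zero[OF oM]] clinear_on_zero[OF lin2 csubspace_zero[OF oM]]
        by simp
  ultimately show ?thesis by blast
qed

lemma rel_orth_orth: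
  assumes A: "closed_csubspace A" and Y: "closed_csubspace Y" "Y \<subseteq> A"
  shows "A \<inter> orth (A \<inter> orth Y) = Y"
proof (intro equalityI subsetI)
  fix x assume x: "x \<in> A \<inter> orth (A \<inter> orth Y)"
  let ?p = "proj Y x"
  have "?p \<in> Y" "x - ?p \<in> A \<inter> orth Y"
    using x proj_in[OF Y(1)] proj_orth[OF Y(1)] Y(2) csubspace_diff[OF A] by blast+
  then have "cinner x (x - ?p) = 0" "cinner (x - ?p) ?p = 0"
    using x unfolding orth_def by blast+
  then have "cinner (x - ?p) (x - ?p) = 0"
    using cinner_zero_commute by (metis cinner_diff_left diff_self)
  then show "x \<in> Y"
    using \<open>?p \<in> Y\<close> by simp
next
  fix x assume "x \<in> Y"
  then show "x \<in> A \<inter> orth (A \<inter> orth Y)"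
    using Y(2) cinner_zero_commute unfolding orth_def by blast
qed

text \<open>
  As in the Schroeder-Bernstein theorem for sets, but with orthogonal complements in the
  fixed-point equation, so that the fixed point is automatically a closed subspace.
\<close>

theorem schroeder_bernstein_unitary:
  assumes A: "closed_csubspace A" and B: "closed_csubspace B"
    and V: "isometry_on A V" "V ` A \<subseteq> B" and W: "isometry_on B W" "W ` B \<subseteq> A"
  shows "\<exists>U. unitary_op A B U"
proof -
  \<comment> \<open>Each of the two complements reverses inclusions, so \<open>f\<close> is monotone
    and has a least fixed point in the lattice of all subsets.\<close>
  define f where "f M = A \<inter> orth (W ` (B \<inter> orth (V ` M)))" for M
  have "mono f"
    unfolding mono_def f_def orth_def by blast
  define M where "M = lfp f"
  have M_eq: "M = f M"
    unfolding M_def by (rule lfp_unfold[OF \<open>mono f\<close>])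
  have MA: "M \<subseteq> A"
    using M_eq by (auto simp: f_def)
  have M: "closed_csubspace M"
    by (subst M_eq) (auto simp: f_def intro: csubspace_Int A csubspace_orth)
  define N where "N = V ` M"
  have VM: "isometry_on M V"
    using V(1) MA isometry_on_mono by blast
  have N: "closed_csubspace N" "N \<subseteq> B"
    using closed_csubspace_isometry_image[OF M VM] V(2) MA by (auto simp: N_def)
  have oN: "closed_csubspace (B \<inter> orth N)"
    by (intro csubspace_Int B csubspace_orth)
  have WN: "isometry_on (B \<inter> orth N) W"
    using W(1) isometry_on_mono by blast
  have "unitary_op M N V"
    by (intro unitary_opI M VM) (simp add: N_def)
  \<comment> \<open>By the fixed-point equation \<open>A \<inter> orth M\<close> is a double
    complement of this image, and the image is closed because \<open>W\<close> is isometric.\<close>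
  moreover have "W ` (B \<inter> orth N) = A \<inter> orth M"
  proof -
    have "closed_csubspace (W ` (B \<inter> orth N))" "W ` (B \<inter> orth N) \<subseteq> A"
      using closed_csubspace_isometry_image[OF oN WN] W(2) by auto
    from rel_orth_orth[OF A this] show ?thesis
      using M_eq by (simp add: f_def N_def)
  qed
  then have "unitary_op (B \<inter> orth N) (A \<inter> orth M) W"
    by (intro unitary_opI oN WN)
  then have "unitary_op (A \<inter> orth M) (B \<inter> orth N) (inv_into (B \<inter> orth N) W)"
    by (rule unitary_op_inv[OF oN])
  ultimately show ?thesis
    using unitary_glue[OF A B M MA N] by blast
qed

text \<open>Equality of norms, applied to differences, makes \<open>g k \<mapsto> h k\<close> well
  defined and isometric, so it extends by uniform continuity to the closures.\<close>

lemma unitary_between_ranges: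
  fixes g :: "'k::complex_hilbert \<Rightarrow> 'a::complex_hilbert" and h :: "'k \<Rightarrow> 'b::complex_hilbert"
  assumes g: "bounded_op UNIV UNIV g" and h: "bounded_op UNIV UNIV h"
    and n: "\<And>k. norm (g k) = norm (h k)"
  shows "\<exists>U. unitary_op (closure (range g)) (closure (range h)) U \<and> (\<forall>k. U (g k) = h k)"
proof -
  note cg = csubspace_closure_range[OF g] and ch = csubspace_closure_range[OF h]
  define f where "f x = h (SOME k. g k = x)" for x
  have fg: "f (g k) = h k" for k
  proof -
    define k' where "k' = (SOME k'. g k' = g k)"
    have "g k' = g k"
      unfolding k'_def by (rule someI) (rule refl)
    then have "norm (h (k' - k)) = 0"
      by (simp flip: n add: bounded_op_UNIV_diff[OF g])
    then show ?thesis
      by (simp add: f_def k'_def[symmetric] bounded_op_UNIV_diff[OF h])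
  qed
  have dist_f: "dist (f x) (f y) = dist x y" if "x \<in> range g" "y \<in> range g" for x y
    using that n by (auto simp: fg dist_norm simp flip: bounded_op_UNIV_diff[OF h]
        bounded_op_UNIV_diff[OF g])
  have "uniformly_continuous_on (range g) f"
    unfolding uniformly_continuous_on_def using dist_f by metis
  then obtain U where U: "uniformly_continuous_on (closure (range g)) U" "\<And>x. x \<in> range g \<Longrightarrow> f x
      = U x"
    using uniformly_continuous_on_extension_on_closure by metis
  have Ug: "U (g k) = h k" for k
    using U(2) fg by auto
  have cont: "continuous_on (closure (range g)) U"
    using U(1) uniformly_continuous_imp_continuous by blast
  \<comment> \<open>The points \<open>k n\<close> themselves need not converge. Keeping the same
    points for \<open>g\<close> and for \<open>h\<close> is what lets linearity and equality of
    norms pass to the limit.\<close>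
  have seq: "\<exists>k. (\<lambda>n. g (k n)) \<longlonglongrightarrow> x \<and> (\<lambda>n. h (k n)) \<longlonglongrightarrow> U x"
    if x: "x \<in> closure (range g)" for x
  proof -
    obtain y where "\<forall>n. y n \<in> range g" "y \<longlonglongrightarrow> x"
      using x unfolding closure_sequential by blast
    then have "\<forall>n. \<exists>k. y n = g k"
      by blast
    then obtain k where k: "\<And>n. y n = g (k n)"
      using choice by metis
    then have "y = (\<lambda>n. g (k n))"
      by auto
    then have lim: "(\<lambda>n. g (k n)) \<longlonglongrightarrow> x"
      using \<open>y \<longlonglongrightarrow> x\<close> by simp
    moreover have "(\<lambda>n. U (g (k n))) \<longlonglongrightarrow> U x"
      using closure_subset[of "range g"]
      by (intro continuous_on_tendsto_compose[OF cont lim x]) (auto intro!: always_eventually)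
    ultimately show ?thesis
      by (auto simp: Ug)
  qed
  have U_lim: "U x = l" if "(\<lambda>n. g (k n)) \<longlonglongrightarrow> x" "(\<lambda>n. h (k n)) \<longlonglongrightarrow> l" for x l k
  proof -
    have x: "x \<in> closure (range g)"
      by (rule closure_sequentialI[OF _ that(1)]) simp
    have "(\<lambda>n. U (g (k n))) \<longlonglongrightarrow> U x"
      using closure_subset[of "range g"]
      by (intro continuous_on_tendsto_compose[OF cont that(1) x]) (auto intro!: always_eventually)
    then show ?thesis
      using LIMSEQ_unique[OF _ that(2), of "U x"] by (simp add: Ug)
  qed
  have "clinear_on (closure (range g)) U"
    unfolding clinear_on_def
  proof (intro conjI ballI allI)
    fix x y c assume "x \<in> closure (range g)" "y \<in> closure (range g)"
    then obtain k l where k: "(\<lambda>n. g (k n)) \<longlonglongrightarrow> x" "(\<lambda>n. h (k n)) \<longlonglongrightarrow> U x"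
      and l: "(\<lambda>n. g (l n)) \<longlonglongrightarrow> y" "(\<lambda>n. h (l n)) \<longlonglongrightarrow> U y"
      using seq by blast
    show "U (x + y) = U x + U y"
      by (rule U_lim[where k = "\<lambda>n. k n + l n"])
        (use tendsto_add[OF k(1) l(1)] tendsto_add[OF k(2) l(2)] in
          \<open>auto simp: bounded_op_UNIV_add[OF g] bounded_op_UNIV_add[OF h]\<close>)
    show "U (c *\<^sub>C x) = c *\<^sub>C U x"
      by (rule U_lim[where k = "\<lambda>n. c *\<^sub>C k n"])
        (use tendsto_scaleC[OF tendsto_const k(1)] tendsto_scaleC[OF tendsto_const k(2)] in
          \<open>auto simp: bounded_op_UNIV_scaleC[OF g] bounded_op_UNIV_scaleC[OF h]\<close>)
  qed
  moreover have "norm (U x) = norm x" if "x \<in> closure (range g)" for x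
  proof -
    obtain k where k: "(\<lambda>n. g (k n)) \<longlonglongrightarrow> x" "(\<lambda>n. h (k n)) \<longlonglongrightarrow> U x"
      using seq \<open>x \<in> closure (range g)\<close> by blast
    show ?thesis
      using LIMSEQ_unique[OF tendsto_norm[OF k(2)]] tendsto_norm[OF k(1)] by (simp add: n)
  qed
  ultimately have iso: "isometry_on (closure (range g)) U"
    by (auto simp: isometry_on_def)
  have "U ` closure (range g) = closure (range h)"
  proof (intro equalityI image_subsetI)
    fix x assume "x \<in> closure (range g)"
    then obtain k where "(\<lambda>n. h (k n)) \<longlonglongrightarrow> U x"
      using seq by blast
    then show "U x \<in> closure (range h)"
      by (rule closure_sequentialI[rotated]) simp
  next
    have "range h \<subseteq> U ` closure (range g)"
      using closure_subset[of "range g"] by (auto simp flip: Ug)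
    then show "closure (range h) \<subseteq> U ` closure (range g)"
      using closure_minimal csubspace_closed[OF closed_csubspace_isometry_image[OF cg iso]] by blast
  qed
  then show ?thesis
    using unitary_opI[OF cg iso] Ug by blast
qed

text \<open>\<open>V\<close> and \<open>W\<close> map into the complements of the ranges of
  \<open>h\<close> and \<open>g\<close>, so their restrictions embed the two complements into each
  other. Schroeder-Bernstein then supplies a unitary between the complements, to be glued to the one
  between the closed ranges.\<close>

lemma unitary_extension:
  fixes g :: "'k::complex_hilbert \<Rightarrow> 'a::complex_hilbert" and h :: "'k \<Rightarrow> 'b::complex_hilbert"
  assumes A: "closed_csubspace A" and B: "closed_csubspace B"
    and g: "bounded_op UNIV A g" and h: "bounded_op UNIV B h" and n: "\<And>k. norm (g k) = norm (h k)"
    and V: "isometry_on A V" "V ` A \<subseteq> B" "\<And>a k. a \<in> A \<Longrightarrow> cinner (V a) (h k) = 0"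
    and W: "isometry_on B W" "W ` B \<subseteq> A" "\<And>b k. b \<in> B \<Longrightarrow> cinner (W b) (g k) = 0"
  shows "\<exists>U. unitary_op A B U \<and> (\<forall>k. U (g k) = h k)"
proof -
  let ?M = "closure (range g)" and ?N = "closure (range h)"
  have g': "bounded_op UNIV UNIV g" and h': "bounded_op UNIV UNIV h"
    using g h by (auto intro: bounded_op_mono)
  obtain U1 where U1: "unitary_op ?M ?N U1" "\<And>k. U1 (g k) = h k"
    using unitary_between_ranges[OF g' h' n] by blast
  have "range g \<subseteq> A" "range h \<subseteq> B"
    using g h by (auto simp: bounded_op_def)
  then have sub: "?M \<subseteq> A" "?N \<subseteq> B"
    using closure_minimal csubspace_closed A B by blast+
  have "V ` (A \<inter> orth ?M) \<subseteq> B \<inter> orth ?N" "W ` (B \<inter> orth ?N) \<subseteq> A \<inter> orth ?M"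
    unfolding orth_closure using V W by (auto simp: orth_def)
  moreover have "isometry_on (A \<inter> orth ?M) V" "isometry_on (B \<inter> orth ?N) W"
    using V(1) W(1) isometry_on_mono by blast+
  ultimately have "\<exists>U. unitary_op (A \<inter> orth ?M) (B \<inter> orth ?N) U"
    by (intro schroeder_bernstein_unitary[where V = V and W = W] csubspace_Int A B csubspace_orth)
  then obtain U2 where "unitary_op (A \<inter> orth ?M) (B \<inter> orth ?N) U2" by blast
  from unitary_glue[OF A B csubspace_closure_range[OF g'] sub(1) csubspace_closure_range[OF h']
      sub(2) U1(1) this]
  obtain U where "unitary_op A B U" "\<And>x. x \<in> ?M \<Longrightarrow> U x = U1 x" by blast
  moreover have "g k \<in> ?M" for k
    using closure_subset[of "range g"] by auto
  ultimately show ?thesis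
    using U1(2) by metis
qed

section \<open>Isometries into square-summable sequences\<close>

lift_definition l2single :: "'a::complex_hilbert \<Rightarrow> 'a l2seq" is "\<lambda>x i. if i = 0 then x else 0"
  by (rule summable_finite[of "{0}"]) auto

lemma norm_l2single: "norm (l2single x) = norm x"
  by transfer (subst suminf_finite[of "{0}"], auto)

text \<open>Interleaving places the first sequence at even and the second at odd positions, which
  identifies the square of the sequence space with the space itself within one type.\<close>

lift_definition l2pair :: "'a::complex_hilbert l2seq \<Rightarrow> 'a l2seq \<Rightarrow> 'a l2seq"
  is "\<lambda>f g i. if even i then f (i div 2) else g ((i - 1) div 2)"
proof -
  fix f g :: "nat \<Rightarrow> 'a"
  assume "summable (\<lambda>i. (norm (f i))\<^sup>2)" "summable (\<lambda>i. (norm (g i))\<^sup>2)"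
  then have "summable (\<lambda>i. if even i then (norm (f (i div 2)))\<^sup>2 else (norm (g ((i - 1) div 2)))\<^sup>2)"
    using sums_if[of "\<lambda>i. (norm (g i))\<^sup>2" _ "\<lambda>i. (norm (f i))\<^sup>2"]
    by (meson summable_sums sums_summable)
  then show "summable (\<lambda>i. (norm (if even i then f (i div 2) else g ((i - 1) div 2)))\<^sup>2)"
    by (subst if_distrib[of norm], subst if_distrib[of "\<lambda>x. x\<^sup>2"])
qed

lemma norm_l2pair: "(norm (l2pair f g))\<^sup>2 = (norm f)\<^sup>2 + (norm g)\<^sup>2"
proof transfer
  fix f g :: "nat \<Rightarrow> 'a"
  assume "summable (\<lambda>i. (norm (f i))\<^sup>2)" "summable (\<lambda>i. (norm (g i))\<^sup>2)"
  then have "(\<lambda>i. if even i then (norm (f (i div 2)))\<^sup>2 else (norm (g ((i - 1) div 2)))\<^sup>2) sums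
      ((\<Sum>i. (norm (g i))\<^sup>2) + (\<Sum>i. (norm (f i))\<^sup>2))"
    by (intro sums_if) (auto simp: summable_sums)
  then have "(\<lambda>i. (norm (if even i then f (i div 2) else g ((i - 1) div 2)))\<^sup>2) sums
      ((\<Sum>i. (norm (g i))\<^sup>2) + (\<Sum>i. (norm (f i))\<^sup>2))"
    by (subst if_distrib[of norm], subst if_distrib[of "\<lambda>x. x\<^sup>2"])
  then have "(\<Sum>i. (norm (if even i then f (i div 2) else g ((i - 1) div 2)))\<^sup>2)
      = (\<Sum>i. (norm (f i))\<^sup>2) + (\<Sum>i. (norm (g i))\<^sup>2)"
    by (simp add: sums_iff)
  moreover have "0 \<le> (\<Sum>i. (norm (f i))\<^sup>2)" "0 \<le> (\<Sum>i. (norm (g i))\<^sup>2)"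
    by (simp_all add: suminf_nonneg \<open>summable (\<lambda>i. (norm (f i))\<^sup>2)\<close> \<open>summable (\<lambda>i. (norm (g i))\<^sup>2)\<close>)
  ultimately show "(sqrt (\<Sum>i. (norm (if even i then f (i div 2) else g ((i - 1) div 2)))\<^sup>2))\<^sup>2
      = (sqrt (\<Sum>i. (norm (f i))\<^sup>2))\<^sup>2 + (sqrt (\<Sum>i. (norm (g i))\<^sup>2))\<^sup>2"
    by simp
qed

lemma l2single_add: "l2single (x + y) = l2single x + l2single y"
  and l2single_scaleC: "l2single (c *\<^sub>C x) = c *\<^sub>C l2single x"
  by (transfer; auto)+

lemma l2pair_add: "l2pair (f + f') (g + g') = l2pair f g + l2pair f' g'"
  and l2pair_scaleC: "l2pair (c *\<^sub>C f) (c *\<^sub>C g) = c *\<^sub>C l2pair f g"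
  by (transfer; auto)+

text \<open>The coordinates are interleaved one at a time. The number of coordinates is fixed by the
  type, so the induction runs over the set \<open>A\<close> of coordinates encoded so far.\<close>

lemma l2seq_vec_encoding:
  "\<exists>J :: 'a::complex_hilbert l2seq ^ 'n::finite \<Rightarrow> 'a l2seq. clinear_on UNIV J \<and>
     (\<forall>v. (norm (J v))\<^sup>2 = (\<Sum>i\<in>A. (norm (v $ i))\<^sup>2))"
proof (induction A rule: infinite_finite_induct)
  case (insert a A)
  then obtain J :: "'a l2seq ^ 'n \<Rightarrow> 'a l2seq" where
    J: "clinear_on UNIV J" "\<And>v. (norm (J v))\<^sup>2 = (\<Sum>i\<in>A. (norm (v $ i))\<^sup>2)" by blast
  define J' where "J' v = l2pair (v $ a) (J v)" for v
  have "clinear_on UNIV J'"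
    using J(1) by (simp add: clinear_on_def J'_def scaleC_vec_def l2pair_add l2pair_scaleC)
  moreover have "(norm (J' v))\<^sup>2 = (\<Sum>i\<in>insert a A. (norm (v $ i))\<^sup>2)" for v
    using insert by (simp add: J'_def norm_l2pair J(2))
  ultimately show ?case by blast
qed (auto intro!: exI[of _ "\<lambda>_. 0"] simp: clinear_on_def)

lemma norm_prod_sq: "(norm p)\<^sup>2 = (norm (fst p))\<^sup>2 + (norm (snd p))\<^sup>2"
  by (simp add: norm_prod_def)

lemma norm_vec_sq: "(norm v)\<^sup>2 = (\<Sum>i\<in>UNIV. (norm (v $ i))\<^sup>2)"
  by (simp add: norm_vec_def L2_set_def sum_nonneg)

text \<open>
  With all of \<open>\<ell>\<^sup>2(\<nat>; \<H> \<oplus> \<K>)\<close> as auxiliary space, both sides of the extension problem embed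
  isometrically into each other away from the prescribed ranges.
\<close>

lemma colligation_unitary_exists:
  fixes p :: "'k::complex_hilbert \<Rightarrow> 'k" and p' :: "'k \<Rightarrow> 'h::complex_hilbert"
    and q :: "'n::finite \<Rightarrow> 'k \<Rightarrow> 'k" and q' :: "'k \<Rightarrow> 'k"
  assumes V: "closed_csubspace V" and V': "closed_csubspace V'" and R0: "closed_csubspace R0"
    and p: "bounded_op UNIV V p" and p': "bounded_op UNIV V' p'"
    and q: "\<And>i. bounded_op UNIV R0 (q i)" and q': "bounded_op UNIV R0 q'"
    and n: "\<And>k. (norm (p k))\<^sup>2 + (\<Sum>i\<in>UNIV. (norm (q i k))\<^sup>2) = (norm (p' k))\<^sup>2 + (norm (q' k))\<^sup>2"
  shows "\<exists>U. unitary_op (V \<times> vec_space (R0 \<times> (UNIV :: ('h \<times> 'k) l2seq set)))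
      (V' \<times> (R0 \<times> (UNIV :: ('h \<times> 'k) l2seq set))) U \<and> (\<forall>k. U (p k, \<chi> i. (q i k, 0))
          = (p' k, (q' k, 0)))"
proof -
  let ?R = "R0 \<times> (UNIV :: ('h \<times> 'k) l2seq set)"
  have R: "closed_csubspace ?R"
    by (intro csubspace_Times R0 csubspace_UNIV)
  define g where "g k = (p k, \<chi> i. (q i k, 0 :: ('h \<times> 'k) l2seq))" for k
  define h where "h k = (p' k, (q' k, 0 :: ('h \<times> 'k) l2seq))" for k
  have n_gh: "norm (g k) = norm (h k)" for k
    by (rule power2_eq_imp_eq) (auto simp: norm_prod_sq norm_vec_sq g_def h_def n)
  have lin_h: "clinear_on UNIV h"
    using bounded_op_linear[OF p'] bounded_op_linear[OF q']
    by (auto simp: clinear_on_def h_def scaleC_prod_def)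
  have lin_g: "clinear_on UNIV g"
    unfolding clinear_on_def g_def
    by (simp add: bounded_op_UNIV_add[OF p] bounded_op_UNIV_add[OF q] bounded_op_UNIV_scaleC[OF p]
        bounded_op_UNIV_scaleC[OF q] scaleC_prod_def scaleC_vec_def vec_eq_iff)
  obtain M where M: "\<And>k. norm (p' k) \<le> M * norm k"
    using bounded_op_UNIV_bound[OF p'] by metis
  obtain N where N: "\<And>k. norm (q' k) \<le> N * norm k"
    using bounded_op_UNIV_bound[OF q'] by metis
  have bound_h: "norm (h k) \<le> (M + N) * norm k" for k
    using M[of k] N[of k] norm_Pair_le[of "p' k" "(q' k, 0 :: ('h \<times> 'k) l2seq)"]
      norm_Pair_le[of "q' k" "0 :: ('h \<times> 'k) l2seq"]
    unfolding h_def distrib_right by simp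
  have h: "bounded_op UNIV (V' \<times> ?R) h"
    using lin_h bound_h p' q' unfolding bounded_op_def h_def by auto
  have g: "bounded_op UNIV (V \<times> vec_space ?R) g"
    using lin_g bound_h bounded_op_in[OF p UNIV_I] bounded_op_in[OF q UNIV_I]
    unfolding bounded_op_def n_gh[symmetric] by (auto simp: g_def vec_space_def)
  obtain J :: "('h \<times> 'k) l2seq ^ 'n \<Rightarrow> ('h \<times> 'k) l2seq" where
    J: "clinear_on UNIV J" "\<And>v. (norm (J v))\<^sup>2 = (\<Sum>i\<in>UNIV. (norm (v $ i))\<^sup>2)"
    using l2seq_vec_encoding[of UNIV] by blast
  \<comment> \<open>Everything is packed into the sequence component, where every \<open>h k\<close>
    has entry \<open>0\<close>; the image is thus orthogonal to the range of \<open>h\<close>.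
    Vectors of \<open>'k\<close> enter as the second half of an entry in
    \<open>'h \<times> 'k\<close>.\<close>
  define j1 :: "'k \<times> (('k \<times> ('h \<times> 'k) l2seq) ^ 'n) \<Rightarrow> 'h \<times> ('k \<times> ('h \<times> 'k) l2seq)" where
    "j1 x = (0, (0, l2pair (l2single (0, fst x))
      (J (\<chi> i. l2pair (l2single (0, fst (snd x $ i))) (snd (snd x $ i))))))" for x
  \<comment> \<open>The same packing in the opposite direction, into the sequence component of a
    single coordinate; \<open>undefined\<close> stands for one arbitrary but fixed index. Both
    halves of an entry in \<open>'h \<times> 'k\<close> are occupied here.\<close>
  define j2 :: "'h \<times> ('k \<times> ('h \<times> 'k) l2seq) \<Rightarrow> 'k \<times> (('k \<times> ('h \<times> 'k) l2seq) ^ 'n)" where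
    "j2 x = (0, \<chi> i. (0, if i = undefined
       then l2pair (l2single (fst x, fst (snd x))) (snd (snd x)) else 0))" for x
  have s_add: "l2single (0 :: 'h, x + y) = l2single (0, x) + l2single (0, y)"
    and s_scale: "l2single (0 :: 'h, c *\<^sub>C x) = c *\<^sub>C l2single (0, x)"
    for x y :: 'k and c
    using l2single_add[of "(0 :: 'h, x)" "(0, y)"] l2single_scaleC[of c "(0 :: 'h, x)"]
    by (auto simp: scaleC_prod_def)
  have iso1: "isometry_on UNIV j1"
  proof -
    have "j1 (x + y) = j1 x + j1 y" for x y
    proof -
      have "(\<chi> i. l2pair (l2single (0 :: 'h, fst (snd (x + y) $ i))) (snd (snd (x + y) $ i)))
        = (\<chi> i. l2pair (l2single (0, fst (snd x $ i))) (snd (snd x $ i)))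
          + (\<chi> i. l2pair (l2single (0, fst (snd y $ i))) (snd (snd y $ i)))"
        by (simp add: vec_eq_iff s_add l2pair_add)
      then show ?thesis
        using J(1) by (simp add: j1_def s_add l2pair_add clinear_on_def)
    qed
    moreover have "j1 (c *\<^sub>C x) = c *\<^sub>C j1 x" for c x
    proof -
      have "(\<chi> i. l2pair (l2single (0 :: 'h, fst (snd (c *\<^sub>C x) $ i))) (snd (snd (c *\<^sub>C x) $ i)))
        = c *\<^sub>C (\<chi> i. l2pair (l2single (0, fst (snd x $ i))) (snd (snd x $ i)))"
        by (simp add: vec_eq_iff s_scale l2pair_scaleC scaleC_prod_def scaleC_vec_def)
      then show ?thesis
        using J(1) by (simp add: j1_def s_scale l2pair_scaleC clinear_on_def scaleC_prod_def)
    qed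
    moreover have "norm (j1 x) = norm x" for x
      by (rule power2_eq_imp_eq)
        (auto simp: norm_prod_sq norm_vec_sq j1_def norm_l2pair norm_l2single J(2))
    ultimately show ?thesis
      by (auto simp: isometry_on_def clinear_on_def)
  qed
  have iso2: "isometry_on UNIV j2"
  proof -
    have "j2 (x + y) = j2 x + j2 y" for x y
      using l2single_add[of "(fst x, fst (snd x))" "(fst y, fst (snd y))"]
      by (auto simp: j2_def vec_eq_iff l2pair_add)
    moreover have "j2 (c *\<^sub>C x) = c *\<^sub>C j2 x" for c x
      using l2single_scaleC[of c "(fst x, fst (snd x))"]
      by (auto simp: j2_def vec_eq_iff scaleC_prod_def scaleC_vec_def l2pair_scaleC)
    moreover have "norm (j2 x) = norm x" for x
      by (rule power2_eq_imp_eq)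
        (auto simp: norm_prod_sq norm_vec_sq j2_def norm_l2pair norm_l2single
          if_distrib[of norm] if_distrib[of "\<lambda>x. x\<^sup>2"] sum.delta' cong: if_cong)
    ultimately show ?thesis
      by (auto simp: isometry_on_def clinear_on_def)
  qed
  have "\<exists>U. unitary_op (V \<times> vec_space ?R) (V' \<times> ?R) U \<and> (\<forall>k. U (g k) = h k)"
  proof (rule unitary_extension[OF _ _ g h n_gh, where V = j1 and W = j2])
    show "closed_csubspace (V \<times> vec_space ?R)" "closed_csubspace (V' \<times> ?R)"
      by (intro csubspace_Times csubspace_vec_space V V' R)+
    show "isometry_on (V \<times> vec_space ?R) j1" "isometry_on (V' \<times> ?R) j2"
      using iso1 iso2 isometry_on_mono by blast+
    show "j1 ` (V \<times> vec_space ?R) \<subseteq> V' \<times> ?R" "j2 ` (V' \<times> ?R) \<subseteq> V \<times> vec_space ?R"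
      using csubspace_zero[OF V] csubspace_zero[OF V'] csubspace_zero[OF R0]
      by (auto simp: j1_def j2_def vec_space_def)
    show "cinner (j1 a) (h k) = 0" for a k
      by (simp add: j1_def h_def cinner_prod_def)
    show "cinner (j2 b) (g k) = 0" for b k
      by (simp add: j2_def g_def cinner_prod_def cinner_vec_def)
  qed
  then show ?thesis
    unfolding g_def h_def .
qed

section \<open>Multi-indices\<close>

text \<open>Keeps the weight \<open>1\<close> in \<open>rho 1\<close> from being rewritten to
  \<open>Suc 0\<close>, so that the identities for this weight go on matching.\<close>

declare One_nat_def [simp del]

definition deg :: "('n::finite \<Rightarrow> nat) \<Rightarrow> nat" where
  "deg \<alpha> = sum \<alpha> UNIV"

definition unit_index :: "'n \<Rightarrow> 'n \<Rightarrow> nat" where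
  "unit_index i = (\<lambda>j. if j = i then 1 else 0)"

lemma unit_index_apply [simp]: "unit_index i j = (if j = i then 1 else 0)"
  by (simp add: unit_index_def)

lemma deg_add [simp]: "deg (\<alpha> + \<beta>) = deg \<alpha> + deg \<beta>"
  by (simp add: deg_def sum.distrib)

lemma deg_unit_index [simp]: "deg (unit_index i) = 1"
  by (simp add: deg_def)

lemma deg_eq_0_iff [simp]: "deg \<alpha> = 0 \<longleftrightarrow> \<alpha> = 0"
  by (auto simp: deg_def fun_eq_iff)

lemma finite_index_le: "finite {\<alpha> :: 'n::finite \<Rightarrow> nat. \<forall>i. \<alpha> i \<le> N}"
proof -
  have "{\<alpha> :: 'n \<Rightarrow> nat. \<forall>i. \<alpha> i \<le> N} = PiE UNIV (\<lambda>_. {..N})"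
    by (auto simp: PiE_def Pi_def extensional_def)
  then show ?thesis
    by (simp add: finite_PiE)
qed

lemma index_le_deg: "\<alpha> i \<le> deg \<alpha>" for \<alpha> :: "'n::finite \<Rightarrow> nat"
  by (simp add: deg_def member_le_sum)

lemma finite_deg_le [simp]: "finite {\<alpha> :: 'n::finite \<Rightarrow> nat. deg \<alpha> \<le> N}"
  by (rule finite_subset[OF _ finite_index_le[of N]]) (use index_le_deg order_trans in blast)

lemma finite_deg_eq [simp]: "finite {\<alpha> :: 'n::finite \<Rightarrow> nat. deg \<alpha> = N}"
  by (rule finite_subset[OF _ finite_deg_le[of N]]) auto

lemma finite_atMost_index [simp]: "finite {..\<gamma>}" for \<gamma> :: "'n::finite \<Rightarrow> nat"
  by (rule finite_subset[OF _ finite_index_le[of "deg \<gamma>"]])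
    (use index_le_deg order_trans in \<open>fastforce simp: le_fun_def\<close>)

lemma index_add_diff: "\<beta> \<le> \<gamma> \<Longrightarrow> \<beta> + (\<gamma> - \<beta>) = \<gamma>" "\<beta> \<le> \<gamma> \<Longrightarrow> (\<gamma> - \<beta>) + \<beta> = \<gamma>"
  for \<beta> \<gamma> :: "'n \<Rightarrow> nat"
  by (auto simp: le_fun_def fun_eq_iff)

lemma index_add_diff' [simp]: "(\<beta> + \<gamma>) - \<beta> = \<gamma>" "(\<gamma> + \<beta>) - \<beta> = \<gamma>"
  for \<beta> \<gamma> :: "'n \<Rightarrow> nat"
  by (auto simp: fun_eq_iff)

lemma index_le_add [simp]: "\<beta> \<le> \<beta> + \<gamma>" "\<beta> \<le> \<gamma> + \<beta>" for \<beta> \<gamma> :: "'n \<Rightarrow> nat"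
  by (auto simp: le_fun_def)

lemma deg_diff: "\<beta> \<le> \<gamma> \<Longrightarrow> deg \<beta> + deg (\<gamma> - \<beta>) = deg \<gamma>"
  using deg_add[of \<beta> "\<gamma> - \<beta>"] by (simp add: index_add_diff del: deg_add)

lemma unit_index_diff_add: "0 < \<alpha> i \<Longrightarrow> (\<alpha> - unit_index i) + unit_index i = \<alpha>"
  by (auto simp: fun_eq_iff)

lemma deg_unit_index_diff: "0 < \<alpha> i \<Longrightarrow> Suc (deg (\<alpha> - unit_index i)) = deg \<alpha>"
  using deg_add[of "\<alpha> - unit_index i" "unit_index i"]
  by (simp only: unit_index_diff_add deg_unit_index)

lemma deg_unit_index_diff_eq: "0 < \<alpha> i \<Longrightarrow> deg (\<alpha> - unit_index i) = deg \<alpha> - 1"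
  using deg_unit_index_diff[of \<alpha> i] by simp

text \<open>Pairs \<open>(\<alpha>, i)\<close> with \<open>\<alpha> i > 0\<close> correspond to
  pairs \<open>(\<beta>, i)\<close> by \<open>\<beta> = \<alpha> - unit_index i\<close>. A recursion
  that raises the degree by one thereby becomes a sum over the preceding degree.\<close>

lemma sum_deg_Suc:
  fixes F :: "'n::finite \<Rightarrow> ('n \<Rightarrow> nat) \<Rightarrow> 'a::comm_monoid_add"
  shows "(\<Sum>\<alpha> | deg \<alpha> = Suc d. \<Sum>i | 0 < \<alpha> i. F i \<alpha>) =
    (\<Sum>\<beta> | deg \<beta> = d. \<Sum>i\<in>UNIV. F i (\<beta> + unit_index i))"
proof -
  have "(\<Sum>\<alpha> | deg \<alpha> = Suc d. \<Sum>i | 0 < \<alpha> i. F i \<alpha>)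
      = (\<Sum>(\<alpha>, i)\<in>(SIGMA \<alpha>:{\<alpha>. deg \<alpha> = Suc d}. {i. 0 < \<alpha> i}). F i \<alpha>)"
    by (rule sum.Sigma) auto
  also have "\<dots> = (\<Sum>(\<beta>, i)\<in>{\<beta>. deg \<beta> = d} \<times> UNIV. F i (\<beta> + unit_index i))"
    by (rule sum.reindex_bij_witness[where i = "\<lambda>(\<beta>, i). (\<beta> + unit_index i, i)"
          and j = "\<lambda>(\<alpha>, i). (\<alpha> - unit_index i, i)"])
      (auto simp: unit_index_diff_add deg_unit_index_diff_eq)
  also have "\<dots> = (\<Sum>\<beta> | deg \<beta> = d. \<Sum>i\<in>UNIV. F i (\<beta> + unit_index i))"
    by (rule sum.Sigma[symmetric]) auto
  finally show ?thesis .
qed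

lemma sum_deg_le_Suc:
  "(\<Sum>\<alpha> | deg \<alpha> \<le> Suc N. f \<alpha>) = (\<Sum>\<alpha> | deg \<alpha> \<le> N. f \<alpha>) + (\<Sum>\<alpha> | deg \<alpha> = Suc N. f \<alpha>)"
  for f :: "('n::finite \<Rightarrow> nat) \<Rightarrow> 'a::comm_monoid_add"
proof -
  have "{\<alpha> :: 'n \<Rightarrow> nat. deg \<alpha> \<le> Suc N} = {\<alpha>. deg \<alpha> \<le> N} \<union> {\<alpha>. deg \<alpha> = Suc N}"
    by auto
  then show ?thesis
    by (simp only:) (rule sum.union_disjoint, auto)
qed

lemma deg_le_0: "{\<alpha> :: 'n::finite \<Rightarrow> nat. deg \<alpha> \<le> 0} = {0}"
  and deg_eq_0: "{\<alpha> :: 'n::finite \<Rightarrow> nat. deg \<alpha> = 0} = {0}"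
  by auto

lemma sum_deg_0: "(\<Sum>\<alpha> | deg \<alpha> = 0. f \<alpha>) = f 0" "(\<Sum>\<alpha> | deg \<alpha> \<le> 0. f \<alpha>) = f 0"
  for f :: "('n::finite \<Rightarrow> nat) \<Rightarrow> 'a::comm_monoid_add"
  unfolding deg_eq_0 deg_le_0 by simp_all

lemma sum_deg_le: "(\<Sum>\<alpha> | deg \<alpha> \<le> N. f \<alpha>) = (\<Sum>d\<le>N. \<Sum>\<alpha> | deg \<alpha> = d. f \<alpha>)"
  for f :: "('n::finite \<Rightarrow> nat) \<Rightarrow> 'a::comm_monoid_add"
proof (induction N)
  case (Suc N)
  then show ?case by (simp only: sum_deg_le_Suc) simp
qed (simp only: deg_le_0 deg_eq_0 atMost_0 sum.insert_if, simp add: deg_eq_0)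

text \<open>The substitution \<open>\<beta> = \<gamma> - \<delta>\<close>. Degrees add, so the bound
  \<open>N\<close> on \<open>\<gamma>\<close> becomes \<open>N - deg \<delta>\<close> on
  \<open>\<beta>\<close>, an exact subtraction since \<open>deg \<delta> \<le> N\<close>.\<close>

lemma sum_convolution:
  fixes F :: "('n::finite \<Rightarrow> nat) \<Rightarrow> ('n \<Rightarrow> nat) \<Rightarrow> 'a::comm_monoid_add"
  shows "(\<Sum>\<gamma> | deg \<gamma> \<le> N. \<Sum>\<delta>\<le>\<gamma>. F \<delta> (\<gamma> - \<delta>))
    = (\<Sum>\<delta> | deg \<delta> \<le> N. \<Sum>\<beta> | deg \<beta> \<le> N - deg \<delta>. F \<delta> \<beta>)"
proof -
  have "(\<Sum>\<gamma> | deg \<gamma> \<le> N. \<Sum>\<delta>\<le>\<gamma>. F \<delta> (\<gamma> - \<delta>))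
      = (\<Sum>(\<gamma>, \<delta>)\<in>(SIGMA \<gamma>:{\<gamma>. deg \<gamma> \<le> N}. {..\<gamma>}). F \<delta> (\<gamma> - \<delta>))"
    by (rule sum.Sigma) auto
  also have "\<dots> = (\<Sum>(\<delta>, \<beta>)\<in>(SIGMA \<delta>:{\<delta>. deg \<delta> \<le> N}. {\<beta>. deg \<beta> \<le> N - deg \<delta>}). F \<delta> \<beta>)"
  proof (rule sum.reindex_bij_witness[where i = "\<lambda>(\<delta>, \<beta>). (\<delta> + \<beta>, \<delta>)"
        and j = "\<lambda>(\<gamma>, \<delta>). (\<delta>, \<gamma> - \<delta>)"], goal_cases)
    case (2 a)
    then obtain \<gamma> \<delta> where "a = (\<gamma>, \<delta>)" "deg \<gamma> \<le> N" "\<delta> \<le> \<gamma>" by auto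
    then show ?case
      using deg_diff[of \<delta> \<gamma>] by auto
  qed (auto simp: index_add_diff)
  also have "\<dots> = (\<Sum>\<delta> | deg \<delta> \<le> N. \<Sum>\<beta> | deg \<beta> \<le> N - deg \<delta>. F \<delta> \<beta>)"
    by (rule sum.Sigma[symmetric]) auto
  finally show ?thesis .
qed

lemma filterlim_deg_le: "filterlim (\<lambda>N. {\<alpha> :: 'n::finite \<Rightarrow> nat. deg \<alpha> \<le> N})
    (finite_subsets_at_top UNIV) sequentially"
  unfolding filterlim_finite_subsets_at_top
proof (intro allI impI)
  fix X :: "('n \<Rightarrow> nat) set" assume X: "finite X \<and> X \<subseteq> UNIV"
  show "\<forall>\<^sub>F N in sequentially. finite {\<alpha> :: 'n \<Rightarrow> nat. deg \<alpha> \<le> N} \<and>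
      X \<subseteq> {\<alpha>. deg \<alpha> \<le> N} \<and> {\<alpha> :: 'n \<Rightarrow> nat. deg \<alpha> \<le> N} \<subseteq> UNIV"
    unfolding eventually_sequentially
  proof (intro exI allI impI conjI)
    fix N assume N: "Max (insert 0 (deg ` X)) \<le> N"
    show "X \<subseteq> {\<alpha>. deg \<alpha> \<le> N}"
    proof
      fix \<alpha> assume "\<alpha> \<in> X"
      then have "deg \<alpha> \<le> Max (insert 0 (deg ` X))"
        using X by (intro Max_ge) auto
      then show "\<alpha> \<in> {\<alpha>. deg \<alpha> \<le> N}"
        using N by simp
    qed
  qed auto
qed

text \<open>Links the unconditional sums of the definitions to arguments that proceed degree by
  degree, such as telescoping.\<close>

lemma has_sum_deg_tendsto:
  assumes "(f has_sum s) UNIV"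
  shows "(\<lambda>N. \<Sum>\<alpha> | deg \<alpha> \<le> N. f \<alpha>) \<longlonglongrightarrow> s"
  using filterlim_compose[OF assms[unfolded has_sum_def] filterlim_deg_le] by simp

lemma finite_subset_deg_le:
  assumes "finite F"
  obtains N where "F \<subseteq> {\<alpha> :: 'n::finite \<Rightarrow> nat. deg \<alpha> \<le> N}"
proof
  show "F \<subseteq> {\<alpha>. deg \<alpha> \<le> Max (insert 0 (deg ` F))}"
    using assms by (auto intro!: Max_ge)
qed

lemma summable_on_deg_bounded:
  fixes f :: "('n::finite \<Rightarrow> nat) \<Rightarrow> real"
  assumes "\<And>\<alpha>. 0 \<le> f \<alpha>" "\<And>N. (\<Sum>\<alpha> | deg \<alpha> \<le> N. f \<alpha>) \<le> C"
  shows "f summable_on UNIV" "infsum f UNIV \<le> C"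
proof -
  show *: "f summable_on UNIV"
  proof (rule nonneg_bdd_above_summable_on)
    show "bdd_above (sum f ` {F. F \<subseteq> UNIV \<and> finite F})"
    proof (rule bdd_aboveI2)
      fix F :: "('n \<Rightarrow> nat) set" assume "F \<in> {F. F \<subseteq> UNIV \<and> finite F}"
      then obtain N where "F \<subseteq> {\<alpha>. deg \<alpha> \<le> N}"
        using finite_subset_deg_le by auto
      then have "sum f F \<le> (\<Sum>\<alpha> | deg \<alpha> \<le> N. f \<alpha>)"
        by (intro sum_mono2) (auto simp: assms)
      then show "sum f F \<le> C"
        using assms(2)[of N] by linarith
    qed
  qed (use assms in auto)
  show "infsum f UNIV \<le> C"
    by (rule LIMSEQ_le_const2[OF has_sum_deg_tendsto[OF has_sum_infsum[OF *]]]) (use assms in auto)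
qed

subsection \<open>The weights\<close>

lemma rho_deg: "rho m \<alpha> = fact (m + deg \<alpha> - 1) / ((\<Prod>i\<in>UNIV. fact (\<alpha> i)) * fact (m - 1))"
  by (simp add: rho_def deg_def)

lemma rho_pos [simp]: "0 < rho m \<alpha>"
  by (auto simp: rho_def intro!: divide_pos_pos mult_pos_pos prod_pos)

lemma rho_nonneg [simp]: "0 \<le> rho m \<alpha>"
  using rho_pos less_imp_le by blast

lemma rho_neq_0 [simp]: "rho m \<alpha> \<noteq> 0"
  using rho_pos[of m \<alpha>] by linarith

lemma rho_0 [simp]: "rho m 0 = 1"
  by (simp add: rho_def)

lemma prod_fact_add_unit_index:
  "(\<Prod>j\<in>UNIV. fact ((\<beta> + unit_index i) j)) = (\<Prod>j\<in>UNIV. fact (\<beta> j) :: real) * real (Suc (\<beta> i))"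
  for \<beta> :: "'n::finite \<Rightarrow> nat"
proof -
  have "(\<Prod>j\<in>UNIV. fact ((\<beta> + unit_index i) j))
      = (\<Prod>j\<in>UNIV. fact (\<beta> j) * (if j = i then real (Suc (\<beta> i)) else 1))"
    by (rule prod.cong) (auto simp: One_nat_def algebra_simps)
  then show ?thesis
    by (simp add: prod.distrib)
qed

lemma rho_add_unit_index:
  assumes "1 \<le> m"
  shows "rho m (\<beta> + unit_index i) * real (Suc (\<beta> i)) = rho m \<beta> * real (m + deg \<beta>)"
proof -
  obtain k where k: "m = Suc k"
    using assms by (cases m) auto
  show ?thesis
    unfolding rho_deg prod_fact_add_unit_index deg_add deg_unit_index k
    by (simp add: One_nat_def field_simps del: of_nat_Suc)
qed

lemma rho_diff_unit_index:
  assumes "1 \<le> m" "0 < \<alpha> i"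
  shows "rho m (\<alpha> - unit_index i) * real (m + deg \<alpha> - 1) = rho m \<alpha> * real (\<alpha> i)"
  using rho_add_unit_index[OF assms(1), of "\<alpha> - unit_index i" i] deg_unit_index_diff[of \<alpha> i] assms
  unfolding unit_index_diff_add[of \<alpha> i, OF assms(2)] by simp

lemma sum_rho_diff_unit_index:
  assumes "1 \<le> m"
  shows "(\<Sum>i | 0 < \<alpha> i. rho m (\<alpha> - unit_index i)) * real (m + deg \<alpha> - 1) = rho m \<alpha> * real (deg \<alpha>)"
proof -
  have "(\<Sum>i | 0 < \<alpha> i. rho m (\<alpha> - unit_index i)) * real (m + deg \<alpha> - 1)
      = (\<Sum>i | 0 < \<alpha> i. rho m \<alpha> * real (\<alpha> i))"
    unfolding sum_distrib_right by (rule sum.cong) (auto simp only: rho_diff_unit_index[OF assms])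
  also have "\<dots> = (\<Sum>i\<in>UNIV. rho m \<alpha> * real (\<alpha> i))"
    by (rule sum.mono_neutral_left) auto
  finally show ?thesis
    by (simp add: deg_def sum_distrib_left)
qed

text \<open>\<open>rho 1 \<alpha>\<close> is the multinomial coefficient counting words with
  \<open>\<alpha> i\<close> letters \<open>i\<close>; the sum sorts the words by their last
  letter.\<close>

lemma rho_1_pascal:
  assumes "\<alpha> \<noteq> 0"
  shows "rho 1 \<alpha> = (\<Sum>i | 0 < \<alpha> i. rho 1 (\<alpha> - unit_index i))"
  using sum_rho_diff_unit_index[of 1 \<alpha>] assms deg_eq_0_iff[of \<alpha>] by simp

lemma rho_Suc_rho: "1 \<le> m \<Longrightarrow> rho (Suc m) \<alpha> * real m = rho m \<alpha> * real (m + deg \<alpha>)"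
  by (cases m) (auto simp: rho_deg field_simps simp del: of_nat_Suc)

text \<open>The weights \<open>rho m\<close> are the Taylor coefficients of
  \<open>(1 - x)^(-m)\<close> with \<open>x = z_1 + ... + z_n\<close>; this compares coefficients in
  \<open>(1 - x)^(-m-1) = (1 - x)^(-m) + x (1 - x)^(-m-1)\<close>.\<close>

lemma rho_pascal:
  assumes m: "1 \<le> m"
  shows "rho (Suc m) \<alpha> = rho m \<alpha> + (\<Sum>i | 0 < \<alpha> i. rho (Suc m) (\<alpha> - unit_index i))"
proof -
  let ?s = "\<Sum>i | 0 < \<alpha> i. rho (Suc m) (\<alpha> - unit_index i)"
  have "(rho m \<alpha> + ?s) * real (m + deg \<alpha>) = rho (Suc m) \<alpha> * real m + rho (Suc m) \<alpha> * real (deg \<alpha>)"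
    using sum_rho_diff_unit_index[of "Suc m" \<alpha>] rho_Suc_rho[OF m, of \<alpha>] by (simp add: distrib_right)
  also have "\<dots> = rho (Suc m) \<alpha> * real (m + deg \<alpha>)"
    by (simp add: distrib_left)
  finally show ?thesis
    using m by (simp del: of_nat_add)
qed

text \<open>The product \<open>(1 - x)^(-p) (1 - x)^(-1) = (1 - x)^(-p-1)\<close> on coefficients.
  Pascal's rule on the factor \<open>rho 1\<close> lowers the degree of \<open>\<gamma>\<close>, and
  Pascal's rule for \<open>rho (Suc p)\<close> reassembles the result.\<close>

lemma rho_convolution:
  assumes p: "1 \<le> p"
  shows "(\<Sum>\<beta>\<le>\<gamma>. rho p \<beta> * rho 1 (\<gamma> - \<beta>)) = rho (Suc p) \<gamma>"
proof (induction "deg \<gamma>" arbitrary: \<gamma> rule: less_induct)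
  case less
  \<comment> \<open>Pascal's rule for \<open>rho 1\<close> fails at the index \<open>0\<close>, so
    the term \<open>\<beta> = \<gamma>\<close> is split off. It supplies the summand
    \<open>rho p \<gamma>\<close> of \<open>rho_pascal\<close>.\<close>
  have "(\<Sum>\<beta>\<le>\<gamma>. rho p \<beta> * rho 1 (\<gamma> - \<beta>))
      = (\<Sum>\<beta>\<le>\<gamma>. (if \<beta> = \<gamma> then rho p \<gamma> else 0)
        + (\<Sum>i | i \<in> UNIV \<and> \<beta> i < \<gamma> i. rho p \<beta> * rho 1 ((\<gamma> - unit_index i) - \<beta>)))"
  proof (rule sum.cong[OF refl])
    fix \<beta> assume "\<beta> \<in> {..\<gamma>}"
    show "rho p \<beta> * rho 1 (\<gamma> - \<beta>) = (if \<beta> = \<gamma> then rho p \<gamma> else 0)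
        + (\<Sum>i | i \<in> UNIV \<and> \<beta> i < \<gamma> i. rho p \<beta> * rho 1 ((\<gamma> - unit_index i) - \<beta>))"
    proof (cases "\<beta> = \<gamma>")
      case True
      have "\<gamma> - \<gamma> = 0" by (simp add: fun_eq_iff)
      then show ?thesis using True by simp
    next
      case False
      then have "\<gamma> - \<beta> \<noteq> 0"
        using \<open>\<beta> \<in> {..\<gamma>}\<close> by (auto simp: fun_eq_iff le_fun_def) (meson order_antisym)
      moreover have "(\<gamma> - \<beta>) - unit_index i = (\<gamma> - unit_index i) - \<beta>" for i
        by (auto simp: fun_eq_iff)
      ultimately show ?thesis
        using False rho_1_pascal[of "\<gamma> - \<beta>"] by (simp add: sum_distrib_left)
    qed
  qed
  also have "\<dots> = rho p \<gamma>
      + (\<Sum>\<beta>\<le>\<gamma>. \<Sum>i | i \<in> UNIV \<and> \<beta> i < \<gamma> i. rho p \<beta> * rho 1 ((\<gamma> - unit_index i) - \<beta>))"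
    by (simp add: sum.distrib)
  also have "(\<Sum>\<beta>\<le>\<gamma>. \<Sum>i | i \<in> UNIV \<and> \<beta> i < \<gamma> i. rho p \<beta> * rho 1 ((\<gamma> - unit_index i) - \<beta>))
      = (\<Sum>i\<in>UNIV. \<Sum>\<beta> | \<beta> \<in> {..\<gamma>} \<and> \<beta> i < \<gamma> i. rho p \<beta> * rho 1 ((\<gamma> - unit_index i) - \<beta>))"
    by (rule sum.swap_restrict) auto
  also have "\<dots> = (\<Sum>i | 0 < \<gamma> i. \<Sum>\<beta> | \<beta> \<in> {..\<gamma>} \<and> \<beta> i < \<gamma> i. rho p \<beta> * rho 1 ((\<gamma> - unit_index i)
      - \<beta>))"
  proof (rule sum.mono_neutral_right)
    have "{\<beta>. \<beta> \<in> {..\<gamma>} \<and> \<beta> i < \<gamma> i} = {}" if "\<gamma> i = 0" for i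
      using that by auto
    then show "\<forall>i\<in>UNIV - {i. 0 < \<gamma> i}.
        (\<Sum>\<beta> | \<beta> \<in> {..\<gamma>} \<and> \<beta> i < \<gamma> i. rho p \<beta> * rho 1 ((\<gamma> - unit_index i) - \<beta>)) = 0"
      by simp
  qed auto
  also have "\<dots> = (\<Sum>i | 0 < \<gamma> i. rho (Suc p) (\<gamma> - unit_index i))"
  proof (rule sum.cong[OF refl])
    fix i assume i: "i \<in> {i. 0 < \<gamma> i}"
    have "{\<beta>. \<beta> \<in> {..\<gamma>} \<and> \<beta> i < \<gamma> i} = {..\<gamma> - unit_index i}"
    proof (intro equalityI subsetI)
      fix \<beta> assume "\<beta> \<in> {\<beta>. \<beta> \<in> {..\<gamma>} \<and> \<beta> i < \<gamma> i}"
      then show "\<beta> \<in> {..\<gamma> - unit_index i}" by (auto simp: le_fun_def)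
    next
      fix \<beta> assume "\<beta> \<in> {..\<gamma> - unit_index i}"
      then have le: "\<beta> j \<le> \<gamma> j - (if j = i then 1 else 0)" for j
        by (auto simp: le_fun_def)
      have "\<beta> j \<le> \<gamma> j" for j
        using le[of j] by simp
      moreover have "\<beta> i < \<gamma> i"
        using le[of i] i by auto
      ultimately show "\<beta> \<in> {\<beta>. \<beta> \<in> {..\<gamma>} \<and> \<beta> i < \<gamma> i}"
        by (auto simp: le_fun_def)
    qed
    moreover have "deg (\<gamma> - unit_index i) < deg \<gamma>"
      using deg_unit_index_diff[of \<gamma> i] i by simp
    ultimately show "(\<Sum>\<beta> | \<beta> \<in> {..\<gamma>} \<and> \<beta> i < \<gamma> i. rho p \<beta> * rho 1 ((\<gamma> - unit_index i) - \<beta>))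
        = rho (Suc p) (\<gamma> - unit_index i)"
      using less by presburger
  qed
  also have "rho p \<gamma> + (\<Sum>i | 0 < \<gamma> i. rho (Suc p) (\<gamma> - unit_index i)) = rho (Suc p) \<gamma>"
    by (rule rho_pascal[OF p, symmetric])
  finally show ?case .
qed

lemma rho_convolution':
  assumes p: "1 \<le> p"
  shows "(\<Sum>\<beta>\<le>\<gamma>. rho 1 \<beta> * rho p (\<gamma> - \<beta>)) = rho (Suc p) \<gamma>"
proof -
  have diff: "\<gamma> - (\<gamma> - \<beta>) = \<beta>" if "\<beta> \<le> \<gamma>" for \<beta>
    using that by (auto simp: fun_eq_iff le_fun_def)
  have "(\<Sum>\<beta>\<le>\<gamma>. rho 1 \<beta> * rho p (\<gamma> - \<beta>)) = (\<Sum>\<beta>\<le>\<gamma>. rho p \<beta> * rho 1 (\<gamma> - \<beta>))"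
    by (rule sum.reindex_bij_witness[where i = "\<lambda>\<beta>. \<gamma> - \<beta>" and j = "\<lambda>\<beta>. \<gamma> - \<beta>"])
      (auto simp: diff mult.commute, auto simp: le_fun_def)
  then show ?thesis
    using rho_convolution[OF p] by simp
qed

text \<open>Both orders of nesting are recorded: with weight 1 inside, an estimate at weight 1
  applies to each shifted family; with weight 1 outside, an induction hypothesis at weight
  \<open>p\<close> does.\<close>

lemma sum_rho_Suc:
  fixes q :: "('n::finite \<Rightarrow> nat) \<Rightarrow> real"
  assumes p: "1 \<le> p"
  shows "(\<Sum>\<gamma> | deg \<gamma> \<le> N. rho (Suc p) \<gamma> * q \<gamma>)
    = (\<Sum>\<delta> | deg \<delta> \<le> N. rho p \<delta> * (\<Sum>\<beta> | deg \<beta> \<le> N - deg \<delta>. rho 1 \<beta> * q (\<delta> + \<beta>)))"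
    (is "?l = ?r")
    and "(\<Sum>\<gamma> | deg \<gamma> \<le> N. rho (Suc p) \<gamma> * q \<gamma>)
    = (\<Sum>\<delta> | deg \<delta> \<le> N. rho 1 \<delta> * (\<Sum>\<beta> | deg \<beta> \<le> N - deg \<delta>. rho p \<beta> * q (\<delta> + \<beta>)))"
    (is "_ = ?r'")
proof -
  have "?l = (\<Sum>\<gamma> | deg \<gamma> \<le> N. \<Sum>\<delta>\<le>\<gamma>. rho p \<delta> * rho 1 (\<gamma> - \<delta>) * q (\<delta> + (\<gamma> - \<delta>)))"
    by (intro sum.cong refl)
      (simp add: index_add_diff rho_convolution[OF p, symmetric] sum_distrib_right)
  also have "\<dots> = ?r"
    by (subst sum_convolution) (simp add: sum_distrib_left mult.assoc)
  finally show "?l = ?r" .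
  have "?l = (\<Sum>\<gamma> | deg \<gamma> \<le> N. \<Sum>\<delta>\<le>\<gamma>. rho 1 \<delta> * rho p (\<gamma> - \<delta>) * q (\<delta> + (\<gamma> - \<delta>)))"
    by (intro sum.cong refl)
      (simp add: index_add_diff rho_convolution'[OF p, symmetric] sum_distrib_right)
  also have "\<dots> = ?r'"
    by (subst sum_convolution) (simp add: sum_distrib_left mult.assoc)
  finally show "?l = ?r'" .
qed

lemma sum_rho_1_Suc:
  fixes q :: "('n::finite \<Rightarrow> nat) \<Rightarrow> real"
  shows "(\<Sum>\<alpha> | deg \<alpha> = Suc d. rho 1 \<alpha> * q \<alpha>)
    = (\<Sum>\<beta> | deg \<beta> = d. rho 1 \<beta> * (\<Sum>i\<in>UNIV. q (\<beta> + unit_index i)))"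
proof -
  have "(\<Sum>\<alpha> | deg \<alpha> = Suc d. rho 1 \<alpha> * q \<alpha>)
      = (\<Sum>\<alpha> | deg \<alpha> = Suc d. \<Sum>i | 0 < \<alpha> i. rho 1 (\<alpha> - unit_index i) * q \<alpha>)"
  proof (rule sum.cong[OF refl])
    fix \<alpha> :: "'n \<Rightarrow> nat" assume "\<alpha> \<in> {\<alpha>. deg \<alpha> = Suc d}"
    then have "\<alpha> \<noteq> 0"
      using deg_eq_0_iff[of \<alpha>] by (simp del: deg_eq_0_iff)
    then show "rho 1 \<alpha> * q \<alpha> = (\<Sum>i | 0 < \<alpha> i. rho 1 (\<alpha> - unit_index i) * q \<alpha>)"
      by (subst rho_1_pascal) (auto simp: sum_distrib_right)
  qed
  also have "\<dots> = (\<Sum>\<beta> | deg \<beta> = d. \<Sum>i\<in>UNIV. rho 1 (\<beta> + unit_index i - unit_index i)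
      * q (\<beta> + unit_index i))"
    by (rule sum_deg_Suc)
  finally show ?thesis
    by (simp add: sum_distrib_left)
qed

subsection \<open>Monomials\<close>

lemma zpow_add: "zpow z (\<alpha> + \<beta>) = zpow z \<alpha> * zpow z \<beta>"
  by (simp add: zpow_def power_add prod.distrib)

lemma zpow_0 [simp]: "zpow z 0 = 1"
  by (simp add: zpow_def)

lemma zpow_unit_index [simp]: "zpow z (unit_index i) = z $ i"
proof -
  have "zpow z (unit_index i) = (\<Prod>j\<in>UNIV. if j = i then z $ i else 1)"
    unfolding zpow_def by (rule prod.cong) auto
  then show ?thesis by simp
qed

text \<open>The multinomial theorem for the \<open>d\<close>-th power of the sum of the
  \<open>(cmod (z $ i))\<^sup>2\<close>.\<close>

lemma sum_rho_1_zpow: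
  "(\<Sum>\<alpha> | deg \<alpha> = d. rho 1 \<alpha> * (cmod (zpow z \<alpha>))\<^sup>2) = (norm z) ^ (2 * d)"
proof (induction d)
  case (Suc d)
  have "(\<Sum>\<alpha> | deg \<alpha> = Suc d. rho 1 \<alpha> * (cmod (zpow z \<alpha>))\<^sup>2)
      = (\<Sum>\<beta> | deg \<beta> = d. rho 1 \<beta> * (cmod (zpow z \<beta>))\<^sup>2 * (\<Sum>i\<in>UNIV. (cmod (z $ i))\<^sup>2))"
    by (simp add: sum_rho_1_Suc zpow_add norm_mult power_mult_distrib sum_distrib_left mult.assoc)
  also have "\<dots> = (norm z) ^ (2 * d) * (norm z)\<^sup>2"
    by (simp add: Suc norm_vec_sq flip: sum_distrib_right)
  finally show ?case
    by (simp add: power2_eq_square mult_ac)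
next
  case 0
  show ?case unfolding deg_eq_0 using rho_0[of 1] zpow_0[of z] by (simp add: zero_fun_def)
qed

text \<open>These are partial sums of the reproducing kernel on the diagonal. For
  \<open>m = 1\<close> they are geometric sums; each further weight contributes one more factor
  through the convolution.\<close>

lemma sum_rho_zpow_bounded:
  assumes z: "norm z < 1" and m: "1 \<le> m"
  shows "(\<Sum>\<alpha> | deg \<alpha> \<le> N. rho m \<alpha> * (cmod (zpow z \<alpha>))\<^sup>2) \<le> (1 / (1 - (norm z)\<^sup>2)) ^ m"
  using m
proof (induction m arbitrary: N rule: nat_induct_at_least)
  case base
  have z2: "(norm z)\<^sup>2 < 1"
    using z by (simp add: power_less_one_iff abs_square_less_1)
  have "(\<Sum>\<alpha> | deg \<alpha> \<le> N. rho 1 \<alpha> * (cmod (zpow z \<alpha>))\<^sup>2) = (\<Sum>d\<le>N. ((norm z)\<^sup>2) ^ d)"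
    by (simp only: sum_deg_le sum_rho_1_zpow power_mult)
  also have "\<dots> \<le> 1 / (1 - (norm z)\<^sup>2)"
    using sum_le_suminf[OF summable_geometric[of "(norm z)\<^sup>2"], of "{..N}"] z2
    by (simp add: suminf_geometric)
  finally show ?case by simp
next
  case (Suc p)
  have z2: "(norm z)\<^sup>2 < 1"
    using z by (simp add: power_less_one_iff abs_square_less_1)
  let ?q = "\<lambda>\<alpha>. (cmod (zpow z \<alpha>))\<^sup>2" and ?c = "1 / (1 - (norm z)\<^sup>2)"
  have 1: "(\<Sum>\<beta> | deg \<beta> \<le> N. rho 1 \<beta> * ?q \<beta>) \<le> ?c" for N
  proof -
    have "(\<Sum>\<alpha> | deg \<alpha> \<le> N. rho 1 \<alpha> * ?q \<alpha>) = (\<Sum>d\<le>N. ((norm z)\<^sup>2) ^ d)"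
      by (simp only: sum_deg_le sum_rho_1_zpow power_mult)
    also have "\<dots> \<le> 1 / (1 - (norm z)\<^sup>2)"
      using sum_le_suminf[OF summable_geometric[of "(norm z)\<^sup>2"], of "{..N}"] z2
      by (simp add: suminf_geometric)
    finally show ?thesis .
  qed
  have "(\<Sum>\<gamma> | deg \<gamma> \<le> N. rho (Suc p) \<gamma> * ?q \<gamma>)
      = (\<Sum>\<delta> | deg \<delta> \<le> N. rho p \<delta> * ?q \<delta> * (\<Sum>\<beta> | deg \<beta> \<le> N - deg \<delta>. rho 1 \<beta> * ?q \<beta>))"
    by (simp add: sum_rho_Suc(1)[OF Suc(1)] zpow_add norm_mult power_mult_distrib sum_distrib_left
        mult_ac)
  also have "\<dots> \<le> (\<Sum>\<delta> | deg \<delta> \<le> N. rho p \<delta> * ?q \<delta> * ?c)"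
    by (intro sum_mono mult_left_mono 1) auto
  also have "\<dots> \<le> ?c ^ p * ?c"
    unfolding sum_distrib_right[symmetric] using z2 by (intro mult_right_mono Suc) auto
  finally show ?case by (simp add: mult.commute)
qed

lemma summable_rho_zpow:
  assumes "z \<in> ball 0 1" "1 \<le> m"
  shows "(\<lambda>\<alpha>. rho m \<alpha> * (cmod (zpow z \<alpha>))\<^sup>2) summable_on UNIV"
  using assms by (intro summable_on_deg_bounded(1)[OF _ sum_rho_zpow_bounded]) auto

section \<open>Uniqueness of power series coefficients\<close>

text \<open>Fixing all variables but \<open>z i\<close> leaves a polynomial in one variable that
  vanishes identically. Its coefficient at \<open>\<alpha> i\<close> is a relation among the
  monomials with this exponent of \<open>z i\<close>, and these are still told apart by the
  remaining variables.\<close>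

lemma monomials_independent:
  fixes a :: "('n \<Rightarrow> nat) \<Rightarrow> complex"
  assumes "finite I" "finite A"
    and "\<And>\<alpha> \<beta>. \<alpha> \<in> A \<Longrightarrow> \<beta> \<in> A \<Longrightarrow> (\<forall>j\<in>I. \<alpha> j = \<beta> j) \<Longrightarrow> \<alpha> = \<beta>"
    and "\<And>z :: 'n \<Rightarrow> complex. (\<Sum>\<alpha>\<in>A. a \<alpha> * (\<Prod>j\<in>I. z j ^ \<alpha> j)) = 0"
    and "\<alpha> \<in> A"
  shows "a \<alpha> = 0"
  using assms
proof (induction I arbitrary: A \<alpha> rule: finite_induct)
  case empty
  then have "A = {\<alpha>}"
    by auto
  then show ?case
    using empty(3) by simp
next
  case (insert i I)
  define A' where "A' = {\<beta> \<in> A. \<beta> i = \<alpha> i}"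
  show ?case
  proof (rule insert.IH[of A'])
    show "finite A'" "\<alpha> \<in> A'"
      using insert by (auto simp: A'_def)
    show "\<And>\<beta> \<gamma>. \<beta> \<in> A' \<Longrightarrow> \<gamma> \<in> A' \<Longrightarrow> \<forall>j\<in>I. \<beta> j = \<gamma> j \<Longrightarrow> \<beta> = \<gamma>"
      using insert.prems(2) by (auto simp: A'_def)
    fix z :: "'n \<Rightarrow> complex"
    define p where "p = (\<Sum>\<beta>\<in>A. monom (a \<beta> * (\<Prod>j\<in>I. z j ^ \<beta> j)) (\<beta> i))"
    have "poly p w = 0" for w
    proof -
      have "poly p w = (\<Sum>\<beta>\<in>A. a \<beta> * (\<Prod>j\<in>insert i I. (z(i := w)) j ^ \<beta> j))"
        unfolding p_def poly_sum
      proof (rule sum.cong[OF refl])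
        fix \<beta>
        have "(\<Prod>j\<in>I. (z(i := w)) j ^ \<beta> j) = (\<Prod>j\<in>I. z j ^ \<beta> j)"
          using insert.hyps(2) by (intro prod.cong) auto
        then show "poly (monom (a \<beta> * (\<Prod>j\<in>I. z j ^ \<beta> j)) (\<beta> i)) w
            = a \<beta> * (\<Prod>j\<in>insert i I. (z(i := w)) j ^ \<beta> j)"
          using insert.hyps by (simp add: poly_monom mult_ac del: fun_upd_apply) simp
      qed
      then show ?thesis
        using insert.prems(3) by simp
    qed
    then have "p = 0"
      using poly_all_0_iff_0 by blast
    then have "0 = coeff p (\<alpha> i)"
      by simp
    also have "\<dots> = (\<Sum>\<beta>\<in>A. if \<beta> i = \<alpha> i then a \<beta> * (\<Prod>j\<in>I. z j ^ \<beta> j) else 0)"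
      by (simp add: p_def coeff_sum)
    also have "\<dots> = (\<Sum>\<beta>\<in>A'. a \<beta> * (\<Prod>j\<in>I. z j ^ \<beta> j))"
      using insert.prems(1) by (simp add: A'_def sum.inter_filter)
    finally show "(\<Sum>\<beta>\<in>A'. a \<beta> * (\<Prod>j\<in>I. z j ^ \<beta> j)) = 0" by simp
  qed
qed

text \<open>Once the lower coefficients vanish, the series can be divided by \<open>t^k\<close> for
  \<open>t \<noteq> 0\<close>. The quotient sums to \<open>0\<close> there and tends to
  \<open>c k\<close> at the origin.\<close>

lemma powser_zero_imp_coeff_zero:
  fixes c :: "nat \<Rightarrow> complex"
  assumes r: "0 < r" and s: "\<And>t. norm t < r \<Longrightarrow> (\<lambda>d. c d * t ^ d) sums 0"
  shows "c k = 0"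
proof (induction k rule: less_induct)
  case (less k)
  have "(\<lambda>n. c (n + k) * t ^ n) sums 0" if t: "t \<noteq> 0" "norm t < r" for t
  proof -
    have "(\<lambda>n. c (n + k) * t ^ (n + k)) sums (0 - (\<Sum>i<k. c i * t ^ i))"
      by (rule sums_split_initial_segment[OF s[OF t(2)]])
    then have "(\<lambda>n. (1 / t ^ k) * (c (n + k) * t ^ (n + k))) sums ((1 / t ^ k) * 0)"
      using less by (intro sums_mult) simp
    then show ?thesis
      using t(1) by (simp add: power_add)
  qed
  then have "((\<lambda>t. 0) \<longlongrightarrow> c (0 + k)) (at (0 :: complex))"
    by (rule powser_limit_0_strong[OF r])
  then show ?case
    using LIM_unique[OF tendsto_const[of 0 "at 0"], of "c (0 + k)"] by simp
qed

lemma zpow_scaleC: "zpow (t *\<^sub>C z) \<alpha> = t ^ deg \<alpha> * zpow z \<alpha>"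
  by (simp add: zpow_def scaleC_vec_def power_mult_distrib prod.distrib deg_def power_sum)

text \<open>On the complex line through \<open>z\<close> the series becomes a power series in
  \<open>t\<close> whose coefficients are the homogeneous parts at \<open>z\<close>. These vanish on
  the ball, by homogeneity everywhere, and independence of monomials finishes.\<close>

lemma scalar_power_series_zero:
  fixes a :: "('n::finite \<Rightarrow> nat) \<Rightarrow> complex"
  assumes s: "\<And>z. z \<in> ball 0 1 \<Longrightarrow> ((\<lambda>\<alpha>. zpow z \<alpha> * a \<alpha>) has_sum 0) UNIV"
  shows "a \<alpha> = 0"
proof -
  define P where "P d z = (\<Sum>\<alpha> | deg \<alpha> = d. a \<alpha> * zpow z \<alpha>)" for d and z :: "complex ^ 'n"
  have P_scale: "P d (t *\<^sub>C z) = t ^ d * P d z" for d t z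
    unfolding P_def sum_distrib_left by (rule sum.cong) (auto simp: zpow_scaleC)
  have P_ball: "P d z = 0" if z: "z \<in> ball 0 1" for d z
  proof (rule powser_zero_imp_coeff_zero[of 1 "\<lambda>d. P d z"])
    fix t :: complex assume t: "norm t < 1"
    have "norm (t *\<^sub>C z) \<le> norm z"
      using t by (intro norm_scaleC_le) simp
    then have "((\<lambda>\<alpha>. zpow (t *\<^sub>C z) \<alpha> * a \<alpha>) has_sum 0) UNIV"
      using z by (intro s) auto
    from has_sum_deg_tendsto[OF this]
    have "(\<lambda>N. \<Sum>d\<le>N. P d (t *\<^sub>C z)) \<longlonglongrightarrow> 0"
      by (simp add: sum_deg_le P_def mult.commute)
    then show "(\<lambda>d. P d z * t ^ d) sums 0"
      by (simp add: sums_def_le P_scale mult.commute)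
  qed simp
  have P_all: "P d z = 0" for d z
  proof -
    \<comment> \<open>Division by \<open>c\<close> moves \<open>z\<close> into the ball; the summand
      \<open>1\<close> keeps \<open>c\<close> nonzero at the origin.\<close>
    define c where "c = complex_of_real (2 * (1 + norm z))"
    have c: "c \<noteq> 0" "cmod c = 2 * (1 + norm z)"
      unfolding c_def by (auto simp: norm_mult simp flip: of_real_add of_real_mult)
        (smt (verit) norm_ge_zero)+
    have "norm ((1/c) *\<^sub>C z) < 1"
      unfolding norm_scaleC norm_divide c(2)
      using norm_ge_zero[of z] by (simp add: divide_less_eq del: norm_ge_zero)
    then have "P d ((1/c) *\<^sub>C z) = 0"
      by (intro P_ball) simp
    then show ?thesis
      using c(1) by (simp add: P_scale)
  qed
  show ?thesis
  proof (rule monomials_independent[of UNIV "{\<beta>. deg \<beta> = deg \<alpha>}"])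
    fix z :: "'n \<Rightarrow> complex"
    show "(\<Sum>\<beta> | deg \<beta> = deg \<alpha>. a \<beta> * (\<Prod>j\<in>UNIV. z j ^ \<beta> j)) = 0"
      using P_all[of "deg \<alpha>" "\<chi> j. z j"] by (simp add: P_def zpow_def)
  qed auto
qed

text \<open>Pairing with a fixed vector reduces the claim to scalar series. It gives the definite
  description in \<open>coeffs\<close> its meaning.\<close>

lemma has_power_series_unique:
  fixes f :: "complex ^ 'n::finite \<Rightarrow> 'a::complex_hilbert"
  assumes "has_power_series f a" "has_power_series f b"
  shows "a = b"
proof
  fix \<alpha>
  have "cinner (a \<alpha> - b \<alpha>) v = 0" for v
  proof (rule scalar_power_series_zero[of "\<lambda>\<alpha>. cinner (a \<alpha> - b \<alpha>) v"])
    fix z :: "complex ^ 'n" assume z: "z \<in> ball 0 1"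
    have "((\<lambda>\<alpha>. zpow z \<alpha> *\<^sub>C a \<alpha> + - (zpow z \<alpha> *\<^sub>C b \<alpha>)) has_sum (f z + - f z)) UNIV"
      by (intro has_sum_add has_sum_uminus[THEN iffD2])
          (use assms z in \<open>auto simp: has_power_series_def\<close>)
    from has_sum_bounded_linear[OF bounded_linear_cinner_left[of v] this]
    show "((\<lambda>\<alpha>. zpow z \<alpha> * cinner (a \<alpha> - b \<alpha>) v) has_sum 0) UNIV"
      by (simp add: cinner_diff_left cinner_scaleC_left algebra_simps)
  qed
  then have "cinner (a \<alpha> - b \<alpha>) (a \<alpha> - b \<alpha>) = 0" .
  then show "a \<alpha> = b \<alpha>" by simp
qed

lemma coeffs_eq: "has_power_series f a \<Longrightarrow> coeffs f = a"
  unfolding coeffs_def by (rule the_equality) (auto dest: has_power_series_unique)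

section \<open>Weighted coefficient spaces\<close>

definition wsummable :: "nat \<Rightarrow> (('n::finite \<Rightarrow> nat) \<Rightarrow> 'a::complex_hilbert) \<Rightarrow> bool" where
  "wsummable m a \<longleftrightarrow> (\<lambda>\<alpha>. (norm (a \<alpha>))\<^sup>2 / rho m \<alpha>) summable_on UNIV"

definition index_enum :: "nat \<Rightarrow> 'n::finite \<Rightarrow> nat" where
  "index_enum = from_nat_into UNIV"

text \<open>An index type has at least one element, so the constant multi-indices already form an
  infinite set.\<close>

lemma bij_index_enum: "bij (index_enum :: nat \<Rightarrow> 'n::finite \<Rightarrow> nat)"
proof -
  have "inj (\<lambda>k. (\<lambda>_. k) :: 'n \<Rightarrow> nat)"
    by (auto simp: inj_def fun_eq_iff)
  then have "infinite (UNIV :: ('n \<Rightarrow> nat) set)"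
    using infinite_iff_countable_subset by auto
  then show ?thesis
    unfolding index_enum_def by (intro bij_betw_from_nat_into) auto
qed

text \<open>The isometry of the coefficient space of weight \<open>1/\<rho>\<^sub>m\<close> onto \<open>\<ell>\<^sup>2(\<nat>)\<close>.\<close>

definition wseq :: "nat \<Rightarrow> (('n::finite \<Rightarrow> nat) \<Rightarrow> 'a::complex_hilbert) \<Rightarrow> 'a l2seq" where
  "wseq m a = Abs_l2seq (\<lambda>j. (1 / sqrt (rho m (index_enum j :: 'n \<Rightarrow> nat))) *\<^sub>R a (index_enum j))"

lemma norm_weight_sq: "(norm ((1 / sqrt (rho m \<alpha>)) *\<^sub>R x))\<^sup>2 = (norm x)\<^sup>2 / rho m \<alpha>"
  by (simp add: power_divide power_mult_distrib)

lemma wsummable_iff_summable: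
  fixes a :: "('n::finite \<Rightarrow> nat) \<Rightarrow> 'a::complex_hilbert"
  shows "wsummable m a \<longleftrightarrow>
    summable (\<lambda>j. (norm ((1 / sqrt (rho m (index_enum j :: 'n \<Rightarrow> nat))) *\<^sub>R a (index_enum j)))\<^sup>2)"
proof -
  have "wsummable m a \<longleftrightarrow> (\<lambda>j. (norm (a (index_enum j)))\<^sup>2 / rho m (index_enum j :: 'n \<Rightarrow> nat))
      summable_on UNIV"
    unfolding wsummable_def by (rule summable_on_reindex_bij_betw[OF bij_index_enum, symmetric])
  also have "\<dots> \<longleftrightarrow> summable (\<lambda>j. (norm (a (index_enum j)))\<^sup>2 / rho m (index_enum j :: 'n \<Rightarrow> nat))"
    by (rule summable_on_UNIV_nonneg_real_iff) simp
  finally show ?thesis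
    unfolding norm_weight_sq .
qed

lemma Rep_wseq:
  fixes a :: "('n::finite \<Rightarrow> nat) \<Rightarrow> 'a::complex_hilbert"
  assumes "wsummable m a"
  shows "Rep_l2seq (wseq m a) j = (1 / sqrt (rho m (index_enum j :: 'n \<Rightarrow> nat))) *\<^sub>R a (index_enum j)"
  using assms unfolding wseq_def wsummable_iff_summable by (simp add: Abs_l2seq_inverse)

lemma wseq_eq_iff:
  fixes a :: "('n::finite \<Rightarrow> nat) \<Rightarrow> 'a::complex_hilbert"
  assumes "wsummable m a"
  shows "wseq m a = s \<longleftrightarrow> (\<forall>j. Rep_l2seq s j = (1 / sqrt (rho m (index_enum j :: 'n \<Rightarrow> nat)))
      *\<^sub>R a (index_enum j))"
  using Rep_wseq[OF assms] by (metis Rep_l2seq_inject ext)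

lemma wsummable_add: "wsummable m a \<Longrightarrow> wsummable m b \<Longrightarrow> wsummable m (\<lambda>\<alpha>. a \<alpha> + b \<alpha>)"
  unfolding wsummable_iff_summable scaleR_add_right by (rule l2seq_summable_add)

lemma wsummable_scaleC: "wsummable m a \<Longrightarrow> wsummable m (\<lambda>\<alpha>. c *\<^sub>C a \<alpha>)"
  unfolding wsummable_def norm_scaleC power_mult_distrib times_divide_eq_right[symmetric]
  by (rule summable_on_cmult_right)

lemma wsummable_finite_support:
  assumes "finite F" "\<And>\<alpha>. \<alpha> \<notin> F \<Longrightarrow> a \<alpha> = 0"
  shows "wsummable m a"
  unfolding wsummable_def
proof (rule finite_nonzero_values_imp_summable_on)
  show "finite {\<alpha> \<in> UNIV. (norm (a \<alpha>))\<^sup>2 / rho m \<alpha> \<noteq> 0}"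
    by (rule finite_subset[OF _ assms(1)]) (use assms(2) in auto)
qed

lemma wseq_add: "wsummable m a \<Longrightarrow> wsummable m b \<Longrightarrow> wseq m (\<lambda>\<alpha>. a \<alpha> + b \<alpha>) = wseq m a + wseq m b"
  by (simp add: wseq_eq_iff wsummable_add plus_l2seq.rep_eq Rep_wseq scaleR_add_right)

lemma wseq_scaleC: "wsummable m a \<Longrightarrow> wseq m (\<lambda>\<alpha>. c *\<^sub>C a \<alpha>) = c *\<^sub>C wseq m a"
  by (simp add: wseq_eq_iff wsummable_scaleC scaleC_l2seq.rep_eq Rep_wseq scaleR_scaleC
      scaleC_scaleC
      mult.commute)

lemma has_sum_cinner_wseq:
  fixes a b :: "('n::finite \<Rightarrow> nat) \<Rightarrow> 'a::complex_hilbert"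
  assumes a: "wsummable m a" and b: "wsummable m b"
  shows "((\<lambda>\<alpha>. cinner (a \<alpha>) (b \<alpha>) / complex_of_real (rho m \<alpha>)) has_sum cinner (wseq m a) (wseq m b))
      UNIV"
proof -
  let ?f = "\<lambda>j. cinner (Rep_l2seq (wseq m a) j) (Rep_l2seq (wseq m b) j)"
  have sa: "summable (\<lambda>j. (norm (Rep_l2seq (wseq m a) j))\<^sup>2)"
      "summable (\<lambda>j. (norm (Rep_l2seq (wseq m b) j))\<^sup>2)"
    using Rep_l2seq by auto
  have "summable (\<lambda>j. norm (?f j))"
    by (rule summable_comparison_test'[OF summable_add[OF sa]]) (simp add: norm_cinner_le)
  moreover have "?f sums cinner (wseq m a) (wseq m b)"
    unfolding cinner_l2seq.rep_eq by (intro summable_sums l2seq_summable_cinner sa)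
  ultimately have "(?f has_sum cinner (wseq m a) (wseq m b)) UNIV"
    by (rule norm_summable_imp_has_sum)
  moreover have "?f j = cinner (a (index_enum j)) (b (index_enum j))
      / complex_of_real (rho m (index_enum j :: 'n \<Rightarrow> nat))" for j
    by (simp add: Rep_wseq a b cinner_scaleR_left cinner_scaleR_right flip: of_real_mult)
  ultimately show ?thesis
    using has_sum_reindex_bij_betw[OF bij_index_enum,
        of "\<lambda>\<alpha>. cinner (a \<alpha>) (b \<alpha>) / complex_of_real (rho m \<alpha>)"] by simp
qed

lemma has_sum_norm_wseq:
  assumes "wsummable m a"
  shows "((\<lambda>\<alpha>. (norm (a \<alpha>))\<^sup>2 / rho m \<alpha>) has_sum (norm (wseq m a))\<^sup>2) UNIV"
  using has_sum_Re[OF has_sum_cinner_wseq[OF assms assms]]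
  by (simp add: cinner_self norm_sq_eq_cinner[symmetric] del: of_real_power flip: of_real_divide)

lemma norm_wseq_sq_eq: "wsummable m a \<Longrightarrow> (norm (wseq m a))\<^sup>2 = (\<Sum>\<^sub>\<infinity>\<alpha>. (norm (a \<alpha>))\<^sup>2 / rho m \<alpha>)"
  using infsumI[OF has_sum_norm_wseq] by metis

lemma norm_wseq_leI:
  assumes a: "wsummable m a" and "0 \<le> c" and "\<And>N. (\<Sum>\<alpha> | deg \<alpha> \<le> N. (norm (a \<alpha>))\<^sup>2 / rho m \<alpha>) \<le> c\<^sup>2"
  shows "norm (wseq m a) \<le> c"
proof (rule power2_le_imp_le)
  show "(norm (wseq m a))\<^sup>2 \<le> c\<^sup>2"
    unfolding norm_wseq_sq_eq[OF a] by (rule summable_on_deg_bounded(2)) (use assms in auto)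
qed fact

lemma sum_norm_le_wseq:
  assumes a: "wsummable m a" and F: "finite F"
  shows "(\<Sum>\<alpha>\<in>F. (norm (a \<alpha>))\<^sup>2 / rho m \<alpha>) \<le> (norm (wseq m a))\<^sup>2"
  unfolding norm_wseq_sq_eq[OF a]
  by (rule finite_sum_le_infsum) (use assms in \<open>auto simp: wsummable_def\<close>)

definition wspace :: "nat \<Rightarrow> 'a::complex_hilbert set \<Rightarrow> (('n::finite \<Rightarrow> nat) \<Rightarrow> 'a) set" where
  "wspace m V = {a. wsummable m a \<and> range a \<subseteq> V}"

lemma wseq_surj:
  obtains a where "wsummable m (a :: ('n::finite \<Rightarrow> nat) \<Rightarrow> 'a::complex_hilbert)" "wseq m a = s"
    "\<And>\<alpha>. \<exists>j c. a \<alpha> = c *\<^sub>R Rep_l2seq s j"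
proof -
  let ?inv = "inv (index_enum :: nat \<Rightarrow> 'n \<Rightarrow> nat)"
  define a where "a \<alpha> = sqrt (rho m \<alpha>) *\<^sub>R Rep_l2seq s (?inv \<alpha>)" for \<alpha>
  have "(1 / sqrt (rho m (index_enum j :: 'n \<Rightarrow> nat))) *\<^sub>R a (index_enum j) = Rep_l2seq s j" for j
    by (simp add: a_def inv_f_f[OF bij_is_inj[OF bij_index_enum]])
  then have "wsummable m a" "wseq m a = s"
    using Rep_l2seq[of s] unfolding wsummable_iff_summable wseq_def
        by (auto simp: Rep_l2seq_inverse)
  then show ?thesis
    using that[of a] a_def by blast
qed

lemma wseq_inject:
  fixes a :: "('n::finite \<Rightarrow> nat) \<Rightarrow> 'a::complex_hilbert"
  assumes "wsummable m a" "wsummable m b" "wseq m a = wseq m b"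
  shows "a = b"
proof
  fix \<alpha> :: "'n \<Rightarrow> nat"
  obtain j where j: "\<alpha> = index_enum j"
    using bij_index_enum by (metis bij_pointE)
  have "(1 / sqrt (rho m \<alpha>)) *\<^sub>R a \<alpha> = (1 / sqrt (rho m \<alpha>)) *\<^sub>R b \<alpha>"
    unfolding j by (metis Rep_wseq assms)
  then show "a \<alpha> = b \<alpha>"
    by simp
qed

lemma wseq_image_wspace:
  assumes V: "closed_csubspace V"
  shows "wseq m ` (wspace m V :: (('n::finite \<Rightarrow> nat) \<Rightarrow> 'a::complex_hilbert) set)
      = {s. \<forall>j. Rep_l2seq s j \<in> V}"
proof (intro equalityI subsetI)
  fix s assume "s \<in> wseq m ` (wspace m V :: (('n \<Rightarrow> nat) \<Rightarrow> 'a) set)"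
  then show "s \<in> {s. \<forall>j. Rep_l2seq s j \<in> V}"
    using csubspace_scaleR[OF V] by (auto simp: wspace_def Rep_wseq image_subset_iff)
next
  fix s assume s: "s \<in> {s. \<forall>j. Rep_l2seq s j \<in> V}"
  obtain a where a: "wsummable m (a :: ('n \<Rightarrow> nat) \<Rightarrow> 'a)" "wseq m a = s"
    "\<And>\<alpha>. \<exists>j c. a \<alpha> = c *\<^sub>R Rep_l2seq s j"
    using wseq_surj[of m s] by blast
  have "a \<alpha> \<in> V" for \<alpha>
    using a(3)[of \<alpha>] s csubspace_scaleR[OF V] by auto
  then show "s \<in> wseq m ` (wspace m V :: (('n \<Rightarrow> nat) \<Rightarrow> 'a) set)"
    using a by (auto simp: wspace_def)
qed

lemma csubspace_l2seq:
  assumes V: "closed_csubspace V"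
  shows "closed_csubspace {s. \<forall>j. Rep_l2seq s j \<in> V}"
proof -
  have "bounded_linear (\<lambda>s :: 'a l2seq. Rep_l2seq s j)" for j
    by (rule bounded_linear_intro[of _ 1])
      (auto simp: plus_l2seq.rep_eq scaleR_l2seq.rep_eq norm_Rep_l2seq_le)
  then have "closed ((\<lambda>s :: 'a l2seq. Rep_l2seq s j) -` V)" for j
    by (intro continuous_closed_vimage csubspace_closed[OF V] linear_continuous_at)
  then have "closed (\<Inter>j. (\<lambda>s :: 'a l2seq. Rep_l2seq s j) -` V)"
    by blast
  moreover have "{s. \<forall>j. Rep_l2seq s j \<in> V} = (\<Inter>j. (\<lambda>s :: 'a l2seq. Rep_l2seq s j) -` V)"
    by auto
  ultimately show ?thesis
    using V by (auto simp: closed_csubspace_def plus_l2seq.rep_eq scaleC_l2seq.rep_eq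
        zero_l2seq.rep_eq)
qed

text \<open>The weighted spaces depend on \<open>m\<close> and are sets of families, not instances
  of the Hilbert space class. Through \<open>wseq\<close> the map becomes an operator on a closed
  subspace of \<open>l2seq\<close>, where the Riesz representation supplies an adjoint of norm at
  most one.\<close>

lemma wspace_adjoint_exists:
  fixes L :: "(('n::finite \<Rightarrow> nat) \<Rightarrow> 'a::complex_hilbert) \<Rightarrow> ('n \<Rightarrow> nat) \<Rightarrow> 'b::complex_hilbert"
  assumes V: "closed_csubspace V"
    and L: "\<And>a. a \<in> wspace m V \<Longrightarrow> wsummable m (L a)"
    and L_add: "\<And>a b. a \<in> wspace m V \<Longrightarrow> b \<in> wspace m V \<Longrightarrow> L (\<lambda>\<alpha>. a \<alpha> + b \<alpha>) = (\<lambda>\<alpha>. L a \<alpha> + L b \<alpha>)"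
    and L_scale: "\<And>c a. a \<in> wspace m V \<Longrightarrow> L (\<lambda>\<alpha>. c *\<^sub>C a \<alpha>) = (\<lambda>\<alpha>. c *\<^sub>C L a \<alpha>)"
    and L_le: "\<And>a. a \<in> wspace m V \<Longrightarrow> norm (wseq m (L a)) \<le> norm (wseq m a)"
  shows "\<exists>x\<in>(wspace m V :: (('n \<Rightarrow> nat) \<Rightarrow> 'a) set).
    (\<forall>a\<in>wspace m V. cinner (wseq m (L a)) y = cinner (wseq m a) (wseq m x))
    \<and> norm (wseq m x) \<le> norm y"
proof -
  define V2 where "V2 = wseq m ` (wspace m V :: (('n \<Rightarrow> nat) \<Rightarrow> 'a) set)"
  have V2: "closed_csubspace V2"
    unfolding V2_def wseq_image_wspace[OF V] by (rule csubspace_l2seq[OF V])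
  define I where "I = inv_into (wspace m V :: (('n \<Rightarrow> nat) \<Rightarrow> 'a) set) (wseq m)"
  have inj: "inj_on (wseq m) (wspace m V :: (('n \<Rightarrow> nat) \<Rightarrow> 'a) set)"
    by (rule inj_onI) (auto simp: wspace_def intro: wseq_inject)
  have I: "I (wseq m a) = a" if "a \<in> wspace m V" for a
    unfolding I_def using inv_into_f_f[OF inj that] .
  define F where "F s = wseq m (L (I s))" for s
  have F: "F (wseq m a) = wseq m (L a)" if "a \<in> wspace m V" for a
    by (simp add: F_def I that)
  have add_in: "(\<lambda>\<alpha>. a \<alpha> + b \<alpha>) \<in> wspace m V" if "a \<in> wspace m V" "b \<in> wspace m V" for a b ::
      "('n \<Rightarrow> nat) \<Rightarrow> 'a"
    using that csubspace_add[OF V] by (auto simp: wspace_def wsummable_add image_subset_iff)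
  have scale_in: "(\<lambda>\<alpha>. c *\<^sub>C a \<alpha>) \<in> wspace m V" if "a \<in> wspace m V" for c and a :: "('n \<Rightarrow> nat) \<Rightarrow> 'a"
    using that csubspace_scaleC[OF V] by (auto simp: wspace_def wsummable_scaleC image_subset_iff)
  have lin: "clinear_on V2 F"
    unfolding clinear_on_def V2_def
  proof (intro conjI ballI allI)
    fix s t c assume "s \<in> wseq m ` (wspace m V :: (('n \<Rightarrow> nat) \<Rightarrow> 'a) set)"
      "t \<in> wseq m ` (wspace m V :: (('n \<Rightarrow> nat) \<Rightarrow> 'a) set)"
    then obtain a b :: "('n \<Rightarrow> nat) \<Rightarrow> 'a" where
      a: "a \<in> wspace m V" "s = wseq m a" and b: "b \<in> wspace m V" "t = wseq m b"
      by blast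
    have ws: "wsummable m a" "wsummable m b"
      using a b by (auto simp: wspace_def)
    show "F (s + t) = F s + F t"
      using F[OF add_in[OF a(1) b(1)]]
      by (simp add: a b F wseq_add[symmetric] ws L L_add)
    show "F (c *\<^sub>C s) = c *\<^sub>C F s"
      using F[OF scale_in[OF a(1), of c]]
      by (simp add: a F wseq_scaleC[symmetric] ws L L_scale)
  qed
  have le: "norm (F s) \<le> 1 * norm s" if "s \<in> V2" for s
    using that L_le by (auto simp: V2_def F)
  have bF: "bounded_op V2 UNIV F"
    unfolding bounded_op_def using lin le by blast
  have "adjoint_on V2 F y \<in> V2"
    by (rule adjoint_on_in[OF V2 bF])
  then obtain x :: "('n \<Rightarrow> nat) \<Rightarrow> 'a" where x: "x \<in> wspace m V" "adjoint_on V2 F y = wseq m x"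
    unfolding V2_def by blast
  have "cinner (wseq m (L a)) y = cinner (wseq m a) (wseq m x)" if "a \<in> wspace m V" for a
  proof -
    have "wseq m a \<in> V2"
      using that by (simp add: V2_def)
    from adjoint_on_cinner[OF V2 bF this, of y] show ?thesis
      by (simp only: F[OF that] x(2))
  qed
  moreover have "norm (wseq m x) \<le> norm y"
    using adjoint_on_norm_le[OF V2 bF zero_le_one le, of y] unfolding x(2) by simp
  ultimately show ?thesis
    using x(1) by blast
qed

section \<open>The function spaces in terms of coefficients\<close>

definition Hm_fun :: "(('n::finite \<Rightarrow> nat) \<Rightarrow> 'a::complex_hilbert) \<Rightarrow> complex ^ 'n \<Rightarrow> 'a" where
  "Hm_fun a = (\<lambda>z. if z \<in> ball 0 1 then \<Sum>\<^sub>\<infinity>\<alpha>. zpow z \<alpha> *\<^sub>C a \<alpha> else 0)"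

text \<open>Each term is dominated, by the inequality of arithmetic and geometric means, by a term
  of the kernel on the diagonal plus a term of the squared norm of the family.\<close>

lemma wsummable_abs_summable:
  fixes a :: "('n::finite \<Rightarrow> nat) \<Rightarrow> 'a::complex_hilbert"
  assumes m: "1 \<le> m" and a: "wsummable m a" and z: "z \<in> ball 0 1"
  shows "(\<lambda>\<alpha>. zpow z \<alpha> *\<^sub>C a \<alpha>) abs_summable_on UNIV"
proof (rule summable_on_comparison_test)
  show "(\<lambda>\<alpha>. rho m \<alpha> * (cmod (zpow z \<alpha>))\<^sup>2 + (norm (a \<alpha>))\<^sup>2 / rho m \<alpha>) summable_on UNIV"
    using a by (intro summable_on_add summable_rho_zpow[OF z m]) (simp add: wsummable_def)
  fix \<alpha> :: "'n \<Rightarrow> nat"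
  have "2 * (sqrt (rho m \<alpha>) * cmod (zpow z \<alpha>)) * (norm (a \<alpha>) / sqrt (rho m \<alpha>))
      \<le> (sqrt (rho m \<alpha>) * cmod (zpow z \<alpha>))\<^sup>2 + (norm (a \<alpha>) / sqrt (rho m \<alpha>))\<^sup>2"
    by (rule sum_squares_bound)
  then have "2 * (cmod (zpow z \<alpha>) * norm (a \<alpha>))
      \<le> rho m \<alpha> * (cmod (zpow z \<alpha>))\<^sup>2 + (norm (a \<alpha>))\<^sup>2 / rho m \<alpha>"
    by (simp add: power_mult_distrib power_divide)
  then show "norm (zpow z \<alpha> *\<^sub>C a \<alpha>) \<le> rho m \<alpha> * (cmod (zpow z \<alpha>))\<^sup>2 + (norm (a \<alpha>))\<^sup>2 / rho m \<alpha>"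
    unfolding norm_scaleC using mult_nonneg_nonneg[of "cmod (zpow z \<alpha>)" "norm (a \<alpha>)"]
    by (simp del: mult_nonneg_nonneg zero_le_mult_iff)
qed auto

lemma has_power_series_Hm_fun:
  assumes "1 \<le> m" "wsummable m a"
  shows "has_power_series (Hm_fun a) a"
  unfolding has_power_series_def Hm_fun_def
  using abs_summable_summable[OF wsummable_abs_summable[OF assms]] by auto

lemma coeffs_Hm_fun [simp]: "1 \<le> m \<Longrightarrow> wsummable m a \<Longrightarrow> coeffs (Hm_fun a) = a"
  by (intro coeffs_eq has_power_series_Hm_fun)

lemma Hm_fun_in: "1 \<le> m \<Longrightarrow> a \<in> wspace m V \<Longrightarrow> Hm_fun a \<in> Hm m V"
  using has_power_series_Hm_fun[of m a]
  by (auto simp: Hm_def wspace_def Hm_fun_def wsummable_def)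

lemma Hm_coeffs:
  assumes "f \<in> Hm m V"
  shows Hm_coeffs_in: "coeffs f \<in> wspace m V" and Hm_power_series: "has_power_series f (coeffs f)"
    and Hm_fun_coeffs: "Hm_fun (coeffs f) = f"
proof -
  obtain a where a: "has_power_series f a" "range a \<subseteq> V" "wsummable m a"
    and f0: "\<And>z. z \<notin> ball 0 1 \<Longrightarrow> f z = 0"
    using assms by (auto simp: Hm_def wsummable_def)
  have [simp]: "coeffs f = a" by (rule coeffs_eq[OF a(1)])
  show "coeffs f \<in> wspace m V" "has_power_series f (coeffs f)"
    using a by (auto simp: wspace_def)
  show "Hm_fun (coeffs f) = f"
    using a(1) f0 by (auto simp: Hm_fun_def fun_eq_iff has_power_series_def infsumI)
qed

lemma Hm_iff: "1 \<le> m \<Longrightarrow> f \<in> Hm m V \<longleftrightarrow> (\<exists>a\<in>wspace m V. f = Hm_fun a)"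
  using Hm_fun_in Hm_coeffs_in Hm_fun_coeffs by metis

lemma Hm_inner_Hm_fun:
  assumes "1 \<le> m" "wsummable m a" "wsummable m b"
  shows "Hm_inner m (Hm_fun a) (Hm_fun b) = cinner (wseq m a) (wseq m b)"
  unfolding Hm_inner_def using assms infsumI[OF has_sum_cinner_wseq[OF assms(2,3)]] by simp

lemma Hm_norm_Hm_fun:
  assumes "1 \<le> m" "wsummable m a"
  shows "Hm_norm m (Hm_fun a) = norm (wseq m a)"
  unfolding Hm_norm_def using assms norm_wseq_sq_eq[OF assms(2)] by (simp flip: norm_wseq_sq_eq)

definition wsingle :: "('n \<Rightarrow> nat) \<Rightarrow> 'a::zero \<Rightarrow> ('n \<Rightarrow> nat) \<Rightarrow> 'a" where
  "wsingle \<alpha> v = (\<lambda>\<beta>. if \<beta> = \<alpha> then v else 0)"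

lemma wsummable_wsingle [simp]: "wsummable m (wsingle \<alpha> v)"
  by (rule wsummable_finite_support[of "{\<alpha>}"]) (auto simp: wsingle_def)

lemma wsingle_in: "closed_csubspace V \<Longrightarrow> v \<in> V \<Longrightarrow> wsingle \<alpha> v \<in> wspace m V"
  using wsummable_wsingle[of m \<alpha> v] by (auto simp: wspace_def wsingle_def csubspace_zero)

lemma cinner_wsingle:
  assumes "wsummable m b"
  shows "cinner (wseq m (wsingle \<alpha> v)) (wseq m b) = cinner v (b \<alpha>) / complex_of_real (rho m \<alpha>)"
proof -
  have "((\<lambda>\<beta>. cinner (wsingle \<alpha> v \<beta>) (b \<beta>) / complex_of_real (rho m \<beta>)) has_sum
      (cinner v (b \<alpha>) / complex_of_real (rho m \<alpha>))) UNIV"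
    by (rule has_sum_finite_neutralI[of "{\<alpha>}"]) (auto simp: wsingle_def)
  then show ?thesis
    using has_sum_cinner_wseq[OF wsummable_wsingle assms] has_sum_unique by blast
qed

section \<open>Multipliers on the weighted spaces\<close>

text \<open>Cauchy-Schwarz with weight \<open>rho m\<close>; this is the estimate of point
  evaluations by the kernel, for the sum of absolute values.\<close>

lemma sum_zpow_norm_le:
  fixes a :: "('n::finite \<Rightarrow> nat) \<Rightarrow> 'a::complex_hilbert"
  assumes m: "1 \<le> m" and a: "wsummable m a" and z: "z \<in> ball 0 1"
  shows "(\<Sum>\<^sub>\<infinity>\<alpha>. norm (zpow z \<alpha> *\<^sub>C a \<alpha>)) \<le> sqrt ((1 / (1 - (norm z)\<^sup>2)) ^ m) * norm (wseq m a)"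
proof (rule summable_on_deg_bounded(2))
  fix N
  let ?F = "{\<alpha> :: 'n \<Rightarrow> nat. deg \<alpha> \<le> N}"
  have "(\<Sum>\<alpha>\<in>?F. norm (zpow z \<alpha> *\<^sub>C a \<alpha>))
      = (\<Sum>\<alpha>\<in>?F. \<bar>sqrt (rho m \<alpha>) * cmod (zpow z \<alpha>)\<bar> * \<bar>norm (a \<alpha>) / sqrt (rho m \<alpha>)\<bar>)"
    by (simp add: norm_scaleC abs_mult)
  also have "\<dots> \<le> L2_set (\<lambda>\<alpha>. sqrt (rho m \<alpha>) * cmod (zpow z \<alpha>)) ?F
      * L2_set (\<lambda>\<alpha>. norm (a \<alpha>) / sqrt (rho m \<alpha>)) ?F"
    by (rule L2_set_mult_ineq)
  also have "\<dots> \<le> sqrt ((1 / (1 - (norm z)\<^sup>2)) ^ m) * sqrt ((norm (wseq m a))\<^sup>2)"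
    unfolding L2_set_def
  proof (intro mult_mono real_sqrt_le_mono)
    show "(\<Sum>\<alpha>\<in>?F. (sqrt (rho m \<alpha>) * cmod (zpow z \<alpha>))\<^sup>2) \<le> (1 / (1 - (norm z)\<^sup>2)) ^ m"
      using sum_rho_zpow_bounded[of z m N] z m by (simp add: power_mult_distrib)
    show "(\<Sum>\<alpha>\<in>?F. (norm (a \<alpha>) / sqrt (rho m \<alpha>))\<^sup>2) \<le> (norm (wseq m a))\<^sup>2"
      using sum_norm_le_wseq[OF a, of ?F] by (simp add: power_divide)
    show "0 \<le> sqrt ((1 / (1 - (norm z)\<^sup>2)) ^ m)"
      using z by (simp add: power_le_one_iff abs_square_le_1)
  qed (auto intro: sum_nonneg)
  finally show "(\<Sum>\<alpha>\<in>?F. norm (zpow z \<alpha> *\<^sub>C a \<alpha>))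
      \<le> sqrt ((1 / (1 - (norm z)\<^sup>2)) ^ m) * norm (wseq m a)" by simp
qed simp

lemma weighted_cauchy_schwarz:
  fixes f g :: "'i \<Rightarrow> 'a::complex_hilbert"
  assumes w: "\<And>i. 0 < w i"
  shows "Re (\<Sum>i\<in>F. cinner (f i) (g i)) \<le> sqrt (\<Sum>i\<in>F. (norm (f i))\<^sup>2 / w i)
      * sqrt (\<Sum>i\<in>F. w i * (norm (g i))\<^sup>2)"
proof -
  have "Re (\<Sum>i\<in>F. cinner (f i) (g i)) \<le> (\<Sum>i\<in>F. \<bar>norm (f i) / sqrt (w i)\<bar> * \<bar>sqrt (w i)
      * norm (g i)\<bar>)"
    unfolding Re_sum
  proof (rule sum_mono)
    fix i
    have "\<bar>norm (f i) / sqrt (w i)\<bar> * \<bar>sqrt (w i) * norm (g i)\<bar> = norm (f i) * norm (g i)"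
      using w[of i] by (simp add: abs_mult)
    then show "Re (cinner (f i) (g i)) \<le> \<bar>norm (f i) / sqrt (w i)\<bar> * \<bar>sqrt (w i) * norm (g i)\<bar>"
      using Re_cinner_le[of "f i" "g i"] by simp
  qed
  also have "\<dots> \<le> L2_set (\<lambda>i. norm (f i) / sqrt (w i)) F * L2_set (\<lambda>i. sqrt (w i) * norm (g i)) F"
    by (rule L2_set_mult_ineq)
  also have "\<dots> = sqrt (\<Sum>i\<in>F. (norm (f i))\<^sup>2 / w i) * sqrt (\<Sum>i\<in>F. w i * (norm (g i))\<^sup>2)"
    using w by (simp add: L2_set_def power_divide power_mult_distrib less_imp_le)
  finally show ?thesis .
qed

lemma eq_Re_of_real_eq: "complex_of_real s = w \<Longrightarrow> s = Re w"
  by auto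

text \<open>Concludes the duality arguments below, where Cauchy-Schwarz against a test family built
  from the unknown yields its squared norm \<open>s\<close> on both sides.\<close>

lemma le_of_le_sqrt_mult_sqrt:
  fixes s t :: real
  assumes "s \<le> sqrt t * sqrt s" "0 \<le> s" "0 \<le> t"
  shows "s \<le> t"
proof -
  have "(sqrt s)\<^sup>2 \<le> sqrt t * sqrt s"
    using assms by simp
  then have "sqrt s \<le> sqrt t"
    by (rule norm_le_of_sq_le_mult) (use assms(3) in simp)
  then show ?thesis by simp
qed

definition conv_coeffs :: "(('n \<Rightarrow> nat) \<Rightarrow> 'a \<Rightarrow> 'b) \<Rightarrow> (('n \<Rightarrow> nat) \<Rightarrow> 'a) \<Rightarrow> ('n::finite \<Rightarrow> nat) \<Rightarrow>
    'b::comm_monoid_add" where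
  "conv_coeffs \<phi> a \<gamma> = (\<Sum>\<alpha>\<le>\<gamma>. \<phi> (\<gamma> - \<alpha>) (a \<alpha>))"

text \<open>
  A coefficient family \<open>\<phi>\<close> acting contractively by convolution for the weight \<open>1/\<rho>\<^sub>1\<close> does so
  for \<open>1/\<rho>\<^sub>m\<close>: after the substitution \<open>b\<^sub>\<gamma> = c\<^sub>\<gamma>/\<rho>\<^sub>m(\<gamma>)\<close> the adjoint action
  \<open>x\<^sub>\<alpha> = \<Sum>\<^sub>\<beta> \<phi>\<^sub>\<beta>\<^sup>* b\<^sub>\<alpha>\<^sub>+\<^sub>\<beta>\<close> does not depend on \<open>m\<close> and commutes with backward shifts, while
  \<open>\<rho>\<^sub>m = \<rho>\<^sub>m\<^sub>-\<^sub>1 * \<rho>\<^sub>1\<close>.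
\<close>

context
  fixes V :: "'a::complex_hilbert set" and \<phi> :: "('n::finite \<Rightarrow> nat) \<Rightarrow> 'a \<Rightarrow> 'b::complex_hilbert"
  assumes V: "closed_csubspace V" and b\<phi>: "\<And>\<beta>. bounded_op V UNIV (\<phi> \<beta>)"
begin

text \<open>Cutting off at total degree \<open>N\<close> turns the pairing between convolution and
  adjoint action into a finite identity, free of questions of convergence.\<close>

definition conv_adj :: "nat \<Rightarrow> (('n \<Rightarrow> nat) \<Rightarrow> 'b) \<Rightarrow> ('n \<Rightarrow> nat) \<Rightarrow> 'a" where
  "conv_adj N b \<alpha> = (\<Sum>\<beta> | deg \<beta> \<le> N - deg \<alpha>. adjoint_on V (\<phi> \<beta>) (b (\<alpha> + \<beta>)))"

lemma conv_adj_in: "conv_adj N b \<alpha> \<in> V"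
  unfolding conv_adj_def by (intro csubspace_sum[OF V] adjoint_on_in[OF V b\<phi>])

text \<open>Commutation with the backward shift by \<open>\<delta>\<close>; the cutoff drops by
  \<open>deg \<delta>\<close>, so the estimate at weight 1 applies to every shifted family.\<close>

lemma conv_adj_shift: "conv_adj (N - deg \<delta>) (\<lambda>\<gamma>. b (\<delta> + \<gamma>)) \<alpha> = conv_adj N b (\<delta> + \<alpha>)"
  unfolding conv_adj_def by (simp add: add.assoc)

lemma conv_adj_pairing:
  assumes "\<And>\<alpha>. a \<alpha> \<in> V"
  shows "(\<Sum>\<gamma> | deg \<gamma> \<le> N. cinner (conv_coeffs \<phi> a \<gamma>) (b \<gamma>))
    = (\<Sum>\<alpha> | deg \<alpha> \<le> N. cinner (a \<alpha>) (conv_adj N b \<alpha>))"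
proof -
  have "(\<Sum>\<gamma> | deg \<gamma> \<le> N. cinner (conv_coeffs \<phi> a \<gamma>) (b \<gamma>))
      = (\<Sum>\<gamma> | deg \<gamma> \<le> N. \<Sum>\<alpha>\<le>\<gamma>. cinner (\<phi> (\<gamma> - \<alpha>) (a \<alpha>)) (b (\<alpha> + (\<gamma> - \<alpha>))))"
    unfolding conv_coeffs_def cinner_sum_left
    by (intro sum.cong refl) (simp add: index_add_diff)
  also have "\<dots> = (\<Sum>\<alpha> | deg \<alpha> \<le> N. cinner (a \<alpha>) (conv_adj N b \<alpha>))"
    by (subst sum_convolution)
      (simp add: conv_adj_def cinner_sum_right adjoint_on_cinner[OF V b\<phi> assms])
  finally show ?thesis .
qed

text \<open>Contractivity is demanded on finitely supported families, where it can be read off from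
  the action of a multiplier on polynomials.\<close>

context
  assumes contr: "\<And>a N. (\<And>\<alpha>. a \<alpha> \<in> V) \<Longrightarrow> finite {\<alpha>. a \<alpha> \<noteq> 0} \<Longrightarrow>
    (\<Sum>\<gamma> | deg \<gamma> \<le> N. (norm (conv_coeffs \<phi> a \<gamma>))\<^sup>2 / rho 1 \<gamma>) \<le> (\<Sum>\<alpha> | a \<alpha> \<noteq> 0. (norm (a \<alpha>))\<^sup>2
        / rho 1 \<alpha>)"
begin

lemma conv_adj_contractive_1:
  "(\<Sum>\<alpha> | deg \<alpha> \<le> N. rho 1 \<alpha> * (norm (conv_adj N b \<alpha>))\<^sup>2) \<le> (\<Sum>\<gamma> | deg \<gamma> \<le> N. rho 1 \<gamma> * (norm (b \<gamma>))\<^sup>2)"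
    (is "?s \<le> ?t")
proof (rule le_of_le_sqrt_mult_sqrt)
  show nn: "0 \<le> ?s" "0 \<le> ?t"
    by (auto intro!: sum_nonneg)
  \<comment> \<open>The test family is the adjoint image times \<open>rho 1\<close>, so that its
    squared norm for the weight \<open>1 / rho 1\<close> equals \<open>?s\<close>.\<close>
  define a where "a \<alpha> = (if deg \<alpha> \<le> N then rho 1 \<alpha> *\<^sub>R conv_adj N b \<alpha> else 0)" for \<alpha>
  have aV: "a \<alpha> \<in> V" for \<alpha>
    by (simp add: a_def csubspace_scaleR[OF V conv_adj_in] csubspace_zero[OF V])
  have supp: "{\<alpha>. a \<alpha> \<noteq> 0} \<subseteq> {\<alpha>. deg \<alpha> \<le> N}"
    by (auto simp: a_def)
  have "complex_of_real ?s = (\<Sum>\<alpha> | deg \<alpha> \<le> N. cinner (a \<alpha>) (conv_adj N b \<alpha>))"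
    by (simp add: a_def cinner_scaleR_left cinner_self)
  also have "\<dots> = (\<Sum>\<gamma> | deg \<gamma> \<le> N. cinner (conv_coeffs \<phi> a \<gamma>) (b \<gamma>))"
    by (rule conv_adj_pairing[OF aV, symmetric])
  finally have "?s = Re (\<Sum>\<gamma> | deg \<gamma> \<le> N. cinner (conv_coeffs \<phi> a \<gamma>) (b \<gamma>))"
    by (rule eq_Re_of_real_eq)
  also have "\<dots> \<le> sqrt (\<Sum>\<gamma> | deg \<gamma> \<le> N. (norm (conv_coeffs \<phi> a \<gamma>))\<^sup>2 / rho 1 \<gamma>) * sqrt ?t"
    by (rule weighted_cauchy_schwarz) simp
  also have "\<dots> \<le> sqrt ?s * sqrt ?t"
  proof (intro mult_right_mono real_sqrt_le_mono)
    have "(\<Sum>\<gamma> | deg \<gamma> \<le> N. (norm (conv_coeffs \<phi> a \<gamma>))\<^sup>2 / rho 1 \<gamma>) \<le> (\<Sum>\<alpha> | a \<alpha> \<noteq> 0. (norm (a \<alpha>))\<^sup>2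
        / rho 1 \<alpha>)"
      by (intro contr aV finite_subset[OF supp]) simp
    also have "\<dots> \<le> (\<Sum>\<alpha> | deg \<alpha> \<le> N. (norm (a \<alpha>))\<^sup>2 / rho 1 \<alpha>)"
      by (rule sum_mono2[OF _ supp]) auto
    also have "\<dots> = ?s"
      by (rule sum.cong) (auto simp: a_def power_mult_distrib power2_eq_square)
    finally show "(\<Sum>\<gamma> | deg \<gamma> \<le> N. (norm (conv_coeffs \<phi> a \<gamma>))\<^sup>2 / rho 1 \<gamma>) \<le> ?s" .
  qed (use nn in simp)
  finally show "?s \<le> sqrt ?t * sqrt ?s" by (simp add: mult.commute)
qed

lemma conv_adj_contractive:
  assumes "1 \<le> m"
  shows "(\<Sum>\<alpha> | deg \<alpha> \<le> N. rho m \<alpha> * (norm (conv_adj N b \<alpha>))\<^sup>2) \<le> (\<Sum>\<gamma> | deg \<gamma> \<le> N. rho m \<gamma>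
      * (norm (b \<gamma>))\<^sup>2)"
proof (cases "m = 1")
  case True
  then show ?thesis using conv_adj_contractive_1 by simp
next
  case False
  then obtain p where p: "m = Suc p" "1 \<le> p"
    using assms by (cases m) auto
  show ?thesis
    unfolding p(1) sum_rho_Suc(1)[OF p(2)]
  proof (rule sum_mono, rule mult_left_mono)
    fix \<delta> :: "'n \<Rightarrow> nat"
    show "(\<Sum>\<beta> | deg \<beta> \<le> N - deg \<delta>. rho 1 \<beta> * (norm (conv_adj N b (\<delta> + \<beta>)))\<^sup>2)
        \<le> (\<Sum>\<beta> | deg \<beta> \<le> N - deg \<delta>. rho 1 \<beta> * (norm (b (\<delta> + \<beta>)))\<^sup>2)"
      unfolding conv_adj_shift[symmetric] by (rule conv_adj_contractive_1)
  qed simp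
qed

text \<open>A second duality returns from the adjoint action to the convolution, now at weight
  \<open>m\<close>; the test family is the convolution divided by \<open>rho m\<close>.\<close>

lemma conv_coeffs_contractive:
  assumes m: "1 \<le> m" and a: "\<And>\<alpha>. a \<alpha> \<in> V"
  shows "(\<Sum>\<gamma> | deg \<gamma> \<le> N. (norm (conv_coeffs \<phi> a \<gamma>))\<^sup>2 / rho m \<gamma>) \<le> (\<Sum>\<alpha> | deg \<alpha> \<le> N. (norm (a \<alpha>))\<^sup>2
      / rho m \<alpha>)"
    (is "?s \<le> ?t")
proof (rule le_of_le_sqrt_mult_sqrt)
  show nn: "0 \<le> ?s" "0 \<le> ?t"
    by (auto intro!: sum_nonneg)
  define b where "b \<gamma> = (1 / rho m \<gamma>) *\<^sub>R conv_coeffs \<phi> a \<gamma>" for \<gamma>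
  have "complex_of_real ?s = (\<Sum>\<gamma> | deg \<gamma> \<le> N. cinner (conv_coeffs \<phi> a \<gamma>) (b \<gamma>))"
    by (simp add: b_def cinner_scaleR_right cinner_self)
  also have "\<dots> = (\<Sum>\<alpha> | deg \<alpha> \<le> N. cinner (a \<alpha>) (conv_adj N b \<alpha>))"
    by (rule conv_adj_pairing[OF a])
  finally have "?s = Re (\<Sum>\<alpha> | deg \<alpha> \<le> N. cinner (a \<alpha>) (conv_adj N b \<alpha>))"
    by (rule eq_Re_of_real_eq)
  also have "\<dots> \<le> sqrt ?t * sqrt (\<Sum>\<alpha> | deg \<alpha> \<le> N. rho m \<alpha> * (norm (conv_adj N b \<alpha>))\<^sup>2)"
    by (rule weighted_cauchy_schwarz) simp
  also have "\<dots> \<le> sqrt ?t * sqrt (\<Sum>\<gamma> | deg \<gamma> \<le> N. rho m \<gamma> * (norm (b \<gamma>))\<^sup>2)"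
    using nn by (intro mult_left_mono real_sqrt_le_mono conv_adj_contractive m) auto
  also have "(\<Sum>\<gamma> | deg \<gamma> \<le> N. rho m \<gamma> * (norm (b \<gamma>))\<^sup>2) = ?s"
    by (rule sum.cong) (auto simp: b_def power_divide power2_eq_square)
  finally show "?s \<le> sqrt ?t * sqrt ?s" .
qed

end

end

subsection \<open>The coefficients of a Schur-Agler function\<close>

text \<open>\<open>Hm_fun (wsingle 0 v)\<close> is the constant function \<open>v\<close>. Its image
  lies in a space of power series, so the coefficients of \<open>\<Phi>\<close> are obtained vector
  by vector, without expanding an operator-valued holomorphic function.\<close>

definition mult_coeff :: "(complex ^ 'n::finite \<Rightarrow> 'a::complex_hilbert \<Rightarrow> 'b::complex_hilbert) \<Rightarrow>
    ('n \<Rightarrow> nat) \<Rightarrow> 'a \<Rightarrow> 'b" where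
  "mult_coeff \<Phi> \<beta> v = coeffs (mult_op \<Phi> (Hm_fun (wsingle 0 v))) \<beta>"

lemma Hm_fun_wsingle:
  assumes "z \<in> ball 0 1"
  shows "Hm_fun (wsingle 0 v) z = v"
proof -
  have "((\<lambda>\<alpha>. zpow z \<alpha> *\<^sub>C wsingle 0 v \<alpha>) has_sum v) UNIV"
    by (rule has_sum_finite_neutralI[of "{0}"]) (auto simp: wsingle_def)
  then show ?thesis
    using assms by (simp add: Hm_fun_def infsumI)
qed

lemma norm_wseq_wsingle: "norm (wseq m (wsingle 0 v)) = norm v"
proof -
  have "(norm (wseq m (wsingle 0 v)))\<^sup>2 = (norm v)\<^sup>2"
    unfolding norm_sq_eq_cinner cinner_wsingle[OF wsummable_wsingle] by (simp add: wsingle_def)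
  then show ?thesis by simp
qed

lemma norm_proj_le:
  assumes V: "closed_csubspace V"
  shows "norm (proj V x) \<le> norm x"
proof (rule power2_le_imp_le)
  have "cinner (x - proj V x) (proj V x) = 0"
    using proj_in[OF V] proj_orth[OF V] unfolding orth_def by blast
  then have "(norm ((x - proj V x) + proj V x))\<^sup>2 = (norm (x - proj V x))\<^sup>2 + (norm (proj V x))\<^sup>2"
    unfolding norm_add_sq by simp
  then show "(norm (proj V x))\<^sup>2 \<le> (norm x)\<^sup>2" by simp
qed simp

lemma bounded_op_proj:
  assumes V: "closed_csubspace V"
  shows "bounded_op UNIV V (proj V)"
  using norm_proj_le[OF V] proj_in[OF V]
  by (auto simp: bounded_op_def clinear_on_def proj_add[OF V] proj_scaleC[OF V] intro!: exI[of _ 1])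

lemma proj_id:
  assumes V: "closed_csubspace V" and "x \<in> V"
  shows "proj V x = x"
  using assms by (intro proj_eq) (auto simp: orth_def)

text \<open>Composing with the projection onto \<open>V\<close> gives a bounded operator on the
  whole type, through which sums may be taken; on \<open>V\<close> nothing changes.\<close>

lemma has_sum_bounded_op:
  assumes V: "closed_csubspace V" and F: "bounded_op V W F"
    and s: "(f has_sum s) A" and f: "\<And>i. i \<in> A \<Longrightarrow> f i \<in> V"
  shows "s \<in> V" "((\<lambda>i. F (f i)) has_sum F s) A"
proof -
  have "((\<lambda>i. proj V (f i)) has_sum proj V s) A"
    by (rule has_sum_bounded_linear[OF bounded_op_bounded_linear[OF bounded_op_proj[OF V]] s])
  moreover have "((\<lambda>i. proj V (f i)) has_sum s) A"
    using s by (rule has_sum_cong[THEN iffD1, rotated]) (simp add: f proj_id[OF V])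
  ultimately have "s = proj V s"
    using has_sum_unique by blast
  then show sV: "s \<in> V"
    using proj_in[OF V] by metis
  have "((\<lambda>i. F (proj V (f i))) has_sum F (proj V s)) A"
    by (rule has_sum_bounded_linear[OF bounded_op_bounded_linear[OF
        bounded_op_comp[OF bounded_op_proj[OF V] F]] s])
  then show "((\<lambda>i. F (f i)) has_sum F s) A"
    using has_sum_cong[of A "\<lambda>i. F (proj V (f i))" "\<lambda>i. F (f i)"] by (simp add: f sV proj_id[OF V])
qed

context
  fixes V :: "'a::complex_hilbert set" and W :: "'b::complex_hilbert set"
    and \<Phi> :: "complex ^ 'n::finite \<Rightarrow> 'a \<Rightarrow> 'b"
  assumes V: "closed_csubspace V" and SA: "schur_agler V W \<Phi>"
begin

lemma schur_agler_bounded: "z \<in> ball 0 1 \<Longrightarrow> bounded_op V W (\<Phi> z)"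
  using SA by (simp add: schur_agler_def op_holomorphic_def)

lemma mult_coeff:
  assumes v: "v \<in> V"
  shows mult_coeff_wsummable: "wsummable 1 (\<lambda>\<beta>. mult_coeff \<Phi> \<beta> v)"
    and mult_coeff_in: "mult_coeff \<Phi> \<beta> v \<in> W"
    and norm_wseq_mult_coeff: "norm (wseq 1 (\<lambda>\<beta>. mult_coeff \<Phi> \<beta> v)) \<le> norm v"
    and mult_coeff_has_power_series: "has_power_series (\<lambda>z. \<Phi> z v) (\<lambda>\<beta>. mult_coeff \<Phi> \<beta> v)"
proof -
  let ?f = "Hm_fun (wsingle 0 v) :: complex ^ 'n \<Rightarrow> 'a"
  have "?f \<in> Hm 1 V"
    by (intro Hm_fun_in wsingle_in V v) simp
  then have f: "mult_op \<Phi> ?f \<in> Hm 1 W" "Hm_norm 1 (mult_op \<Phi> ?f) \<le> Hm_norm 1 ?f"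
    using SA by (auto simp: schur_agler_def)
  have c: "coeffs (mult_op \<Phi> ?f) = (\<lambda>\<beta>. mult_coeff \<Phi> \<beta> v)"
    by (simp add: fun_eq_iff mult_coeff_def)
  show ws: "wsummable 1 (\<lambda>\<beta>. mult_coeff \<Phi> \<beta> v)" and "mult_coeff \<Phi> \<beta> v \<in> W"
    using Hm_coeffs_in[OF f(1)] unfolding c by (auto simp: wspace_def)
  have "Hm_norm 1 (mult_op \<Phi> ?f) = norm (wseq 1 (\<lambda>\<beta>. mult_coeff \<Phi> \<beta> v))"
    using Hm_norm_Hm_fun[OF _ ws] Hm_fun_coeffs[OF f(1)] unfolding c by simp
  then show "norm (wseq 1 (\<lambda>\<beta>. mult_coeff \<Phi> \<beta> v)) \<le> norm v"
    using f(2) by (simp add: Hm_norm_Hm_fun norm_wseq_wsingle)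
  have "has_power_series (mult_op \<Phi> ?f) (\<lambda>\<beta>. mult_coeff \<Phi> \<beta> v)"
    using Hm_power_series[OF f(1)] unfolding c .
  then show "has_power_series (\<lambda>z. \<Phi> z v) (\<lambda>\<beta>. mult_coeff \<Phi> \<beta> v)"
    unfolding has_power_series_def by (simp add: mult_op_def Hm_fun_wsingle)
qed

text \<open>Linearity follows from that of each \<open>\<Phi> z\<close> by uniqueness of power
  series. The bound compares one coefficient with the whole squared norm at weight 1.\<close>

lemma bounded_op_mult_coeff: "bounded_op V W (mult_coeff \<Phi> \<beta>)"
proof -
  have add: "(\<lambda>\<beta>. mult_coeff \<Phi> \<beta> (u + v)) = (\<lambda>\<beta>. mult_coeff \<Phi> \<beta> u + mult_coeff \<Phi> \<beta> v)"
    if "u \<in> V" "v \<in> V" for u v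
  proof (rule has_power_series_unique[OF mult_coeff_has_power_series])
    show "has_power_series (\<lambda>z. \<Phi> z (u + v)) (\<lambda>\<beta>. mult_coeff \<Phi> \<beta> u + mult_coeff \<Phi> \<beta> v)"
      unfolding has_power_series_def
    proof
      fix z :: "complex ^ 'n" assume z: "z \<in> ball 0 1"
      have "((\<lambda>\<beta>. zpow z \<beta> *\<^sub>C mult_coeff \<Phi> \<beta> u + zpow z \<beta> *\<^sub>C mult_coeff \<Phi> \<beta> v)
          has_sum (\<Phi> z u + \<Phi> z v)) UNIV"
        using mult_coeff_has_power_series that z
            by (intro has_sum_add) (auto simp: has_power_series_def)
      then show "((\<lambda>\<beta>. zpow z \<beta> *\<^sub>C (mult_coeff \<Phi> \<beta> u + mult_coeff \<Phi> \<beta> v)) has_sum \<Phi> z (u + v)) UNIV"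
        by (simp add: scaleC_add_right clinear_on_add[OF
            bounded_op_linear[OF schur_agler_bounded[OF z]] that])
    qed
  qed (use that csubspace_add[OF V] in auto)
  have scale: "(\<lambda>\<beta>. mult_coeff \<Phi> \<beta> (c *\<^sub>C v)) = (\<lambda>\<beta>. c *\<^sub>C mult_coeff \<Phi> \<beta> v)"
    if "v \<in> V" for c v
  proof (rule has_power_series_unique[OF mult_coeff_has_power_series])
    show "has_power_series (\<lambda>z. \<Phi> z (c *\<^sub>C v)) (\<lambda>\<beta>. c *\<^sub>C mult_coeff \<Phi> \<beta> v)"
      unfolding has_power_series_def
    proof
      fix z :: "complex ^ 'n" assume z: "z \<in> ball 0 1"
      have "((\<lambda>\<beta>. zpow z \<beta> *\<^sub>C mult_coeff \<Phi> \<beta> v) has_sum \<Phi> z v) UNIV"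
        using mult_coeff_has_power_series[OF that] z by (simp add: has_power_series_def)
      from has_sum_bounded_linear[OF bounded_linear_scaleC_right[of c] this]
      show "((\<lambda>\<beta>. zpow z \<beta> *\<^sub>C (c *\<^sub>C mult_coeff \<Phi> \<beta> v)) has_sum \<Phi> z (c *\<^sub>C v)) UNIV"
        by (simp add: scaleC_scaleC mult.commute
            clinear_on_scaleC[OF bounded_op_linear[OF schur_agler_bounded[OF z]] that])
    qed
  qed (use that csubspace_scaleC[OF V] in auto)
  have "norm (mult_coeff \<Phi> \<beta> v) \<le> sqrt (rho 1 \<beta>) * norm v" if v: "v \<in> V" for v
  proof (rule power2_le_imp_le)
    have "(norm (mult_coeff \<Phi> \<beta> v))\<^sup>2 / rho 1 \<beta> \<le> (norm (wseq 1 (\<lambda>\<beta>. mult_coeff \<Phi> \<beta> v)))\<^sup>2"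
      using sum_norm_le_wseq[OF mult_coeff_wsummable[OF v], of "{\<beta>}"] by simp
    also have "\<dots> \<le> (norm v)\<^sup>2"
      by (intro power_mono norm_wseq_mult_coeff[OF v]) simp
    finally show "(norm (mult_coeff \<Phi> \<beta> v))\<^sup>2 \<le> (sqrt (rho 1 \<beta>) * norm v)\<^sup>2"
      by (simp add: power_mult_distrib divide_le_eq mult.commute)
  qed simp
  then show ?thesis
    using add scale mult_coeff_in unfolding bounded_op_def clinear_on_def
    by (auto simp: fun_eq_iff)
qed

text \<open>A Cauchy product over pairs of multi-indices. The input is controlled at weight
  \<open>m\<close> and the coefficients of \<open>\<Phi>\<close> at weight 1; both give absolute
  convergence on the ball.\<close>

lemma mult_op_power_series:
  assumes m: "1 \<le> m" and a: "a \<in> wspace m V"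
  shows "has_power_series (mult_op \<Phi> (Hm_fun a)) (conv_coeffs (mult_coeff \<Phi>) a)"
  unfolding has_power_series_def
proof
  fix z :: "complex ^ 'n" assume z: "z \<in> ball 0 1"
  have aV: "a \<alpha> \<in> V" for \<alpha>
    using a by (auto simp: wspace_def)
  have ws: "wsummable m a"
    using a by (auto simp: wspace_def)
  define F where "F = (\<lambda>(\<alpha>, \<beta>). zpow z (\<alpha> + \<beta>) *\<^sub>C mult_coeff \<Phi> \<beta> (a \<alpha>))"
  define C where "C = sqrt ((1 / (1 - (norm z)\<^sup>2)) ^ 1)"
  have norm_F: "norm (F (\<alpha>, \<beta>)) = cmod (zpow z \<alpha>) * norm (zpow z \<beta> *\<^sub>C mult_coeff \<Phi> \<beta> (a \<alpha>))" for \<alpha> \<beta>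
    by (simp add: F_def zpow_add norm_scaleC norm_mult)
  have abs1: "(\<lambda>\<beta>. zpow z \<beta> *\<^sub>C mult_coeff \<Phi> \<beta> (a \<alpha>)) abs_summable_on UNIV" for \<alpha>
    by (rule wsummable_abs_summable[OF _ mult_coeff_wsummable[OF aV] z]) simp
  have "C \<ge> 0"
    using z by (simp add: C_def abs_square_le_1)
  \<comment> \<open>\<open>\<Phi>\<close> applied to a constant does not increase the norm at weight
    1, so the inner sum is bounded by the norm of \<open>a \<alpha>\<close> with a factor
    independent of \<open>\<alpha>\<close>.\<close>
  have inner_le: "(\<Sum>\<^sub>\<infinity>\<beta>. norm (F (\<alpha>, \<beta>))) \<le> C * norm (zpow z \<alpha> *\<^sub>C a \<alpha>)" for \<alpha>
  proof -
    have "(\<Sum>\<^sub>\<infinity>\<beta>. norm (F (\<alpha>, \<beta>))) = cmod (zpow z \<alpha>) * (\<Sum>\<^sub>\<infinity>\<beta>. norm (zpow z \<beta> *\<^sub>C mult_coeff \<Phi> \<beta> (a \<alpha>)))"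
      unfolding norm_F by (rule infsum_cmult_right) (use abs1 in auto)
    also have "\<dots> \<le> cmod (zpow z \<alpha>) * (C * norm (wseq 1 (\<lambda>\<beta>. mult_coeff \<Phi> \<beta> (a \<alpha>))))"
      unfolding C_def by (intro mult_left_mono sum_zpow_norm_le mult_coeff_wsummable aV z) auto
    also have "\<dots> \<le> cmod (zpow z \<alpha>) * (C * norm (a \<alpha>))"
      using \<open>C \<ge> 0\<close> by (intro mult_left_mono norm_wseq_mult_coeff aV) auto
    finally show ?thesis
      by (simp add: norm_scaleC mult_ac)
  qed
  have "(\<lambda>p. norm (F p)) summable_on UNIV \<times> UNIV"
  proof (rule Infinite_Sum.abs_summable_on_Sigma_iff[THEN iffD2], intro conjI ballI)
    show "(\<lambda>\<beta>. norm (F (\<alpha>, \<beta>))) summable_on UNIV" for \<alpha>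
      unfolding norm_F by (intro summable_on_cmult_right abs1)
    have "(\<lambda>\<alpha>. \<Sum>\<^sub>\<infinity>\<beta>. norm (F (\<alpha>, \<beta>))) summable_on UNIV"
    proof (rule summable_on_comparison_test)
      show "(\<lambda>\<alpha>. C * norm (zpow z \<alpha> *\<^sub>C a \<alpha>)) summable_on UNIV"
        by (intro summable_on_cmult_right wsummable_abs_summable[OF m ws z])
    qed (use inner_le in \<open>auto intro: infsum_nonneg\<close>)
    then show "(\<lambda>\<alpha>. norm (\<Sum>\<^sub>\<infinity>\<beta>. norm (F (\<alpha>, \<beta>)))) summable_on UNIV"
      by (simp add: infsum_nonneg)
  qed
  then have F_sum: "F summable_on UNIV \<times> UNIV"
    by (rule abs_summable_summable)
  have inner: "((\<lambda>\<beta>. F (\<alpha>, \<beta>)) has_sum (zpow z \<alpha> *\<^sub>C \<Phi> z (a \<alpha>))) UNIV" for \<alpha>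
  proof -
    have "((\<lambda>\<beta>. zpow z \<beta> *\<^sub>C mult_coeff \<Phi> \<beta> (a \<alpha>)) has_sum \<Phi> z (a \<alpha>)) UNIV"
      using mult_coeff_has_power_series[OF aV] z by (simp add: has_power_series_def)
    from has_sum_bounded_linear[OF bounded_linear_scaleC_right[of "zpow z \<alpha>"] this]
    show ?thesis by (simp add: F_def zpow_add scaleC_scaleC)
  qed
  have f_sum: "((\<lambda>\<alpha>. zpow z \<alpha> *\<^sub>C a \<alpha>) has_sum Hm_fun a z) UNIV"
    using has_power_series_Hm_fun[OF m ws] z by (simp add: has_power_series_def)
  have "((\<lambda>\<alpha>. \<Phi> z (zpow z \<alpha> *\<^sub>C a \<alpha>)) has_sum \<Phi> z (Hm_fun a z)) UNIV"
    by (rule has_sum_bounded_op(2)[OF V schur_agler_bounded[OF z] f_sum])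
        (simp add: csubspace_scaleC[OF V aV])
  then have outer: "((\<lambda>\<alpha>. zpow z \<alpha> *\<^sub>C \<Phi> z (a \<alpha>)) has_sum \<Phi> z (Hm_fun a z)) UNIV"
    by (simp add: clinear_on_scaleC[OF bounded_op_linear[OF schur_agler_bounded[OF z]] aV])
  have "(F has_sum \<Phi> z (Hm_fun a z)) (UNIV \<times> UNIV)"
    by (rule has_sum_SigmaI[OF inner outer F_sum])
  \<comment> \<open>Regrouping by the total index \<open>\<gamma> = \<alpha> + \<beta>\<close> is
    legitimate for an unconditional sum, and the fibres are finite.\<close>
  then have "((\<lambda>(\<gamma>, \<alpha>). F (\<alpha>, \<gamma> - \<alpha>)) has_sum \<Phi> z (Hm_fun a z)) (SIGMA \<gamma>:UNIV. {..\<gamma>})"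
    by (rule has_sum_reindex_bij_witness[where j = "\<lambda>(\<alpha>, \<beta>). (\<alpha> + \<beta>, \<alpha>)"
          and i = "\<lambda>(\<gamma>, \<alpha>). (\<alpha>, \<gamma> - \<alpha>)", THEN iffD1, rotated -1])
      (auto simp: index_add_diff)
  then have "((\<lambda>\<gamma>. \<Sum>\<alpha>\<le>\<gamma>. F (\<alpha>, \<gamma> - \<alpha>)) has_sum \<Phi> z (Hm_fun a z)) UNIV"
    by (rule has_sum_SigmaD) (auto intro: has_sum_finiteI)
  moreover have "(\<Sum>\<alpha>\<le>\<gamma>. F (\<alpha>, \<gamma> - \<alpha>)) = zpow z \<gamma> *\<^sub>C conv_coeffs (mult_coeff \<Phi>) a \<gamma>" for \<gamma>
    unfolding conv_coeffs_def scaleC_sum_right F_def by (rule sum.cong) (auto simp: index_add_diff)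
  ultimately show "((\<lambda>\<gamma>. zpow z \<gamma> *\<^sub>C conv_coeffs (mult_coeff \<Phi>) a \<gamma>) has_sum mult_op \<Phi> (Hm_fun a) z)
      UNIV"
    using z by (simp add: mult_op_def)
qed

lemma mult_coeff_contractive_1:
  assumes a: "\<And>\<alpha>. a \<alpha> \<in> V" and fin: "finite {\<alpha>. a \<alpha> \<noteq> 0}"
  shows "(\<Sum>\<gamma> | deg \<gamma> \<le> N. (norm (conv_coeffs (mult_coeff \<Phi>) a \<gamma>))\<^sup>2 / rho 1 \<gamma>)
    \<le> (\<Sum>\<alpha> | a \<alpha> \<noteq> 0. (norm (a \<alpha>))\<^sup>2 / rho 1 \<alpha>)"
proof -
  let ?c = "conv_coeffs (mult_coeff \<Phi>) a"
  have ws: "wsummable 1 a"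
    by (rule wsummable_finite_support[OF fin]) simp
  then have aw: "a \<in> wspace 1 V"
    using a by (auto simp: wspace_def)
  then have "Hm_fun a \<in> Hm 1 V"
    by (intro Hm_fun_in) auto
  then have f: "mult_op \<Phi> (Hm_fun a) \<in> Hm 1 W" "Hm_norm 1 (mult_op \<Phi> (Hm_fun a))
      \<le> Hm_norm 1 (Hm_fun a)"
    using SA by (auto simp: schur_agler_def)
  have c: "coeffs (mult_op \<Phi> (Hm_fun a)) = ?c"
    by (rule coeffs_eq[OF mult_op_power_series[OF _ aw]]) simp
  have wc: "wsummable 1 ?c"
    using Hm_coeffs_in[OF f(1)] unfolding c by (simp add: wspace_def)
  have "norm (wseq 1 ?c) \<le> norm (wseq 1 a)"
    using f(2) Hm_norm_Hm_fun[OF _ wc] Hm_norm_Hm_fun[OF _ ws] Hm_fun_coeffs[OF f(1)] unfolding c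
        by simp
  then have "(norm (wseq 1 ?c))\<^sup>2 \<le> (norm (wseq 1 a))\<^sup>2"
    by (intro power_mono) auto
  moreover have "((\<lambda>\<alpha>. (norm (a \<alpha>))\<^sup>2 / rho 1 \<alpha>) has_sum (\<Sum>\<alpha> | a \<alpha> \<noteq> 0. (norm (a \<alpha>))\<^sup>2 / rho 1 \<alpha>))
      UNIV"
    by (rule has_sum_finite_neutralI[OF fin]) auto
  ultimately show ?thesis
    using sum_norm_le_wseq[OF wc, of "{\<gamma>. deg \<gamma> \<le> N}"] has_sum_unique[OF has_sum_norm_wseq[OF ws]]
        by fastforce
qed

lemma mult_coeff_contractive:
  assumes m: "1 \<le> m" and a: "a \<in> wspace m V"
  shows "wsummable m (conv_coeffs (mult_coeff \<Phi>) a)"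
    "norm (wseq m (conv_coeffs (mult_coeff \<Phi>) a)) \<le> norm (wseq m a)"
proof -
  let ?c = "conv_coeffs (mult_coeff \<Phi>) a"
  have b\<phi>: "bounded_op V UNIV (mult_coeff \<Phi> \<beta>)" for \<beta>
    by (rule bounded_op_mono[OF bounded_op_mult_coeff]) auto
  have aV: "a \<alpha> \<in> V" for \<alpha>
    using a by (auto simp: wspace_def)
  have ws: "wsummable m a"
    using a by (auto simp: wspace_def)
  have le: "(\<Sum>\<gamma> | deg \<gamma> \<le> N. (norm (?c \<gamma>))\<^sup>2 / rho m \<gamma>) \<le> (norm (wseq m a))\<^sup>2" for N
    using conv_coeffs_contractive[OF V b\<phi> mult_coeff_contractive_1 m aV]
      sum_norm_le_wseq[OF ws, of "{\<alpha>. deg \<alpha> \<le> N}"] by (rule order_trans) auto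
  then show wc: "wsummable m ?c"
    unfolding wsummable_def by (intro summable_on_deg_bounded(1)) auto
  show "norm (wseq m ?c) \<le> norm (wseq m a)"
    by (rule norm_wseq_leI[OF wc _ le]) simp
qed

text \<open>Evaluates the definite description in \<open>mult_op_adj\<close>: existence comes from
  the adjoint on coefficient families, uniqueness from testing against the monomials
  \<open>wsingle \<alpha> v\<close>.\<close>

lemma mult_op_adj_exists:
  fixes b :: "('n \<Rightarrow> nat) \<Rightarrow> 'b"
  assumes m: "1 \<le> m" and b: "wsummable m b"
  shows "\<exists>x\<in>wspace m V. mult_op_adj m V \<Phi> (Hm_fun b) = Hm_fun x \<and> norm (wseq m x) \<le> norm (wseq m b)
      \<and>
    (\<forall>a\<in>wspace m V. cinner (wseq m (conv_coeffs (mult_coeff \<Phi>) a)) (wseq m b)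
        = cinner (wseq m a) (wseq m x))"
proof -
  let ?L = "conv_coeffs (mult_coeff \<Phi>)"
  note lin = bounded_op_linear[OF bounded_op_mult_coeff]
  have "\<exists>x\<in>(wspace m V :: (('n \<Rightarrow> nat) \<Rightarrow> 'a) set).
    (\<forall>a\<in>wspace m V. cinner (wseq m (?L a)) (wseq m b) = cinner (wseq m a) (wseq m x))
      \<and> norm (wseq m x) \<le> norm (wseq m b)"
  proof (rule wspace_adjoint_exists[OF V])
    fix a a' :: "('n \<Rightarrow> nat) \<Rightarrow> 'a" and c
    assume a: "a \<in> wspace m V"
    show "wsummable m (?L a)" "norm (wseq m (?L a)) \<le> norm (wseq m a)"
      by (rule mult_coeff_contractive[OF m a])+
    have aV: "a \<alpha> \<in> V" for \<alpha>
      using a by (auto simp: wspace_def)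
    show "?L (\<lambda>\<alpha>. c *\<^sub>C a \<alpha>) = (\<lambda>\<alpha>. c *\<^sub>C ?L a \<alpha>)"
      unfolding conv_coeffs_def scaleC_sum_right by (simp add: clinear_on_scaleC[OF lin aV])
    assume a': "a' \<in> wspace m V"
    then have "a' \<alpha> \<in> V" for \<alpha>
      by (auto simp: wspace_def)
    then show "?L (\<lambda>\<alpha>. a \<alpha> + a' \<alpha>) = (\<lambda>\<alpha>. ?L a \<alpha> + ?L a' \<alpha>)"
      unfolding conv_coeffs_def by (simp add: clinear_on_add[OF lin] aV sum.distrib)
  qed
  then obtain x :: "('n \<Rightarrow> nat) \<Rightarrow> 'a" where x: "x \<in> wspace m V" "norm (wseq m x) \<le> norm (wseq m b)"
    and adj: "\<And>a. a \<in> wspace m V \<Longrightarrow> cinner (wseq m (?L a)) (wseq m b) = cinner (wseq m a) (wseq m x)"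
    by blast
  have xs: "wsummable m x"
    using x by (simp add: wspace_def)
  have mo: "mult_op \<Phi> (Hm_fun a) = Hm_fun (?L a)" if a: "a \<in> wspace m V" for a
  proof
    fix z
    show "mult_op \<Phi> (Hm_fun a) z = Hm_fun (?L a) z"
    proof (cases "z \<in> ball 0 1")
      case True
      then show ?thesis
        using mult_op_power_series[OF m a] has_power_series_Hm_fun[OF m
            mult_coeff_contractive(1)[OF m a]]
        unfolding has_power_series_def using has_sum_unique by blast
    qed (simp add: mult_op_def Hm_fun_def)
  qed
  have inner: "Hm_inner m (mult_op \<Phi> (Hm_fun a)) (Hm_fun b) = cinner (wseq m (?L a)) (wseq m b)"
    if a: "a \<in> wspace m V" for a
    using mo[OF a] Hm_inner_Hm_fun[OF m mult_coeff_contractive(1)[OF m a] b] by simp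
  have "mult_op_adj m V \<Phi> (Hm_fun b) = Hm_fun x"
    unfolding mult_op_adj_def adjoint_wrt_def
  proof (rule the_equality)
    show "Hm_fun x \<in> Hm m V \<and>
        (\<forall>v\<in>Hm m V. Hm_inner m (mult_op \<Phi> v) (Hm_fun b) = Hm_inner m v (Hm_fun x))"
    proof (intro conjI ballI Hm_fun_in m x)
      fix v :: "complex ^ 'n \<Rightarrow> 'a" assume "v \<in> Hm m V"
      then obtain a where a: "a \<in> wspace m V" "v = Hm_fun a"
        using Hm_iff[OF m] by blast
      have "wsummable m a"
        using a by (simp add: wspace_def)
      from Hm_inner_Hm_fun[OF m this xs]
      show "Hm_inner m (mult_op \<Phi> v) (Hm_fun b) = Hm_inner m v (Hm_fun x)"
        by (simp only: a(2) inner[OF a(1)] adj[OF a(1)])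
    qed
  next
    fix g assume g: "g \<in> Hm m V \<and> (\<forall>v\<in>Hm m V. Hm_inner m (mult_op \<Phi> v) (Hm_fun b) = Hm_inner m v g)"
    then obtain y where y: "y \<in> wspace m V" "g = Hm_fun y"
      using Hm_iff[OF m] by blast
    have ys: "wsummable m y"
      using y by (simp add: wspace_def)
    have "y \<alpha> = x \<alpha>" for \<alpha>
    proof -
      have eq: "cinner v (y \<alpha>) = cinner v (x \<alpha>)" if v: "v \<in> V" for v
      proof -
        have s: "wsingle \<alpha> v \<in> wspace m V"
          by (rule wsingle_in[OF V v])
        have "Hm_inner m (mult_op \<Phi> (Hm_fun (wsingle \<alpha> v))) (Hm_fun b)
            = Hm_inner m (Hm_fun (wsingle \<alpha> v)) g"
          using g Hm_fun_in[OF m s] by blast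
        then have "cinner (wseq m (wsingle \<alpha> v)) (wseq m x)
            = cinner (wseq m (wsingle \<alpha> v)) (wseq m y)"
          using Hm_inner_Hm_fun[OF m wsummable_wsingle ys]
              by (simp only: y(2) inner[OF s] adj[OF s])
        then show ?thesis
          by (simp add: cinner_wsingle xs ys)
      qed
      have "y \<alpha> - x \<alpha> \<in> V"
        using x y csubspace_diff[OF V] by (auto simp: wspace_def image_subset_iff)
      from eq[OF this] have "cinner (y \<alpha> - x \<alpha>) (y \<alpha> - x \<alpha>) = 0"
        by (simp add: cinner_diff_right)
      then show ?thesis by simp
    qed
    then show "g = Hm_fun x"
      using y(2) by presburger
  qed
  then show ?thesis
    using x adj by blast
qed

text \<open>The series for \<open>x\<^sub>\<alpha>\<close> does not involve \<open>m\<close>.\<close>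

lemma mult_op_adj_coeffs:
  fixes b :: "('n \<Rightarrow> nat) \<Rightarrow> 'b"
  assumes m: "1 \<le> m" and b: "wsummable m (\<lambda>\<gamma>. rho m \<gamma> *\<^sub>R b \<gamma>)"
  obtains x where "(\<lambda>\<alpha>. rho m \<alpha> *\<^sub>R x \<alpha>) \<in> wspace m V"
    "mult_op_adj m V \<Phi> (Hm_fun (\<lambda>\<gamma>. rho m \<gamma> *\<^sub>R b \<gamma>)) = Hm_fun (\<lambda>\<alpha>. rho m \<alpha> *\<^sub>R x \<alpha>)"
    "norm (wseq m (\<lambda>\<alpha>. rho m \<alpha> *\<^sub>R x \<alpha>)) \<le> norm (wseq m (\<lambda>\<gamma>. rho m \<gamma> *\<^sub>R b \<gamma>))"
    "\<And>\<alpha>. x \<alpha> \<in> V"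
    "\<And>\<alpha> v. v \<in> V \<Longrightarrow> ((\<lambda>\<beta>. cinner (mult_coeff \<Phi> \<beta> v) (b (\<alpha> + \<beta>))) has_sum cinner v (x \<alpha>)) UNIV"
proof -
  obtain y where y: "y \<in> wspace m V" "mult_op_adj m V \<Phi> (Hm_fun (\<lambda>\<gamma>. rho m \<gamma> *\<^sub>R b \<gamma>)) = Hm_fun y"
    "norm (wseq m y) \<le> norm (wseq m (\<lambda>\<gamma>. rho m \<gamma> *\<^sub>R b \<gamma>))"
    and adj: "\<And>a. a \<in> wspace m V \<Longrightarrow>
      cinner (wseq m (conv_coeffs (mult_coeff \<Phi>) a)) (wseq m (\<lambda>\<gamma>. rho m \<gamma> *\<^sub>R b \<gamma>))
          = cinner (wseq m a) (wseq m y)"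
    using mult_op_adj_exists[OF m b] by blast
  define x where "x \<alpha> = (1 / rho m \<alpha>) *\<^sub>R y \<alpha>" for \<alpha>
  have rx: "(\<lambda>\<alpha>. rho m \<alpha> *\<^sub>R x \<alpha>) = y"
    by (simp add: x_def)
  have "((\<lambda>\<beta>. cinner (mult_coeff \<Phi> \<beta> v) (b (\<alpha> + \<beta>))) has_sum cinner v (x \<alpha>)) UNIV"
      if v: "v \<in> V" for \<alpha> v
  proof -
    let ?c = "conv_coeffs (mult_coeff \<Phi>) (wsingle \<alpha> v)"
    have s: "wsingle \<alpha> v \<in> wspace m V"
      by (rule wsingle_in[OF V v])
    have zero: "mult_coeff \<Phi> \<beta> 0 = 0" for \<beta>
      by (rule clinear_on_zero[OF bounded_op_linear[OF bounded_op_mult_coeff] v])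
    \<comment> \<open>Multiplying \<open>\<Phi>\<close> by a monomial only shifts its coefficients,
      so pairing with it isolates the single coefficient \<open>x \<alpha>\<close>.\<close>
    have c: "?c \<gamma> = (if \<alpha> \<le> \<gamma> then mult_coeff \<Phi> (\<gamma> - \<alpha>) v else 0)" for \<gamma>
    proof -
      have "?c \<gamma> = (\<Sum>\<beta>\<le>\<gamma>. if \<beta> = \<alpha> then mult_coeff \<Phi> (\<gamma> - \<alpha>) v else 0)"
        unfolding conv_coeffs_def wsingle_def by (rule sum.cong) (auto simp: zero)
      then show ?thesis by (simp add: sum.delta)
    qed
    have "((\<lambda>\<gamma>. cinner (?c \<gamma>) (rho m \<gamma> *\<^sub>R b \<gamma>) / complex_of_real (rho m \<gamma>)) has_sum
        cinner (wseq m (wsingle \<alpha> v)) (wseq m y)) UNIV"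
      using has_sum_cinner_wseq[OF mult_coeff_contractive(1)[OF m s] b] by (simp only: adj[OF s])
    moreover have "cinner (wseq m (wsingle \<alpha> v)) (wseq m y) = cinner v (x \<alpha>)"
      using y by (simp add: cinner_wsingle wspace_def x_def cinner_scaleR_right)
    ultimately have "((\<lambda>\<gamma>. cinner (?c \<gamma>) (b \<gamma>)) has_sum cinner v (x \<alpha>)) UNIV"
      by (simp add: cinner_scaleR_right)
    then have "((\<lambda>\<gamma>. cinner (mult_coeff \<Phi> (\<gamma> - \<alpha>) v) (b \<gamma>)) has_sum cinner v (x \<alpha>)) {\<gamma>. \<alpha> \<le> \<gamma>}"
      by (rule has_sum_cong_neutral[THEN iffD1, rotated -1]) (auto simp: c)
    then show ?thesis
      by (rule has_sum_reindex_bij_witness[where i = "\<lambda>\<beta>. \<alpha> + \<beta>" and j = "\<lambda>\<gamma>. \<gamma> - \<alpha>", THEN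
          iffD1, rotated -1])
        (auto simp: index_add_diff)
  qed
  moreover have "x \<alpha> \<in> V" for \<alpha>
    using y(1) csubspace_scaleR[OF V] by (auto simp: x_def wspace_def image_subset_iff)
  ultimately show ?thesis
    using that[of x] y unfolding rx by blast
qed

end

section \<open>Hypercontractions and their canonical dilations\<close>

lemma funpow_commute_funpow:
  assumes "\<And>h. f (g h) = g (f h)"
  shows "(f ^^ a) ((g ^^ b) h) = (g ^^ b) ((f ^^ a) h)"
proof -
  have 1: "f ((g ^^ b) h) = (g ^^ b) (f h)" for h
    by (induction b) (auto simp: assms)
  show ?thesis
    by (induction a) (auto simp: 1)
qed

context
  fixes A :: "'n::finite \<Rightarrow> 'h \<Rightarrow> 'h"
  assumes comm: "\<And>i j h. A i (A j h) = A j (A i h)"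
begin

lemma op_pow_fold_commute: "comp_fun_commute_on UNIV (\<lambda>i F. (A i ^^ \<alpha> i) \<circ> F)"
proof
  fix i j
  have "(A i ^^ \<alpha> i) ((A j ^^ \<alpha> j) h) = (A j ^^ \<alpha> j) ((A i ^^ \<alpha> i) h)" for h
    by (rule funpow_commute_funpow) (rule comm)
  then show "(\<circ>) (A j ^^ \<alpha> j) \<circ> (\<circ>) (A i ^^ \<alpha> i) = (\<circ>) (A i ^^ \<alpha> i) \<circ> (\<circ>) (A j ^^ \<alpha> j)"
    by (auto simp: fun_eq_iff)
qed

text \<open>Exposes the products over subsets \<open>I\<close> of the coordinates, on which
  induction is possible, while \<open>op_pow\<close> itself ranges over all coordinates.\<close>

lemma op_pow_fold:
  obtains G where "op_pow A = (\<lambda>\<alpha>. G \<alpha> UNIV)" "\<And>\<alpha> h. G \<alpha> {} h = h"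
    "\<And>\<alpha> i I h. i \<notin> I \<Longrightarrow> G \<alpha> (insert i I) h = (A i ^^ \<alpha> i) (G \<alpha> I h)"
proof
  define G where "G \<alpha> I = Finite_Set.fold (\<lambda>i F. (A i ^^ \<alpha> i) \<circ> F) id I" for \<alpha> I
  show "op_pow A = (\<lambda>\<alpha>. G \<alpha> UNIV)"
    by (simp add: fun_eq_iff op_pow_def G_def)
  show "G \<alpha> {} h = h" for \<alpha> h
    by (simp add: G_def)
  show "G \<alpha> (insert i I) h = (A i ^^ \<alpha> i) (G \<alpha> I h)" if "i \<notin> I" for \<alpha> i I h
    unfolding G_def comp_fun_commute_on.fold_insert[OF op_pow_fold_commute subset_UNIV finite that]
        comp_apply ..
qed

lemma op_pow_0: "op_pow A 0 h = h"
proof -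
  obtain G where G: "op_pow A = (\<lambda>\<alpha>. G \<alpha> UNIV)" "\<And>\<alpha> h. G \<alpha> {} h = h"
    "\<And>\<alpha> i I h. i \<notin> I \<Longrightarrow> G \<alpha> (insert i I) h = (A i ^^ \<alpha> i) (G \<alpha> I h)"
    using op_pow_fold by metis
  have "G 0 I h = h" for I
    by (induction I rule: finite_induct[OF finite]) (auto simp: G)
  then show ?thesis by (simp only: G)
qed

lemma op_pow_add_unit_index: "op_pow A (\<alpha> + unit_index i) h = A i (op_pow A \<alpha> h)"
proof -
  obtain G where G: "op_pow A = (\<lambda>\<alpha>. G \<alpha> UNIV)" "\<And>\<alpha> h. G \<alpha> {} h = h"
    "\<And>\<alpha> i I h. i \<notin> I \<Longrightarrow> G \<alpha> (insert i I) h = (A i ^^ \<alpha> i) (G \<alpha> I h)"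
    using op_pow_fold by metis
  have "G (\<alpha> + unit_index i) I h = (if i \<in> I then A i (G \<alpha> I h) else G \<alpha> I h)" for I
  proof (induction I rule: finite_induct[OF finite])
    case (2 j I)
    have "A i ((A j ^^ k) x) = (A j ^^ k) (A i x)" for k x
      using funpow_commute_funpow[of "A i" "A j" 1 k x] comm[of i j] by (simp add: One_nat_def)
    moreover have "(A i ^^ (k + 1)) x = (A i ^^ k) (A i x)" for k x
      by (simp add: funpow_add One_nat_def funpow_swap1)
    ultimately show ?case
      using 2 by (auto simp: G)
  qed (simp add: G)
  from this[of UNIV] show ?thesis
    by (simp add: G)
qed

lemma op_pow_unit_index_comm: "A i (op_pow A \<alpha> h) = op_pow A \<alpha> (A i h)"
proof (induction "deg \<alpha>" arbitrary: \<alpha>)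
  case 0
  then have "\<alpha> = 0" by simp
  then show ?case by (simp only: op_pow_0 add_0)
next
  case (Suc d)
  then obtain j where j: "0 < \<alpha> j"
    by (metis deg_eq_0_iff ext gr0I nat.simps(3) zero_fun_apply)
  define \<beta> where "\<beta> = \<alpha> - unit_index j"
  have \<alpha>: "\<alpha> = \<beta> + unit_index j"
    using unit_index_diff_add[of \<alpha> j, OF j] by (simp add: \<beta>_def)
  have "A i (op_pow A \<beta> h) = op_pow A \<beta> (A i h)"
    using Suc(1)[of \<beta>] Suc(2) by (simp add: \<alpha>)
  then show ?case
    by (simp add: \<alpha> op_pow_add_unit_index comm[of i j])
qed

lemma op_pow_add: "op_pow A (\<alpha> + \<beta>) h = op_pow A \<alpha> (op_pow A \<beta> h)"
proof (induction "deg \<alpha>" arbitrary: \<alpha>)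
  case 0
  then have "\<alpha> = 0" by simp
  then show ?case by (simp only: op_pow_0 add_0)
next
  case (Suc d)
  then obtain j where j: "0 < \<alpha> j"
    by (metis deg_eq_0_iff ext gr0I nat.simps(3) zero_fun_apply)
  define \<gamma> where "\<gamma> = \<alpha> - unit_index j"
  have \<alpha>: "\<alpha> = \<gamma> + unit_index j"
    using unit_index_diff_add[of \<alpha> j, OF j] by (simp add: \<gamma>_def)
  have "op_pow A (\<gamma> + \<beta>) h = op_pow A \<gamma> (op_pow A \<beta> h)"
    using Suc(1)[of \<gamma>] Suc(2) by (simp add: \<alpha>)
  moreover have "\<alpha> + \<beta> = (\<gamma> + \<beta>) + unit_index j"
    by (simp add: \<alpha> add_ac)
  ultimately show ?case
    by (simp add: \<alpha> op_pow_add_unit_index)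
qed

end

lemma op_pow_intertwine:
  fixes A :: "'n::finite \<Rightarrow> 'h \<Rightarrow> 'h" and B :: "'n \<Rightarrow> 'k \<Rightarrow> 'k"
  assumes A: "\<And>i j h. A i (A j h) = A j (A i h)" and B: "\<And>i j h. B i (B j h) = B j (B i h)"
    and Y: "\<And>i h. Y (A i h) = B i (Y h)"
  shows "Y (op_pow A \<alpha> h) = op_pow B \<alpha> (Y h)"
proof (induction "deg \<alpha>" arbitrary: \<alpha>)
  case 0
  then have "\<alpha> = 0" by simp
  then show ?case by (simp only: op_pow_0[of A, OF A] op_pow_0[of B, OF B])
next
  case (Suc d)
  then obtain j where j: "0 < \<alpha> j"
    by (metis deg_eq_0_iff ext gr0I nat.simps(3) zero_fun_apply)
  define \<gamma> where "\<gamma> = \<alpha> - unit_index j"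
  have \<alpha>: "\<alpha> = \<gamma> + unit_index j"
    using unit_index_diff_add[of \<alpha> j, OF j] by (simp add: \<gamma>_def)
  have "Y (op_pow A \<gamma> h) = op_pow B \<gamma> (Y h)"
    using Suc(1)[of \<gamma>] Suc(2) by (simp add: \<alpha>)
  then show ?case
    by (simp add: \<alpha> op_pow_add_unit_index[of A, OF A] op_pow_add_unit_index[of B, OF B] Y)
qed

section \<open>Quadratic forms and iterates of the completely positive map\<close>

definition qform :: "('h::complex_hilbert \<Rightarrow> 'h) \<Rightarrow> 'h \<Rightarrow> real" where
  "qform Y h = Re (cinner (Y h) h)"

definition adj_pow :: "('n::finite \<Rightarrow> 'h::complex_hilbert \<Rightarrow> 'h) \<Rightarrow> ('n \<Rightarrow> nat) \<Rightarrow> 'h \<Rightarrow> 'h" where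
  "adj_pow T = op_pow (\<lambda>i. adj (T i))"

text \<open>The quadratic form of \<open>\<sigma>\<^sub>T\<^sup>j(Y)\<close>.\<close>

definition sigma_form ::
    "('n::finite \<Rightarrow> 'h::complex_hilbert \<Rightarrow> 'h) \<Rightarrow> nat \<Rightarrow> ('h \<Rightarrow> 'h) \<Rightarrow> 'h \<Rightarrow> real" where
  "sigma_form T j Y h = (\<Sum>\<alpha> | deg \<alpha> = j. rho 1 \<alpha> * qform Y (adj_pow T \<alpha> h))"

definition defect_iter :: "('n::finite \<Rightarrow> 'h::complex_hilbert \<Rightarrow> 'h) \<Rightarrow> nat \<Rightarrow> 'h \<Rightarrow> 'h" where
  "defect_iter T p = (one_minus_sigma T ^^ p) id"

lemma defect_iter_0: "defect_iter T 0 = id"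
  and defect_iter_Suc: "defect_iter T (Suc p) = one_minus_sigma T (defect_iter T p)"
  by (auto simp: defect_iter_def)

locale commuting_tuple =
  fixes T :: "'n::finite \<Rightarrow> 'h::complex_hilbert \<Rightarrow> 'h"
  assumes bounded: "\<And>i. bounded_op UNIV UNIV (T i)"
    and commute: "\<And>i j h. T i (T j h) = T j (T i h)"
begin

lemma adj_commute: "adj (T i) (adj (T j) h) = adj (T j) (adj (T i) h)"
  using adj_comp[OF bounded bounded, of i j h] adj_comp[OF bounded bounded, of j i h]
  by (simp add: commute[of i j])

lemmas adj_pow_0 = op_pow_0[of "\<lambda>i. adj (T i)", OF adj_commute, folded adj_pow_def]
lemmas adj_pow_add_unit_index =
  op_pow_add_unit_index[of "\<lambda>i. adj (T i)", OF adj_commute, folded adj_pow_def]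
lemmas adj_pow_comm = op_pow_unit_index_comm[of "\<lambda>i. adj (T i)", OF adj_commute, folded adj_pow_def]
lemmas adj_pow_add = op_pow_add[of "\<lambda>i. adj (T i)", OF adj_commute, folded adj_pow_def]

lemma bounded_adj: "bounded_op UNIV UNIV (adj (T i))"
  by (rule bounded_op_adjoint_on[OF csubspace_UNIV bounded])

lemma bounded_one_minus_sigma:
  assumes "bounded_op UNIV UNIV Y"
  shows "bounded_op UNIV UNIV (one_minus_sigma T Y)"
  unfolding one_minus_sigma_def sigma_op_def
  by (intro bounded_op_diff bounded_op_sum assms csubspace_UNIV
      bounded_op_comp[OF bounded_op_comp[OF bounded_adj assms] bounded])

lemma bounded_defect_iter: "bounded_op UNIV UNIV (defect_iter T p)"
proof (induction p)
  case 0
  then show ?case using bounded_op_id[of UNIV] by (simp add: defect_iter_0 id_def)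
qed (simp add: defect_iter_Suc bounded_one_minus_sigma)

lemma qform_sigma_op: "qform (sigma_op T Y) h = (\<Sum>i\<in>UNIV. qform Y (adj (T i) h))"
  by (simp add: qform_def sigma_op_def cinner_sum_left cinner_adj[OF bounded])

lemma qform_one_minus_sigma: "qform (one_minus_sigma T Y) h = qform Y h
    - (\<Sum>i\<in>UNIV. qform Y (adj (T i) h))"
  by (simp add: qform_sigma_op[symmetric]) (simp add: qform_def one_minus_sigma_def
      cinner_diff_left)

lemma sigma_form_0: "sigma_form T 0 Y h = qform Y h"
  unfolding sigma_form_def deg_eq_0 by (simp only: sum.insert finite.emptyI empty_iff sum.empty
      not_False_eq_True rho_0 adj_pow_0 mult_1 add_0_right)

lemma sigma_form_Suc:
  "sigma_form T (Suc j) Y h = (\<Sum>\<alpha> | deg \<alpha> = j. rho 1 \<alpha>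
      * (\<Sum>i\<in>UNIV. qform Y (adj (T i) (adj_pow T \<alpha> h))))"
  unfolding sigma_form_def sum_rho_1_Suc adj_pow_add_unit_index ..

lemma sigma_form_Suc': "sigma_form T (Suc j) Y h = (\<Sum>i\<in>UNIV. sigma_form T j Y (adj (T i) h))"
  unfolding sigma_form_Suc unfolding sigma_form_def adj_pow_comm sum_distrib_left by (rule sum.swap)

lemma qform_sigma_op_pow: "qform ((sigma_op T ^^ j) Y) h = sigma_form T j Y h"
proof (induction j arbitrary: h)
  case (Suc j)
  then show ?case by (simp add: qform_sigma_op sigma_form_Suc')
qed (simp add: sigma_form_0)

text \<open>By linearity \<open>\<sigma>^j(Y - \<sigma>(Y)) = \<sigma>^j(Y) -
  \<sigma>^(j+1)(Y)\<close>; all telescoping in \<open>j\<close> rests on this.\<close>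

lemma sigma_form_one_minus_sigma:
  "sigma_form T j (one_minus_sigma T Y) h = sigma_form T j Y h - sigma_form T (Suc j) Y h"
  unfolding sigma_form_Suc
  by (simp add: sigma_form_def qform_one_minus_sigma right_diff_distrib sum_subtractf)

end

section \<open>Pure hypercontractions\<close>

locale pure_hypercontraction = commuting_tuple T
  for T :: "'n::finite \<Rightarrow> 'h::complex_hilbert \<Rightarrow> 'h" +
  fixes m :: nat
  assumes m: "1 \<le> m" and pos: "positive_op (defect_iter T m)" and pure: "pure_tuple T"
begin

text \<open>For \<open>p = 0\<close> this is purity; each further factor \<open>1 - \<sigma>\<close>
  produces a difference of two consecutive null sequences.\<close>

lemma sigma_form_tendsto_0: "(\<lambda>j. sigma_form T j (defect_iter T p) h) \<longlonglongrightarrow> 0"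
proof (induction p)
  case 0
  have "(\<lambda>j. qform ((sigma_op T ^^ j) id) h) \<longlonglongrightarrow> Re (cinner 0 h)"
    unfolding qform_def
    by (intro tendsto_intros tendsto_cinner) (use pure in \<open>simp add: pure_tuple_def\<close>)
  then show ?case
    by (simp only: qform_sigma_op_pow defect_iter_0 cinner_zero_left zero_complex.simps)
next
  case (Suc p)
  show ?case
    using tendsto_diff[OF Suc LIMSEQ_Suc[OF Suc]]
        by (simp add: defect_iter_Suc sigma_form_one_minus_sigma)
qed

text \<open>Telescoping inverts \<open>1 - \<sigma>\<close>: summing the iterates of
  \<open>\<sigma>\<close> on the form of order \<open>p + 1\<close> returns the form of order
  \<open>p\<close>, the remainder vanishing by purity.\<close>

lemma sigma_form_sums: "(\<lambda>j. sigma_form T j (defect_iter T (Suc p)) h) sums qform (defect_iter T p)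
    h"
proof -
  let ?s = "\<lambda>j. sigma_form T j (defect_iter T p) h"
  have "(\<lambda>j. ?s j - ?s (Suc j)) sums (?s 0 - 0)"
    by (rule telescope_sums'[OF sigma_form_tendsto_0])
  then show ?thesis
    by (simp add: defect_iter_Suc sigma_form_one_minus_sigma sigma_form_0)
qed

text \<open>Downward induction from the order \<open>m\<close>: the form of order \<open>p\<close>
  is a sum of values of the form of order \<open>p + 1\<close> with nonnegative weights.\<close>

lemma qform_defect_iter_nonneg:
  assumes "p \<le> m"
  shows "0 \<le> qform (defect_iter T p) h"
  using assms
proof (induction p arbitrary: h rule: inc_induct)
  case base
  then show ?case using positive_op_Re[OF pos] by (simp add: qform_def)
next
  case (step p)
  have "0 \<le> sigma_form T j (defect_iter T (Suc p)) h" for j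
    unfolding sigma_form_def by (intro sum_nonneg mult_nonneg_nonneg step) auto
  then show ?case
    using sums_le[OF _ sums_zero sigma_form_sums] by blast
qed

lemma sum_qform_le:
  assumes "Suc p \<le> m"
  shows "(\<Sum>\<alpha> | deg \<alpha> \<le> N. rho 1 \<alpha> * qform (defect_iter T (Suc p)) (adj_pow T \<alpha> h))
      \<le> qform (defect_iter T p) h"
proof -
  let ?s = "\<lambda>j. sigma_form T j (defect_iter T (Suc p)) h"
  have nn: "0 \<le> ?s j" for j
    unfolding sigma_form_def by (intro sum_nonneg mult_nonneg_nonneg qform_defect_iter_nonneg assms)
        auto
  have "(\<Sum>j\<le>N. ?s j) \<le> (\<Sum>j. ?s j)"
    by (rule sum_le_suminf[OF sums_summable[OF sigma_form_sums]]) (use nn in auto)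
  then show ?thesis
    using sums_unique[OF sigma_form_sums[of p h]] by (simp add: sum_deg_le sigma_form_def)
qed

abbreviation "D \<equiv> defect_op m T"

lemma defect_op_positive: "positive_op D"
  unfolding defect_op_def defect_iter_def[symmetric] by (rule sqrt_op_positive[OF pos])

lemma bounded_defect_op: "bounded_op UNIV UNIV D"
  by (rule positive_op_bounded[OF defect_op_positive])

lemma csubspace_defect_space: "closed_csubspace (defect_space m T)"
  unfolding defect_space_def by (rule csubspace_closure_range[OF bounded_defect_op])

lemma defect_op_in: "D h \<in> defect_space m T"
  unfolding defect_space_def using closure_subset[of "range D"] by auto

lemma norm_defect_op: "(norm (D h))\<^sup>2 = qform (defect_iter T m) h"
  unfolding defect_op_def qform_def defect_iter_def[symmetric] by (rule norm_sqrt_op[OF pos])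

text \<open>Each application of \<open>sum_qform_le\<close> raises the weight by one through the
  convolution and lowers the order of the form. At \<open>p = m\<close> the bound is the squared
  norm of \<open>h\<close>, which places the dilation in the space of weight
  \<open>m\<close>.\<close>

lemma sum_norm_defect_le:
  assumes "1 \<le> p" "p \<le> m"
  shows "(\<Sum>\<alpha> | deg \<alpha> \<le> N. rho p \<alpha> * (norm (D (adj_pow T \<alpha> h)))\<^sup>2) \<le> qform (defect_iter T (m - p)) h"
  using assms
proof (induction p arbitrary: h N rule: nat_induct_at_least)
  case base
  then show ?case
    using sum_qform_le[of "m - 1" h N] m by (simp add: norm_defect_op)
next
  case (Suc p)
  have "(\<Sum>\<gamma> | deg \<gamma> \<le> N. rho (Suc p) \<gamma> * (norm (D (adj_pow T \<gamma> h)))\<^sup>2)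
      = (\<Sum>\<delta> | deg \<delta> \<le> N. rho 1 \<delta> *
          (\<Sum>\<beta> | deg \<beta> \<le> N - deg \<delta>. rho p \<beta> * (norm (D (adj_pow T \<beta> (adj_pow T \<delta> h))))\<^sup>2))"
  proof -
    have "adj_pow T (\<delta> + \<beta>) h = adj_pow T \<beta> (adj_pow T \<delta> h)" for \<delta> \<beta>
      unfolding adj_pow_add[symmetric] by (simp only: add.commute)
    then show ?thesis
      unfolding sum_rho_Suc(2)[OF Suc(1)] by simp
  qed
  also have "\<dots> \<le> (\<Sum>\<delta> | deg \<delta> \<le> N. rho 1 \<delta> * qform (defect_iter T (m - p)) (adj_pow T \<delta> h))"
    using Suc by (intro sum_mono mult_left_mono) auto
  also have "\<dots> \<le> qform (defect_iter T (m - Suc p)) h"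
  proof -
    have "m - p = Suc (m - Suc p)"
      using Suc by simp
    then show ?thesis
      using sum_qform_le[of "m - Suc p" h N] m by (simp)
  qed
  finally show ?case .
qed

text \<open>At weight 1 the bound is attained: the partial sums by degree are those of the
  telescoping series for the form of order \<open>m - 1\<close>.\<close>

lemma has_sum_norm_defect:
  "((\<lambda>\<alpha>. rho 1 \<alpha> * (norm (D (adj_pow T \<alpha> h)))\<^sup>2) has_sum qform (defect_iter T (m - 1)) h) UNIV"
proof -
  let ?f = "\<lambda>\<alpha>. rho 1 \<alpha> * (norm (D (adj_pow T \<alpha> h)))\<^sup>2"
  have "?f summable_on UNIV"
    using sum_norm_defect_le[OF order_refl m] by (intro summable_on_deg_bounded(1)) auto
  then have "(?f has_sum infsum ?f UNIV) UNIV"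
    by simp
  moreover have "(\<lambda>N. \<Sum>\<alpha> | deg \<alpha> \<le> N. ?f \<alpha>) \<longlonglongrightarrow> qform (defect_iter T (m - 1)) h"
    using sigma_form_sums[of "m - 1" h] m
    by (simp add: sum_deg_le sigma_form_def norm_defect_op sums_def_le)
  ultimately show ?thesis
    using LIMSEQ_unique[OF has_sum_deg_tendsto] by fastforce
qed

definition dil_coeffs :: "'h \<Rightarrow> ('n \<Rightarrow> nat) \<Rightarrow> 'h" where
  "dil_coeffs h \<alpha> = D (adj_pow T \<alpha> h)"

lemma norm_weighted_sq: "(norm (rho p \<alpha> *\<^sub>R x))\<^sup>2 / rho p \<alpha> = rho p \<alpha> * (norm x)\<^sup>2"
  by (simp add: power_mult_distrib power2_eq_square)

lemma dil_coeffs_wsummable: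
  assumes "1 \<le> p" "p \<le> m"
  shows "wsummable p (\<lambda>\<alpha>. rho p \<alpha> *\<^sub>R dil_coeffs h \<alpha>)"
  unfolding wsummable_def norm_weighted_sq dil_coeffs_def
  using sum_norm_defect_le[OF assms] by (intro summable_on_deg_bounded(1)) auto

lemma canonical_dilation_eq: "canonical_dilation m T h = Hm_fun (\<lambda>\<alpha>. rho m \<alpha> *\<^sub>R dil_coeffs h \<alpha>)"
  by (simp add: canonical_dilation_def Hm_fun_def dil_coeffs_def adj_pow_def)

end

lemma pure_hypercontractionI:
  assumes "1 \<le> m" "hypercontraction m T" "pure_tuple T"
  shows "pure_hypercontraction T m"
proof
  show "bounded_op UNIV UNIV (T i)" for i
    using assms(2) by (simp add: hypercontraction_def contraction_def)
  show "T i (T j h) = T j (T i h)" for i j h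
  proof -
    have "T i \<circ> T j = T j \<circ> T i"
      using assms(2) by (simp add: hypercontraction_def)
    then show ?thesis by (metis comp_apply)
  qed
qed (use assms in \<open>auto simp: hypercontraction_def defect_iter_def\<close>)

section \<open>Two hypercontractions and an intertwining operator\<close>

locale intertwined_hypercontractions =
  T: pure_hypercontraction T m + S: pure_hypercontraction S m
  for T :: "'n::finite \<Rightarrow> 'h::complex_hilbert \<Rightarrow> 'h" and S :: "'n \<Rightarrow> 'k::complex_hilbert \<Rightarrow> 'k"
      and m :: nat +
  fixes X :: "'h \<Rightarrow> 'k"
  assumes X: "bounded_op UNIV UNIV X" and intertwine: "\<And>i h. X (T i h) = S i (X h)"
begin

lemma adj_intertwine: "adj X (adj (S i) k) = adj (T i) (adj X k)"
  using adj_comp[OF S.bounded X, of i k] adj_comp[OF X T.bounded, of i k] by (simp add: intertwine)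

lemma adj_pow_intertwine: "adj X (adj_pow S \<alpha> k) = adj_pow T \<alpha> (adj X k)"
  unfolding adj_pow_def
  by (rule op_pow_intertwine) (auto simp: S.adj_commute T.adj_commute adj_intertwine)

abbreviation P :: "'k \<Rightarrow> 'k" where
  "P \<equiv> (one_minus_sigma S ^^ (m - 1)) (\<lambda>k. k - X (adj X k))"

text \<open>Intertwining moves \<open>X\<close> outside: \<open>\<sigma>_S\<close> applied to
  \<open>X G X^*\<close> is \<open>X \<sigma>_T(G) X^*\<close>, so the powers act separately on the
  two summands.\<close>

lemma one_minus_sigma_pow:
  "(one_minus_sigma S ^^ p) (\<lambda>k. k - X (adj X k)) = (\<lambda>k. defect_iter S p k
      - X (defect_iter T p (adj X k)))"
proof (induction p)
  case (Suc p)
  have "one_minus_sigma S (\<lambda>k. F k - X (G (adj X k))) k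
      = one_minus_sigma S F k - X (one_minus_sigma T G (adj X k))" for F G k
  proof -
    have "sigma_op S (\<lambda>k. F k - X (G (adj X k))) k = sigma_op S F k - X (sigma_op T G (adj X k))"
      by (simp add: sigma_op_def bounded_op_UNIV_diff[OF S.bounded] bounded_op_UNIV_sum[OF X]
          sum_subtractf
          intertwine adj_intertwine)
    then show ?thesis
      by (simp add: one_minus_sigma_def bounded_op_UNIV_diff[OF X] algebra_simps)
  qed
  then show ?case
    by (simp add: Suc defect_iter_Suc)
qed (simp add: defect_iter_0)

lemma bounded_P: "bounded_op UNIV UNIV P"
  unfolding one_minus_sigma_pow
  by (intro bounded_op_diff csubspace_UNIV S.bounded_defect_iter
      bounded_op_comp[OF bounded_op_comp[OF bounded_op_adjoint_on[OF csubspace_UNIV X]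
          T.bounded_defect_iter] X])

lemma qform_P: "qform P k = qform (defect_iter S (m - 1)) k
    - qform (defect_iter T (m - 1)) (adj X k)"
  unfolding one_minus_sigma_pow by (simp add: qform_def cinner_diff_left cinner_adj[OF X])

lemma qform_P_step:
  "qform P k - (\<Sum>i\<in>UNIV. qform P (adj (S i) k)) = qform (defect_iter S m) k
      - qform (defect_iter T m) (adj X k)"
proof -
  have "Suc (m - 1) = m"
    using T.m by simp
  then have "defect_iter S m = one_minus_sigma S (defect_iter S (m - 1))"
    "defect_iter T m = one_minus_sigma T (defect_iter T (m - 1))"
    by (metis defect_iter_Suc)+
  then show ?thesis
    by (simp add: qform_P sum_subtractf adj_intertwine S.qform_one_minus_sigma
        T.qform_one_minus_sigma)
qed

lemma sigma_form_P_tendsto_0: "(\<lambda>j. sigma_form S j P k) \<longlonglongrightarrow> 0"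
proof -
  have "sigma_form S j P k = sigma_form S j (defect_iter S (m - 1)) k
      - sigma_form T j (defect_iter T (m - 1)) (adj X k)" for j
    by (simp add: sigma_form_def qform_P adj_pow_intertwine right_diff_distrib sum_subtractf)
  then show ?thesis
    using tendsto_diff[OF S.sigma_form_tendsto_0[of "m - 1" k] T.sigma_form_tendsto_0[of "m - 1"
        "adj X k"]] by simp
qed

text \<open>Reality of a form survives \<open>one_minus_sigma\<close>, because each summand of
  \<open>\<sigma>\<close> at \<open>k\<close> is the old form evaluated at the image of
  \<open>k\<close> under an adjoint of the tuple.\<close>

lemma P_real: "Im (cinner (P k) k) = 0"
proof -
  have "Im (cinner (defect_iter S p k) k) = 0" for p k
  proof (induction p arbitrary: k)
    case (Suc p)
    then show ?case
      by (simp add: defect_iter_Suc one_minus_sigma_def sigma_op_def cinner_diff_left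
          cinner_sum_left cinner_adj[OF S.bounded])
  qed (simp add: cinner_self defect_iter_0)
  moreover have "Im (cinner (defect_iter T p k) k) = 0" for p k
  proof (induction p arbitrary: k)
    case (Suc p)
    then show ?case
      by (simp add: defect_iter_Suc one_minus_sigma_def sigma_op_def cinner_diff_left
          cinner_sum_left cinner_adj[OF T.bounded])
  qed (simp add: cinner_self defect_iter_0)
  ultimately show ?thesis
    unfolding one_minus_sigma_pow by (simp add: cinner_diff_left cinner_adj[OF X])
qed

text \<open>
  The relation \<open>\<pi>\<^sub>T X\<^sup>* = M\<^sub>\<Phi>\<^sup>* \<pi>\<^sub>S\<close> has the same coefficient form for all weights. For the weight
  \<open>\<rho>\<^sub>1\<close> it exhibits \<open>X Q\<^sub>T X\<^sup>* \<le> Q\<^sub>S\<close>, where \<open>Q = (1 - \<sigma>)\<^sup>m\<^sup>-\<^sup>1(I)\<close>, as contractivity of \<open>M\<^sub>\<Phi>\<^sup>*\<close>.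
\<close>

lemma positive_if_multiplier:
  assumes SA: "schur_agler (defect_space m T) (defect_space m S) \<Phi>"
    and eq: "canonical_dilation m T \<circ> adj X
        = mult_op_adj m (defect_space m T) \<Phi> \<circ> canonical_dilation m S"
  shows "positive_op P"
proof -
  note V = T.csubspace_defect_space
  have "0 \<le> qform P k" for k
  proof -
    obtain x where x: "(\<lambda>\<alpha>. rho m \<alpha> *\<^sub>R x \<alpha>) \<in> wspace m (defect_space m T)"
      "mult_op_adj m (defect_space m T) \<Phi> (Hm_fun (\<lambda>\<gamma>. rho m \<gamma> *\<^sub>R S.dil_coeffs k \<gamma>))
          = Hm_fun (\<lambda>\<alpha>. rho m \<alpha> *\<^sub>R x \<alpha>)"
      "norm (wseq m (\<lambda>\<alpha>. rho m \<alpha> *\<^sub>R x \<alpha>)) \<le> norm (wseq m (\<lambda>\<gamma>. rho m \<gamma> *\<^sub>R S.dil_coeffs k \<gamma>))"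
      "\<And>\<alpha>. x \<alpha> \<in> defect_space m T"
      "\<And>\<alpha> v. v \<in> defect_space m T \<Longrightarrow>
        ((\<lambda>\<beta>. cinner (mult_coeff \<Phi> \<beta> v) (S.dil_coeffs k (\<alpha> + \<beta>))) has_sum cinner v (x \<alpha>)) UNIV"
      by (rule mult_op_adj_coeffs[OF V SA T.m S.dil_coeffs_wsummable[OF T.m order_refl, of k]])
        (rule that; assumption)
    have "Hm_fun (\<lambda>\<alpha>. rho m \<alpha> *\<^sub>R T.dil_coeffs (adj X k) \<alpha>) = Hm_fun (\<lambda>\<alpha>. rho m \<alpha> *\<^sub>R x \<alpha>)"
      using fun_cong[OF eq, of k] x(2) by (simp add: T.canonical_dilation_eq
          S.canonical_dilation_eq)
    then have "coeffs (Hm_fun (\<lambda>\<alpha>. rho m \<alpha> *\<^sub>R T.dil_coeffs (adj X k) \<alpha>))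
        = coeffs (Hm_fun (\<lambda>\<alpha>. rho m \<alpha> *\<^sub>R x \<alpha>))"
      by simp
    moreover have "wsummable m (\<lambda>\<alpha>. rho m \<alpha> *\<^sub>R x \<alpha>)"
      using x(1) by (simp add: wspace_def)
    ultimately have "(\<lambda>\<alpha>. rho m \<alpha> *\<^sub>R T.dil_coeffs (adj X k) \<alpha>) = (\<lambda>\<alpha>. rho m \<alpha> *\<^sub>R x \<alpha>)"
      by (simp only: coeffs_Hm_fun[OF T.m] T.dil_coeffs_wsummable[OF T.m order_refl])
    then have xT: "x \<alpha> = T.dil_coeffs (adj X k) \<alpha>" for \<alpha>
      by (auto simp: fun_eq_iff)
    \<comment> \<open>The adjoint at weight 1 is applied to the same unweighted coefficients. The
      series defining \<open>y\<close> coincides with that of \<open>x\<close>, so the norm bound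
      \<open>y(3)\<close> becomes a statement about the dilation coefficients of
      \<open>T\<close>.\<close>
    obtain y where y: "(\<lambda>\<alpha>. rho 1 \<alpha> *\<^sub>R y \<alpha>) \<in> wspace 1 (defect_space m T)"
      "mult_op_adj 1 (defect_space m T) \<Phi> (Hm_fun (\<lambda>\<gamma>. rho 1 \<gamma> *\<^sub>R S.dil_coeffs k \<gamma>))
          = Hm_fun (\<lambda>\<alpha>. rho 1 \<alpha> *\<^sub>R y \<alpha>)"
      "norm (wseq 1 (\<lambda>\<alpha>. rho 1 \<alpha> *\<^sub>R y \<alpha>)) \<le> norm (wseq 1 (\<lambda>\<gamma>. rho 1 \<gamma> *\<^sub>R S.dil_coeffs k \<gamma>))"
      "\<And>\<alpha>. y \<alpha> \<in> defect_space m T"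
      "\<And>\<alpha> v. v \<in> defect_space m T \<Longrightarrow>
        ((\<lambda>\<beta>. cinner (mult_coeff \<Phi> \<beta> v) (S.dil_coeffs k (\<alpha> + \<beta>))) has_sum cinner v (y \<alpha>)) UNIV"
      by (rule mult_op_adj_coeffs[OF V SA order_refl S.dil_coeffs_wsummable[OF order_refl T.m,
          of k]])
        (rule that; assumption)
    have "y \<alpha> = x \<alpha>" for \<alpha>
    proof -
      have "y \<alpha> - x \<alpha> \<in> defect_space m T"
        by (rule csubspace_diff[OF V y(4) x(4)])
      from has_sum_unique[OF y(5)[OF this] x(5)[OF this]]
      have "cinner (y \<alpha> - x \<alpha>) (y \<alpha> - x \<alpha>) = 0"
        by (simp add: cinner_diff_right)
      then show ?thesis by simp
    qed
    then have yT: "y = T.dil_coeffs (adj X k)"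
      by (auto simp: xT)
    have sq: "(norm (wseq 1 (\<lambda>\<alpha>. rho 1 \<alpha> *\<^sub>R T.dil_coeffs h \<alpha>)))\<^sup>2 = qform (defect_iter T (m - 1)) h"
        for h
      using has_sum_norm_wseq[OF T.dil_coeffs_wsummable[OF order_refl T.m]] T.has_sum_norm_defect
          has_sum_unique
      unfolding T.norm_weighted_sq T.dil_coeffs_def by blast
    have sq': "(norm (wseq 1 (\<lambda>\<alpha>. rho 1 \<alpha> *\<^sub>R S.dil_coeffs h \<alpha>)))\<^sup>2 = qform (defect_iter S (m - 1)) h"
        for h
      using has_sum_norm_wseq[OF S.dil_coeffs_wsummable[OF order_refl T.m]] S.has_sum_norm_defect
          has_sum_unique
      unfolding S.norm_weighted_sq S.dil_coeffs_def by blast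
    have "qform (defect_iter T (m - 1)) (adj X k) \<le> qform (defect_iter S (m - 1)) k"
      using power_mono[OF y(3) norm_ge_zero, of 2] unfolding yT sq sq' .
    then show ?thesis
      by (simp add: qform_P)
  qed
  then show ?thesis
    using bounded_P P_real by (simp add: positive_op_def qform_def)
qed

end

section \<open>Transfer functions of unitary colligations\<close>

lemma row_op_add: "row_op z (u + v) = row_op z u + row_op z v"
  and row_op_scaleC: "row_op z (c *\<^sub>C v) = c *\<^sub>C row_op z v"
  and row_op_diff_left: "row_op (z - w) v = row_op z v - row_op w v"
  by (simp_all add: row_op_def scaleC_add_right sum.distrib scaleC_sum_right scaleC_vec_def
      scaleC_scaleC
      mult.commute scaleC_diff_left sum_subtractf)

lemma norm_row_op_le: "norm (row_op z v) \<le> norm z * norm v"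
proof -
  have "norm (row_op z v) \<le> (\<Sum>i\<in>UNIV. \<bar>norm (z $ i)\<bar> * \<bar>norm (v $ i)\<bar>)"
    unfolding row_op_def by (rule order_trans[OF norm_sum]) (simp add: norm_scaleC)
  also have "\<dots> \<le> L2_set (\<lambda>i. norm (z $ i)) UNIV * L2_set (\<lambda>i. norm (v $ i)) UNIV"
    by (rule L2_set_mult_ineq)
  finally show ?thesis by (simp add: norm_vec_def)
qed

lemma row_op_in: "closed_csubspace R \<Longrightarrow> v \<in> vec_space R \<Longrightarrow> row_op z v \<in> R"
  unfolding row_op_def vec_space_def by (intro csubspace_sum csubspace_scaleC) auto

lemma bounded_op_row_op:
  assumes "closed_csubspace R"
  shows "bounded_op (vec_space R) R (row_op z)"
  using norm_row_op_le[of z] row_op_in[OF assms]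
  by (auto simp: bounded_op_def clinear_on_def row_op_add row_op_scaleC)

lemma bounded_op_row_op_UNIV: "bounded_op UNIV UNIV (row_op z)"
  using bounded_op_row_op[of UNIV z] by (simp add: vec_space_def)

text \<open>
  The bound controls each homogeneous part separately, so no summability of the coefficients
  themselves is needed.
\<close>

lemma homogeneous_bound_abs_summable:
  fixes y :: "('n::finite \<Rightarrow> nat) \<Rightarrow> 'a::complex_hilbert"
  assumes z: "z \<in> ball 0 1" and M: "0 \<le> M" "\<And>d. (\<Sum>\<alpha> | deg \<alpha> = d. (norm (y \<alpha>))\<^sup>2 / rho 1 \<alpha>) \<le> M\<^sup>2"
  shows "(\<lambda>\<alpha>. norm (zpow z \<alpha> *\<^sub>C y \<alpha>)) summable_on UNIV"
proof (rule summable_on_deg_bounded(1))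
  fix N
  have d: "(\<Sum>\<alpha> | deg \<alpha> = d. norm (zpow z \<alpha> *\<^sub>C y \<alpha>)) \<le> norm z ^ d * M" for d
  proof -
    let ?F = "{\<alpha> :: 'n \<Rightarrow> nat. deg \<alpha> = d}"
    have "(\<Sum>\<alpha>\<in>?F. norm (zpow z \<alpha> *\<^sub>C y \<alpha>))
        = (\<Sum>\<alpha>\<in>?F. \<bar>sqrt (rho 1 \<alpha>) * cmod (zpow z \<alpha>)\<bar> * \<bar>norm (y \<alpha>) / sqrt (rho 1 \<alpha>)\<bar>)"
      by (simp add: norm_scaleC abs_mult)
    also have "\<dots> \<le> L2_set (\<lambda>\<alpha>. sqrt (rho 1 \<alpha>) * cmod (zpow z \<alpha>)) ?F
        * L2_set (\<lambda>\<alpha>. norm (y \<alpha>) / sqrt (rho 1 \<alpha>)) ?F"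
      by (rule L2_set_mult_ineq)
    also have "L2_set (\<lambda>\<alpha>. sqrt (rho 1 \<alpha>) * cmod (zpow z \<alpha>)) ?F = norm z ^ d"
      using sum_rho_1_zpow[where d = d and z = z]
          by (simp add: L2_set_def power_mult_distrib power_even_eq)
    also have "L2_set (\<lambda>\<alpha>. norm (y \<alpha>) / sqrt (rho 1 \<alpha>)) ?F \<le> M"
      unfolding L2_set_def using M(2)[of d] M(1)
          by (intro real_le_lsqrt) (auto simp: power_divide sum_nonneg)
    finally show ?thesis by (simp add: mult_left_mono)
  qed
  have "(\<Sum>\<alpha> | deg \<alpha> \<le> N. norm (zpow z \<alpha> *\<^sub>C y \<alpha>)) \<le> (\<Sum>d\<le>N. norm z ^ d * M)"
    unfolding sum_deg_le by (rule sum_mono) (rule d)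
  also have "\<dots> \<le> (1 / (1 - norm z)) * M"
    unfolding sum_distrib_right[symmetric]
    using sum_le_suminf[OF summable_geometric[of "norm z"], of "{..N}"] z M(1)
    by (intro mult_right_mono) (auto simp: suminf_geometric)
  finally show "(\<Sum>\<alpha> | deg \<alpha> \<le> N. norm (zpow z \<alpha> *\<^sub>C y \<alpha>)) \<le> (1 / (1 - norm z)) * M" .
qed simp

text \<open>The blocks are those of \<open>U\<close>, whereas the transfer function is that of its
  adjoint: inputs come from \<open>W\<close>, outputs lie in \<open>V\<close>, and \<open>R\<close>
  is the state space.\<close>

locale unitary_colligation =
  fixes V :: "'a::complex_hilbert set" and W :: "'b::complex_hilbert set"
      and R :: "'r::complex_hilbert set"
    and A :: "'a \<Rightarrow> 'b" and B :: "'r ^ 'n::finite \<Rightarrow> 'b" and C :: "'a \<Rightarrow> 'r" and D :: "'r ^ 'n \<Rightarrow> 'r"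
  assumes V: "closed_csubspace V" and W: "closed_csubspace W" and R: "closed_csubspace R"
    and A: "bounded_op V W A" and B: "bounded_op (vec_space R) W B"
    and C: "bounded_op V R C" and D: "bounded_op (vec_space R) R D"
    and U: "unitary_op (V \<times> vec_space R) (W \<times> R) (block_op A B C D)"
begin

abbreviation "As \<equiv> adjoint_on V A"
abbreviation "Bs \<equiv> adjoint_on (vec_space R) B"
abbreviation "Cs \<equiv> adjoint_on V C"
abbreviation "Ds \<equiv> adjoint_on (vec_space R) D"

lemmas Rn = csubspace_vec_space[OF R]

lemma bounded_As: "bounded_op UNIV V As" and bounded_Bs: "bounded_op UNIV (vec_space R) Bs"
  and bounded_Cs: "bounded_op UNIV V Cs" and bounded_Ds: "bounded_op UNIV (vec_space R) Ds"
  by (rule bounded_op_adjoint_on[OF V A] bounded_op_adjoint_on[OF Rn B]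
      bounded_op_adjoint_on[OF V C] bounded_op_adjoint_on[OF Rn D])+

lemmas adj_in = bounded_op_in[OF bounded_As UNIV_I] bounded_op_in[OF bounded_Bs UNIV_I]
  bounded_op_in[OF bounded_Cs UNIV_I] bounded_op_in[OF bounded_Ds UNIV_I]

lemma cinner_block_op:
  assumes "s \<in> V" "t \<in> vec_space R"
  shows "cinner (block_op A B C D (s, t)) (x, r) = cinner (s, t) (As x + Cs r, Bs x + Ds r)"
  using assms
  by (simp add: block_op_def cinner_prod_def cinner_add_left cinner_add_right
      adjoint_on_cinner[OF V A] adjoint_on_cinner[OF V C] adjoint_on_cinner[OF Rn B]
          adjoint_on_cinner[OF Rn D])

text \<open>\<open>U\<close> is onto, so \<open>(x, r)\<close> has a preimage, and pairing with
  arbitrary vectors identifies it with the value of the block adjoint. Thus the adjoint is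
  isometric.\<close>

lemma norm_adjoint_block:
  assumes x: "x \<in> W" and r: "r \<in> R"
  shows "(norm (As x + Cs r))\<^sup>2 + (norm (Bs x + Ds r))\<^sup>2 = (norm x)\<^sup>2 + (norm r)\<^sup>2"
proof -
  let ?U = "block_op A B C D" and ?H = "V \<times> vec_space R"
  note H = csubspace_Times[OF V Rn]
  have "?U ` ?H = W \<times> R"
    using U by (simp add: unitary_op_def bij_betw_def)
  then have "(x, r) \<in> ?U ` ?H"
    using x r by simp
  then obtain q where q: "q \<in> ?H" "?U q = (x, r)"
    unfolding image_iff by auto
  define q' where "q' = (As x + Cs r, Bs x + Ds r)"
  have q': "q' \<in> ?H"
    by (auto simp: q'_def intro!: csubspace_add V Rn adj_in)
  have inn: "cinner p q' = cinner p q" if p: "p \<in> ?H" for p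
  proof -
    have "cinner p q' = cinner (?U p) (x, r)"
      using p cinner_block_op[of "fst p" "snd p" x r] by (auto simp: q'_def)
    also have "\<dots> = cinner p q"
      using U p q by (auto simp: unitary_op_def simp flip: q(2))
    finally show ?thesis .
  qed
  have "cinner (q' - q) (q' - q) = 0"
    using inn[OF csubspace_diff[OF H q' q(1)]] by (simp add: cinner_diff_right)
  then have "q' = q" by simp
  moreover have "norm (?U q) = norm q"
    using unitary_op_isometry[OF U] q(1) unfolding isometry_on_def by blast
  ultimately have "norm (x, r) = norm q'"
    by (simp only: q(2))
  then have "(norm (x, r))\<^sup>2 = (norm q')\<^sup>2" by simp
  then show ?thesis
    by (simp add: q'_def norm_prod_sq)
qed

lemma norm_Ds_le: "r \<in> R \<Longrightarrow> norm (Ds r) \<le> norm r"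
  and norm_Cs_le: "r \<in> R \<Longrightarrow> norm (Cs r) \<le> norm r"
  using norm_adjoint_block[OF csubspace_zero[OF W], of r]
  by (simp_all add: bounded_op_UNIV_zero[OF bounded_As] bounded_op_UNIV_zero[OF bounded_Bs])
    (metis le_add_same_cancel1 le_add_same_cancel2 power2_le_imp_le norm_ge_zero zero_le_power2)+

section \<open>Resolvent and holomorphy of the transfer function\<close>

definition resolv :: "complex ^ 'n \<Rightarrow> 'r \<Rightarrow> 'r" where
  "resolv z = inv_into R (\<lambda>r. r - row_op z (Ds r))"

lemma row_Ds_in: "row_op z (Ds r) \<in> R"
  by (intro row_op_in R adj_in)

lemma norm_row_Ds_le:
  assumes "r \<in> R"
  shows "norm (row_op z (Ds r)) \<le> norm z * norm r"
  using order_trans[OF norm_row_op_le mult_left_mono[OF norm_Ds_le[OF assms] norm_ge_zero]] .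

lemma row_Ds_diff: "row_op z (Ds (r - s)) = row_op z (Ds r) - row_op z (Ds s)"
  by (simp add: bounded_op_UNIV_diff[OF bounded_Ds] bounded_op_UNIV_diff[OF bounded_op_row_op_UNIV])

lemma norm_le_resolvent:
  assumes z: "z \<in> ball 0 1" and r: "r \<in> R"
  shows "norm r \<le> norm (r - row_op z (Ds r)) / (1 - norm z)"
proof -
  have "norm r \<le> norm (r - row_op z (Ds r)) + norm z * norm r"
    using norm_triangle_ineq[of "r - row_op z (Ds r)" "row_op z (Ds r)"] norm_row_Ds_le[OF r, of z]
        by simp
  then have "norm r * (1 - norm z) \<le> norm (r - row_op z (Ds r))"
    by (simp add: algebra_simps)
  then show ?thesis
    using z by (simp add: le_divide_eq)
qed

text \<open>For given \<open>s\<close> the map \<open>r \<mapsto> s + row_op z (Ds r)\<close>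
  contracts by the factor \<open>norm z < 1\<close>, so Banach's theorem yields a preimage.
  Injectivity is the lower bound \<open>norm_le_resolvent\<close>.\<close>

lemma bij_resolvent:
  assumes z: "z \<in> ball 0 1"
  shows "bij_betw (\<lambda>r. r - row_op z (Ds r)) R R"
proof -
  have "inj_on (\<lambda>r. r - row_op z (Ds r)) R"
  proof (rule inj_onI)
    fix r s assume rs: "r \<in> R" "s \<in> R" "r - row_op z (Ds r) = s - row_op z (Ds s)"
    have "(r - s) - row_op z (Ds (r - s)) = (r - row_op z (Ds r)) - (s - row_op z (Ds s))"
      unfolding row_Ds_diff by (simp add: algebra_simps)
    then have "(r - s) - row_op z (Ds (r - s)) = 0"
      using rs(3) by simp
    then have "norm (r - s) \<le> 0"
      using norm_le_resolvent[OF z csubspace_diff[OF R rs(1,2)]] by simp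
    then show "r = s" by simp
  qed
  moreover have "(\<lambda>r. r - row_op z (Ds r)) ` R = R"
  proof (intro equalityI image_subsetI subsetI)
    show "r - row_op z (Ds r) \<in> R" if "r \<in> R" for r
      by (intro csubspace_diff[OF R that row_Ds_in])
    fix s assume s: "s \<in> R"
    have "\<exists>!r\<in>R. s + row_op z (Ds r) = r"
    proof (rule Banach_fix[where c = "norm z"])
      show "complete R"
        by (rule complete_eq_closed[THEN iffD2, OF csubspace_closed[OF R]])
      show "R \<noteq> {}"
        using s by auto
      show "0 \<le> norm z" "norm z < 1"
        using z by auto
      show "(\<lambda>r. s + row_op z (Ds r)) ` R \<subseteq> R"
        using csubspace_add[OF R s row_Ds_in] by auto
      show "dist (s + row_op z (Ds x)) (s + row_op z (Ds y)) \<le> norm z * dist x y"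
        if "x \<in> R" "y \<in> R" for x y
        using norm_row_Ds_le[OF csubspace_diff[OF R that]]
            by (simp add: dist_norm flip: row_Ds_diff)
    qed
    then obtain r where "r \<in> R" "s + row_op z (Ds r) = r" by blast
    then show "s \<in> (\<lambda>r. r - row_op z (Ds r)) ` R"
      by (intro image_eqI[of _ _ r]) (auto simp: algebra_simps)
  qed
  ultimately show ?thesis
    by (simp add: bij_betw_def)
qed

context
  fixes z :: "complex ^ 'n"
  assumes z: "z \<in> ball 0 1"
begin

lemma resolv_eq: "r \<in> R \<Longrightarrow> r - row_op z (Ds r) = s \<Longrightarrow> resolv z s = r"
  unfolding resolv_def
  using inv_into_f_f[OF bij_betw_imp_inj_on[OF bij_resolvent[OF z]], of r] by simp

lemma resolv_in: "s \<in> R \<Longrightarrow> resolv z s \<in> R"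
  and resolv_fixpoint: "s \<in> R \<Longrightarrow> resolv z s - row_op z (Ds (resolv z s)) = s"
  using inv_into_into[of s "\<lambda>r. r - row_op z (Ds r)" R] f_inv_into_f[of s "\<lambda>r. r
      - row_op z (Ds r)" R]
    bij_betw_imp_surj_on[OF bij_resolvent[OF z]] by (simp_all add: resolv_def)

lemma norm_resolv_le: "s \<in> R \<Longrightarrow> norm (resolv z s) \<le> norm s / (1 - norm z)"
  using norm_le_resolvent[OF z resolv_in] resolv_fixpoint by simp

lemma bounded_op_resolv: "bounded_op R R (resolv z)"
proof -
  have "resolv z (s + t) = resolv z s + resolv z t" if "s \<in> R" "t \<in> R" for s t
  proof (rule resolv_eq)
    have "resolv z s + resolv z t - row_op z (Ds (resolv z s + resolv z t))
        = (resolv z s - row_op z (Ds (resolv z s))) + (resolv z t - row_op z (Ds (resolv z t)))"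
      by (simp add: bounded_op_UNIV_add[OF bounded_Ds] row_op_add algebra_simps)
    then show "resolv z s + resolv z t - row_op z (Ds (resolv z s + resolv z t)) = s + t"
      using that by (simp only: resolv_fixpoint)
  qed (intro csubspace_add[OF R] resolv_in that)
  moreover have "resolv z (c *\<^sub>C s) = c *\<^sub>C resolv z s" if "s \<in> R" for c s
  proof (rule resolv_eq)
    have "c *\<^sub>C resolv z s - row_op z (Ds (c *\<^sub>C resolv z s))
        = c *\<^sub>C (resolv z s - row_op z (Ds (resolv z s)))"
      by (simp add: bounded_op_UNIV_scaleC[OF bounded_Ds] row_op_scaleC scaleC_diff_right)
    then show "c *\<^sub>C resolv z s - row_op z (Ds (c *\<^sub>C resolv z s)) = c *\<^sub>C s"
      using that by (simp only: resolv_fixpoint)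
  qed (intro csubspace_scaleC[OF R] resolv_in that)
  moreover have "norm (resolv z s) \<le> (1 / (1 - norm z)) * norm s" if "s \<in> R" for s
    using norm_resolv_le[OF that] by simp
  ultimately show ?thesis
    using resolv_in unfolding bounded_op_def clinear_on_def by blast
qed

end

abbreviation "\<Phi> \<equiv> adj_transfer V R A B C D"

lemma transfer_eq: "\<Phi> z x = As x + Cs (resolv z (row_op z (Bs x)))"
  by (simp add: adj_transfer_def resolv_def)

lemma row_Bs_in: "row_op z (Bs x) \<in> R"
  by (intro row_op_in R adj_in)

lemma bounded_op_transfer:
  assumes z: "z \<in> ball 0 1"
  shows "bounded_op W V (\<Phi> z)"
proof -
  have "bounded_op W R (\<lambda>x. row_op z (Bs x))"
    by (rule bounded_op_comp[OF bounded_op_adjoint_on[OF Rn B] bounded_op_row_op[OF R]])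
  from bounded_op_comp[OF bounded_op_comp[OF this bounded_op_resolv[OF z]]
      bounded_op_adjoint_on[OF V C]]
  show ?thesis
    unfolding transfer_eq[abs_def] by (rule bounded_op_add[OF V bounded_op_adjoint_on[OF V A]])
qed

text \<open>The component in \<open>R^n\<close> of the adjoint colligation once the feedback loop is
  closed: for \<open>z\<close> in the ball, \<open>row_op z\<close> of this vector is the resolvent
  term in the transfer function. Its coordinates also carry the partial derivatives.\<close>

definition state :: "complex ^ 'n \<Rightarrow> 'b \<Rightarrow> 'r ^ 'n" where
  "state z x = Bs x + Ds (resolv z (row_op z (Bs x)))"

lemma bounded_op_state:
  assumes z: "z \<in> ball 0 1"
  shows "bounded_op W (vec_space R) (state z)"
proof -
  have "bounded_op W R (\<lambda>x. row_op z (Bs x))"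
    by (rule bounded_op_comp[OF bounded_op_adjoint_on[OF Rn B] bounded_op_row_op[OF R]])
  from bounded_op_comp[OF bounded_op_comp[OF this bounded_op_resolv[OF z]]
      bounded_op_adjoint_on[OF Rn D]]
  show ?thesis
    unfolding state_def[abs_def] by (rule bounded_op_add[OF Rn bounded_op_adjoint_on[OF Rn B]])
qed

text \<open>Second-order remainder: both differences of resolvents contribute a factor \<open>w - z\<close>.\<close>

lemma transfer_remainder:
  assumes z: "z \<in> ball 0 1" and w: "w \<in> ball 0 1" and x: "x \<in> W"
  shows "norm (\<Phi> w x - \<Phi> z x - Cs (resolv z (row_op (w - z) (state z x))))
    \<le> (norm (w - z))\<^sup>2 * norm (state z x) / ((1 - norm w) * (1 - norm z))"
proof -
  define y where "y w = resolv w (row_op w (Bs x))" for w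
  define s where "s = row_op (w - z) (state z x)"
  define t where "t = resolv z s"
  have sR: "s \<in> R" and yz: "y z \<in> R" and yw: "y w \<in> R" and tR: "t \<in> R"
    using bounded_op_in[OF bounded_op_state[OF z] x]
    by (auto simp: s_def y_def t_def intro!: row_op_in R resolv_in z w adj_in)
  have fz: "y z - row_op z (Ds (y z)) = row_op z (Bs x)" and fw: "y w - row_op w (Ds (y w))
      = row_op w (Bs x)"
    unfolding y_def using resolv_fixpoint[OF z row_Bs_in] resolv_fixpoint[OF w row_Bs_in] by auto
  \<comment> \<open>First difference: the solutions at \<open>w\<close> and \<open>z\<close> differ
    by the solution at \<open>w\<close> for the perturbation \<open>s\<close> of the data.\<close>
  have 1: "resolv w s = y w - y z"
  proof (rule resolv_eq[OF w csubspace_diff[OF R yw yz]])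
    have "s = row_op w (Bs x) - row_op z (Bs x) + (row_op w (Ds (y z)) - row_op z (Ds (y z)))"
      by (simp add: s_def state_def y_def row_op_diff_left row_op_add)
    then show "y w - y z - row_op w (Ds (y w - y z)) = s"
      unfolding row_Ds_diff fz[symmetric] fw[symmetric] by simp
  qed
  \<comment> \<open>Replacing the resolvent at \<open>w\<close> by the one at \<open>z\<close>
    leaves the error \<open>resolv w r\<close>; here \<open>r\<close> carries the second factor
    \<open>w - z\<close>.\<close>
  define r where "r = row_op (w - z) (Ds t)"
  have rR: "r \<in> R"
    by (simp add: r_def row_op_in R adj_in)
  have diff_rearrange: "a - t - (b - d) = d - c" if "a - b = s" "t - c = s" for a b c d
  proof -
    have "a - t - (b - d) = (a - b) - (t - c) + (d - c)"
      by (simp add: algebra_simps)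
    then show ?thesis using that by simp
  qed
  have 2: "resolv w r = resolv w s - t"
  proof (rule resolv_eq[OF w])
    show "resolv w s - t \<in> R"
      by (rule csubspace_diff[OF R resolv_in[OF w sR] tR])
    have "resolv w s - row_op w (Ds (resolv w s)) = s" "t - row_op z (Ds t) = s"
      unfolding t_def using resolv_fixpoint[OF w sR] resolv_fixpoint[OF z sR] by auto
    then show "resolv w s - t - row_op w (Ds (resolv w s - t)) = r"
      unfolding row_Ds_diff r_def row_op_diff_left by (rule diff_rearrange)
  qed
  have "\<Phi> w x - \<Phi> z x - Cs t = Cs (resolv w r)"
    unfolding 2 1 transfer_eq y_def
    by (simp add: bounded_op_UNIV_diff[OF bounded_Cs])
  then have "norm (\<Phi> w x - \<Phi> z x - Cs t) \<le> norm r / (1 - norm w)"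
    using norm_Cs_le[OF resolv_in[OF w rR]] norm_resolv_le[OF w rR] by simp
  also have "\<dots> \<le> (norm (w - z) * (norm s / (1 - norm z))) / (1 - norm w)"
  proof (intro divide_right_mono)
    have "norm r \<le> norm (w - z) * norm t"
      unfolding r_def by (rule norm_row_Ds_le[OF tR])
    also have "\<dots> \<le> norm (w - z) * (norm s / (1 - norm z))"
      unfolding t_def by (intro mult_left_mono norm_resolv_le[OF z sR]) simp
    finally show "norm r \<le> norm (w - z) * (norm s / (1 - norm z))" .
  qed (use w in simp)
  also have "\<dots> \<le> (norm (w - z) * ((norm (w - z) * norm (state z x)) / (1 - norm z))) / (1 - norm w)"
    unfolding s_def using z w
    by (intro divide_right_mono mult_left_mono norm_row_op_le) auto
  also have "\<dots> = (norm (w - z))\<^sup>2 * norm (state z x) / ((1 - norm w) * (1 - norm z))"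
    by (simp add: power2_eq_square mult_ac)
  finally show ?thesis
    by (simp add: t_def s_def)
qed

lemma transfer_holomorphic: "op_holomorphic W V \<Phi>"
  unfolding op_holomorphic_def
proof (intro conjI ballI bounded_op_transfer)
  fix z :: "complex ^ 'n" assume z: "z \<in> ball 0 1"
  \<comment> \<open>The candidates come from the remainder estimate, whose linear term
    \<open>row_op (w - z)\<close> is split into coordinates.\<close>
  define L where "L i x = Cs (resolv z (state z x $ i))" for i x
  have state_i: "bounded_op W R (\<lambda>x. state z x $ i)" for i
  proof -
    have "bounded_op (vec_space R) R (\<lambda>v :: 'r ^ 'n. v $ i)"
      by (auto simp: bounded_op_def clinear_on_def vec_space_def scaleC_vec_def intro!: exI[of _ 1]
          Finite_Cartesian_Product.norm_nth_le)
    from bounded_op_comp[OF bounded_op_state[OF z] this] show ?thesis .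
  qed
  have bL: "bounded_op W V (L i)" for i
    unfolding L_def[abs_def]
    by (rule bounded_op_comp[OF bounded_op_comp[OF state_i bounded_op_resolv[OF z]]
        bounded_op_adjoint_on[OF V C]])
  have L_sum: "(\<Sum>i\<in>UNIV. (w $ i - z $ i) *\<^sub>C L i x) = Cs (resolv z (row_op (w - z) (state z x)))"
    if x: "x \<in> W" for w x
  proof -
    have i: "state z x $ i \<in> R" for i
      using bounded_op_in[OF state_i x] .
    note lin = bounded_op_linear[OF bounded_op_resolv[OF z]]
    show ?thesis
      unfolding row_op_def L_def
      by (simp add: clinear_on_sum[OF R lin] csubspace_scaleC[OF R i] clinear_on_scaleC[OF lin i]
          bounded_op_UNIV_sum[OF bounded_Cs] bounded_op_UNIV_scaleC[OF bounded_Cs])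
  qed
  obtain K where K: "K \<ge> 0" "\<And>x. x \<in> W \<Longrightarrow> norm (state z x) \<le> K * norm x"
    using bounded_op_bound[OF bounded_op_state[OF z]] by metis
  \<comment> \<open>Half the distance of \<open>z\<close> to the sphere: points \<open>w\<close>
    closer to \<open>z\<close> than \<open>h\<close> keep \<open>1 - norm w \<ge> h\<close>, so the
    resolvents stay uniformly bounded.\<close>
  define h where "h = (1 - norm z) / 2"
  have h: "h > 0"
    using z by (simp add: h_def)
  have "\<exists>d>0. \<forall>w\<in>ball 0 1. dist w z < d \<longrightarrow>
      (\<forall>x\<in>W. norm (\<Phi> w x - \<Phi> z x - (\<Sum>i\<in>UNIV. (w $ i - z $ i) *\<^sub>C L i x)) \<le> e * norm (w - z)
          * norm x)"
    if e: "e > 0" for e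
  \<comment> \<open>The second bound makes \<open>norm (w - z) * K / (h * h)\<close> at most
    \<open>e\<close>; \<open>K + 1\<close> avoids division by zero.\<close>
  proof (intro exI[of _ "min h (e * h * h / (K + 1))"] conjI ballI impI)
    show "0 < min h (e * h * h / (K + 1))"
      using h e K by simp
    fix w x assume w: "w \<in> ball 0 1" and wz: "dist w z < min h (e * h * h / (K + 1))" and x: "x \<in> W"
    have "norm (w - z) < h" and wz2: "norm (w - z) * (K + 1) \<le> e * h * h"
      using wz K(1) by (auto simp: dist_norm less_divide_eq)
    then have "norm w \<le> norm z + h"
      using norm_triangle_ineq[of "w - z" z] by simp
    then have hw: "h \<le> 1 - norm w" and hz: "h \<le> 1 - norm z"
      using h by (auto simp: h_def field_simps)
    have "norm (\<Phi> w x - \<Phi> z x - (\<Sum>i\<in>UNIV. (w $ i - z $ i) *\<^sub>C L i x))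
        \<le> (norm (w - z))\<^sup>2 * norm (state z x) / ((1 - norm w) * (1 - norm z))"
      unfolding L_sum[OF x] by (rule transfer_remainder[OF z w x])
    also have "\<dots> \<le> (norm (w - z))\<^sup>2 * (K * norm x) / (h * h)"
      using hw hz h K x by (intro frac_le mult_mono mult_left_mono) auto
    also have "\<dots> \<le> e * norm (w - z) * norm x"
    proof -
      have "norm (w - z) * K \<le> e * h * h"
        using wz2 by (simp add: distrib_left) (smt (verit) norm_ge_zero)
      then have "(norm (w - z) * norm x) * (norm (w - z) * K) \<le> (norm (w - z) * norm x)
          * (e * h * h)"
        by (intro mult_left_mono) auto
      then show ?thesis
        using h by (simp add: divide_le_eq power2_eq_square mult_ac)
    qed
    finally show "norm (\<Phi> w x - \<Phi> z x - (\<Sum>i\<in>UNIV. (w $ i - z $ i) *\<^sub>C L i x)) \<le> e * norm (w - z)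
        * norm x" .
  qed
  then show "\<exists>L. (\<forall>i. bounded_op W V (L i)) \<and>
      (\<forall>e>0. \<exists>d>0. \<forall>w\<in>ball 0 1. dist w z < d \<longrightarrow>
        (\<forall>x\<in>W. norm (\<Phi> w x - \<Phi> z x - (\<Sum>i\<in>UNIV. (w $ i - z $ i) *\<^sub>C L i x)) \<le> e * norm (w - z)
            * norm x))"
    using bL by blast
qed

subsection \<open>Coefficients of the transfer function\<close>

text \<open>
  For an input \<open>f = \<Sum> a\<^sub>\<alpha> z\<^sup>\<alpha>\<close> the state \<open>y = Z (B\<^sup>* f + D\<^sup>* y)\<close> is computed degree by degree.
\<close>

primrec state_rec :: "(('n \<Rightarrow> nat) \<Rightarrow> 'b) \<Rightarrow> nat \<Rightarrow> ('n \<Rightarrow> nat) \<Rightarrow> 'r" where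
  "state_rec a 0 = (\<lambda>\<alpha>. 0)"
| "state_rec a (Suc d) = (\<lambda>\<alpha>. \<Sum>i | 0 < \<alpha> i.
    (Bs (a (\<alpha> - unit_index i)) + Ds (state_rec a d (\<alpha> - unit_index i))) $ i)"

text \<open>The depth of the recursion is tied to the degree, which suffices because every step
  lowers the degree by one.\<close>

definition ycoeff :: "(('n \<Rightarrow> nat) \<Rightarrow> 'b) \<Rightarrow> ('n \<Rightarrow> nat) \<Rightarrow> 'r" where
  "ycoeff a \<alpha> = state_rec a (deg \<alpha>) \<alpha>"

definition ucoeff :: "(('n \<Rightarrow> nat) \<Rightarrow> 'b) \<Rightarrow> ('n \<Rightarrow> nat) \<Rightarrow> 'r ^ 'n" where
  "ucoeff a \<alpha> = Bs (a \<alpha>) + Ds (ycoeff a \<alpha>)"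

definition ccoeff :: "(('n \<Rightarrow> nat) \<Rightarrow> 'b) \<Rightarrow> ('n \<Rightarrow> nat) \<Rightarrow> 'a" where
  "ccoeff a \<alpha> = As (a \<alpha>) + Cs (ycoeff a \<alpha>)"

lemma ycoeff_rec: "ycoeff a \<alpha> = (\<Sum>i | 0 < \<alpha> i. ucoeff a (\<alpha> - unit_index i) $ i)"
proof (cases "deg \<alpha>")
  case 0
  then have "{i. 0 < \<alpha> i} = {}"
    by (auto simp: fun_eq_iff)
  then show ?thesis
    using 0 by (simp add: ycoeff_def del: deg_eq_0_iff)
next
  case (Suc d)
  then show ?thesis
    by (auto simp: ycoeff_def ucoeff_def deg_unit_index_diff_eq intro!: sum.cong)
qed

lemma ycoeff_0: "ycoeff a 0 = 0"
  unfolding ycoeff_rec by simp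

lemma ucoeff_in: "ucoeff a \<alpha> \<in> vec_space R"
  unfolding ucoeff_def by (intro csubspace_add[OF Rn] adj_in)

lemma ycoeff_in: "ycoeff a \<alpha> \<in> R"
  unfolding ycoeff_rec by (intro csubspace_sum[OF R]) (use ucoeff_in in \<open>auto simp: vec_space_def\<close>)

lemma ccoeff_in: "ccoeff a \<alpha> \<in> V"
  unfolding ccoeff_def by (intro csubspace_add[OF V] adj_in)

context
  fixes a :: "('n \<Rightarrow> nat) \<Rightarrow> 'b"
  assumes aW: "\<And>\<alpha>. a \<alpha> \<in> W"
begin

lemma norm_coeff_balance:
  "(norm (ccoeff a \<alpha>))\<^sup>2 + (norm (ucoeff a \<alpha>))\<^sup>2 = (norm (a \<alpha>))\<^sup>2 + (norm (ycoeff a \<alpha>))\<^sup>2"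
  unfolding ccoeff_def ucoeff_def by (rule norm_adjoint_block[OF aW ycoeff_in])

text \<open>Cauchy-Schwarz with the weights \<open>rho 1 (\<alpha> - unit_index i)\<close>, whose
  sum is \<open>rho 1 \<alpha>\<close> by Pascal's rule. On coefficients, this is why the row of
  coordinates is contractive at weight 1.\<close>

lemma norm_ycoeff_le:
  "(norm (ycoeff a \<alpha>))\<^sup>2 / rho 1 \<alpha>
    \<le> (\<Sum>i | 0 < \<alpha> i. (norm (ucoeff a (\<alpha> - unit_index i) $ i))\<^sup>2 / rho 1 (\<alpha> - unit_index i))"
proof (cases "\<alpha> = 0")
  case True
  then show ?thesis by (simp add: ycoeff_0[unfolded zero_fun_def] zero_fun_def)
next
  case False
  let ?I = "{i. 0 < \<alpha> i}" and ?u = "\<lambda>i. norm (ucoeff a (\<alpha> - unit_index i) $ i)"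
    and ?r = "\<lambda>i. rho 1 (\<alpha> - unit_index i)"
  have "norm (ycoeff a \<alpha>) \<le> (\<Sum>i\<in>?I. \<bar>sqrt (?r i)\<bar> * \<bar>?u i / sqrt (?r i)\<bar>)"
    unfolding ycoeff_rec by (rule order_trans[OF norm_sum]) simp
  also have "\<dots> \<le> L2_set (\<lambda>i. sqrt (?r i)) ?I * L2_set (\<lambda>i. ?u i / sqrt (?r i)) ?I"
    by (rule L2_set_mult_ineq)
  also have "\<dots> = sqrt (rho 1 \<alpha>) * sqrt (\<Sum>i\<in>?I. (?u i)\<^sup>2 / ?r i)"
    by (simp add: L2_set_def power_divide rho_1_pascal[OF False])
  finally have "(norm (ycoeff a \<alpha>))\<^sup>2 \<le> (sqrt (rho 1 \<alpha>) * sqrt (\<Sum>i\<in>?I. (?u i)\<^sup>2 / ?r i))\<^sup>2"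
    by (intro power_mono) auto
  also have "\<dots> = (\<Sum>i\<in>?I. (?u i)\<^sup>2 / ?r i) * rho 1 \<alpha>"
    by (simp add: power_mult_distrib sum_nonneg)
  finally show ?thesis
    by (simp add: divide_le_eq)
qed

lemma sum_norm_ycoeff_le:
  "(\<Sum>\<alpha> | deg \<alpha> = Suc d. (norm (ycoeff a \<alpha>))\<^sup>2 / rho 1 \<alpha>) \<le> (\<Sum>\<alpha> | deg \<alpha> = d. (norm (ucoeff a \<alpha>))\<^sup>2
      / rho 1 \<alpha>)"
proof -
  have "(\<Sum>\<alpha> | deg \<alpha> = Suc d. (norm (ycoeff a \<alpha>))\<^sup>2 / rho 1 \<alpha>)
      \<le> (\<Sum>\<alpha> | deg \<alpha> = Suc d. \<Sum>i | 0 < \<alpha> i.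
          (norm (ucoeff a (\<alpha> - unit_index i) $ i))\<^sup>2 / rho 1 (\<alpha> - unit_index i))"
    by (intro sum_mono norm_ycoeff_le)
  also have "\<dots> = (\<Sum>\<alpha> | deg \<alpha> = d. (norm (ucoeff a \<alpha>))\<^sup>2 / rho 1 \<alpha>)"
    unfolding sum_deg_Suc by (simp add: norm_vec_sq sum_divide_distrib)
  finally show ?thesis .
qed

text \<open>An energy balance: in each degree output plus new state equals input plus old state, and
  the state passed to the next degree does not grow. The top-degree term of \<open>ucoeff\<close> is
  kept so that the induction closes.\<close>

lemma sum_norm_ccoeff_le:
  "(\<Sum>\<alpha> | deg \<alpha> \<le> N. (norm (ccoeff a \<alpha>))\<^sup>2 / rho 1 \<alpha>) + (\<Sum>\<alpha> | deg \<alpha> = N. (norm (ucoeff a \<alpha>))\<^sup>2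
      / rho 1 \<alpha>)
    \<le> (\<Sum>\<alpha> | deg \<alpha> \<le> N. (norm (a \<alpha>))\<^sup>2 / rho 1 \<alpha>)"
proof -
  have bal: "(\<Sum>\<alpha> | deg \<alpha> = d. (norm (ccoeff a \<alpha>))\<^sup>2 / rho 1 \<alpha>)
      + (\<Sum>\<alpha> | deg \<alpha> = d. (norm (ucoeff a \<alpha>))\<^sup>2 / rho 1 \<alpha>)
      = (\<Sum>\<alpha> | deg \<alpha> = d. (norm (a \<alpha>))\<^sup>2 / rho 1 \<alpha>) + (\<Sum>\<alpha> | deg \<alpha> = d. (norm (ycoeff a \<alpha>))\<^sup>2
          / rho 1 \<alpha>)" for d
    by (simp add: norm_coeff_balance flip: sum.distrib add_divide_distrib)
  show ?thesis
  proof (induction N)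
    case 0
    have "(norm (ycoeff a 0))\<^sup>2 / rho 1 0 = 0"
      by (simp add: ycoeff_0)
    then show ?case
      using bal[of 0] unfolding sum_deg_0 by (simp del: zero_fun_apply)
  next
    case (Suc N)
    then show ?case
      using bal[of "Suc N"] sum_norm_ycoeff_le[of N] unfolding sum_deg_le_Suc by linarith
  qed
qed

end

text \<open>The recursion is tied to the closed formula by summation: the total state
  \<open>yz\<close> satisfies \<open>yz = row_op z (Bs f + Ds yz)\<close>, which characterizes the
  resolvent value.\<close>

lemma transfer_coeffs:
  assumes a: "a \<in> wspace 1 W"
  shows "wsummable 1 (ccoeff a)" "norm (wseq 1 (ccoeff a)) \<le> norm (wseq 1 a)"
    "(\<Sum>\<alpha> | deg \<alpha> = d. (norm (ycoeff a \<alpha>))\<^sup>2 / rho 1 \<alpha>) \<le> (norm (wseq 1 a))\<^sup>2"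
    "mult_op \<Phi> (Hm_fun a) = Hm_fun (ccoeff a)"
proof -
  have aW: "a \<alpha> \<in> W" for \<alpha>
    using a by (auto simp: wspace_def)
  have ws: "wsummable 1 a"
    using a by (auto simp: wspace_def)
  let ?M = "norm (wseq 1 a)"
  have nn: "0 \<le> (\<Sum>\<alpha> | deg \<alpha> \<le> N. (norm (ccoeff a \<alpha>))\<^sup>2 / rho 1 \<alpha>)"
    "0 \<le> (\<Sum>\<alpha> | deg \<alpha> = N. (norm (ucoeff a \<alpha>))\<^sup>2 / rho 1 \<alpha>)" for N
    by (auto intro!: sum_nonneg)
  have le: "(\<Sum>\<alpha> | deg \<alpha> \<le> N. (norm (a \<alpha>))\<^sup>2 / rho 1 \<alpha>) \<le> ?M\<^sup>2" for N
    by (rule sum_norm_le_wseq[OF ws]) simp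
  have c_le: "(\<Sum>\<alpha> | deg \<alpha> \<le> N. (norm (ccoeff a \<alpha>))\<^sup>2 / rho 1 \<alpha>) \<le> ?M\<^sup>2" for N
    using sum_norm_ccoeff_le[where a = a, OF aW, of N] le[of N] nn[of N] by linarith
  have u_le: "(\<Sum>\<alpha> | deg \<alpha> = N. (norm (ucoeff a \<alpha>))\<^sup>2 / rho 1 \<alpha>) \<le> ?M\<^sup>2" for N
    using sum_norm_ccoeff_le[where a = a, OF aW, of N] le[of N] nn[of N] by linarith
  show y_le: "(\<Sum>\<alpha> | deg \<alpha> = d. (norm (ycoeff a \<alpha>))\<^sup>2 / rho 1 \<alpha>) \<le> ?M\<^sup>2" for d
  proof (cases d)
    case 0
    have "(norm (ycoeff a 0))\<^sup>2 / rho 1 0 = 0"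
      by (simp add: ycoeff_0)
    then show ?thesis
      unfolding 0 sum_deg_0 by simp
  next
    case (Suc e)
    then show ?thesis
      using sum_norm_ycoeff_le[where a = a, OF aW, of e] u_le[of e] by simp
  qed
  show wc: "wsummable 1 (ccoeff a)"
    unfolding wsummable_def using c_le by (intro summable_on_deg_bounded(1)) auto
  show "norm (wseq 1 (ccoeff a)) \<le> ?M"
    by (rule norm_wseq_leI[OF wc _ c_le]) simp
  show "mult_op \<Phi> (Hm_fun a) = Hm_fun (ccoeff a)"
  proof
    fix z
    show "mult_op \<Phi> (Hm_fun a) z = Hm_fun (ccoeff a) z"
    proof (cases "z \<in> ball 0 1")
      case z: True
      define f where "f = Hm_fun a z"
      have f: "((\<lambda>\<alpha>. zpow z \<alpha> *\<^sub>C a \<alpha>) has_sum f) UNIV"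
        using has_power_series_Hm_fun[OF order_refl ws] z by (simp add: has_power_series_def f_def)
      obtain yz where y: "((\<lambda>\<alpha>. zpow z \<alpha> *\<^sub>C ycoeff a \<alpha>) has_sum yz) UNIV"
        using abs_summable_summable[OF homogeneous_bound_abs_summable[OF z norm_ge_zero y_le]]
        by (auto simp: summable_on_def)
      have yR: "yz \<in> R"
        by (rule has_sum_bounded_op(1)[OF R bounded_op_id y])
            (rule csubspace_scaleC[OF R ycoeff_in])
      define uz where "uz = Bs f + Ds yz"
      have u: "((\<lambda>\<alpha>. zpow z \<alpha> *\<^sub>C ucoeff a \<alpha>) has_sum uz) UNIV"
        using has_sum_add[OF has_sum_bounded_linear[OF bounded_op_bounded_linear[OF bounded_Bs] f]
            has_sum_bounded_linear[OF bounded_op_bounded_linear[OF bounded_Ds] y]]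
        by (simp add: uz_def ucoeff_def bounded_op_UNIV_scaleC[OF bounded_Bs]
            bounded_op_UNIV_scaleC[OF bounded_Ds] scaleC_add_right)
      have c: "((\<lambda>\<alpha>. zpow z \<alpha> *\<^sub>C ccoeff a \<alpha>) has_sum (As f + Cs yz)) UNIV"
        using has_sum_add[OF has_sum_bounded_linear[OF bounded_op_bounded_linear[OF bounded_As] f]
            has_sum_bounded_linear[OF bounded_op_bounded_linear[OF bounded_Cs] y]]
        by (simp add: ccoeff_def bounded_op_UNIV_scaleC[OF bounded_As]
            bounded_op_UNIV_scaleC[OF bounded_Cs] scaleC_add_right)
      have step: "(\<Sum>\<alpha> | deg \<alpha> = Suc d. zpow z \<alpha> *\<^sub>C ycoeff a \<alpha>)
          = row_op z (\<Sum>\<alpha> | deg \<alpha> = d. zpow z \<alpha> *\<^sub>C ucoeff a \<alpha>)" for d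
      proof -
        have "(\<Sum>\<alpha> | deg \<alpha> = Suc d. zpow z \<alpha> *\<^sub>C ycoeff a \<alpha>)
            = (\<Sum>\<alpha> | deg \<alpha> = Suc d. \<Sum>i | 0 < \<alpha> i. zpow z \<alpha> *\<^sub>C ucoeff a (\<alpha> - unit_index i) $ i)"
          by (subst ycoeff_rec) (simp add: scaleC_sum_right)
        also have "\<dots> = (\<Sum>\<alpha> | deg \<alpha> = d. zpow z \<alpha> *\<^sub>C row_op z (ucoeff a \<alpha>))"
          unfolding sum_deg_Suc
          by (simp add: row_op_def zpow_add scaleC_sum_right scaleC_scaleC)
        also have "\<dots> = row_op z (\<Sum>\<alpha> | deg \<alpha> = d. zpow z \<alpha> *\<^sub>C ucoeff a \<alpha>)"
          by (simp add: bounded_op_UNIV_sum[OF bounded_op_row_op_UNIV] row_op_scaleC)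
        finally show ?thesis .
      qed
      have partial: "(\<Sum>\<alpha> | deg \<alpha> \<le> Suc N. zpow z \<alpha> *\<^sub>C ycoeff a \<alpha>)
          = row_op z (\<Sum>\<alpha> | deg \<alpha> \<le> N. zpow z \<alpha> *\<^sub>C ucoeff a \<alpha>)" for N
      proof (induction N)
        case 0
        show ?case
          using step[of 0] unfolding sum_deg_le_Suc sum_deg_0
              by (simp add: ycoeff_0 del: zero_fun_apply)
      next
        case (Suc N)
        show ?case
          by (subst sum_deg_le_Suc) (simp only: Suc step sum_deg_le_Suc row_op_add)
      qed
      have "(\<lambda>N. row_op z (\<Sum>\<alpha> | deg \<alpha> \<le> N. zpow z \<alpha> *\<^sub>C ucoeff a \<alpha>)) \<longlonglongrightarrow> row_op z uz"
        by (rule bounded_linear.tendsto[OF bounded_op_bounded_linear[OF bounded_op_row_op_UNIV]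
            has_sum_deg_tendsto[OF u]])
      moreover have "(\<lambda>N. \<Sum>\<alpha> | deg \<alpha> \<le> Suc N. zpow z \<alpha> *\<^sub>C ycoeff a \<alpha>) \<longlonglongrightarrow> yz"
        by (rule LIMSEQ_Suc[OF has_sum_deg_tendsto[OF y]])
      ultimately have "yz = row_op z uz"
        unfolding partial using LIMSEQ_unique by blast
      then have "yz = row_op z (Bs f) + row_op z (Ds yz)"
        unfolding uz_def row_op_add .
      then have "yz - row_op z (Ds yz) = row_op z (Bs f)"
        by (metis add_diff_cancel_right')
      then have "resolv z (row_op z (Bs f)) = yz"
        by (rule resolv_eq[OF z yR])
      then have "mult_op \<Phi> (Hm_fun a) z = As f + Cs yz"
        using z by (simp add: mult_op_def transfer_eq f_def)
      moreover have "Hm_fun (ccoeff a) z = As f + Cs yz"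
        using c z by (simp add: Hm_fun_def infsumI)
      ultimately show ?thesis by simp
    qed (simp add: mult_op_def Hm_fun_def)
  qed
qed

lemma transfer_schur_agler: "schur_agler W V \<Phi>"
  unfolding schur_agler_def
proof (intro conjI ballI transfer_holomorphic)
  fix f :: "complex ^ 'n \<Rightarrow> 'b" assume "f \<in> Hm 1 W"
  then obtain a where a: "a \<in> wspace 1 W" "f = Hm_fun a"
    using Hm_iff[OF order_refl] by blast
  note t = transfer_coeffs[OF a(1)]
  have "ccoeff a \<in> wspace 1 V"
    using t(1) ccoeff_in by (auto simp: wspace_def)
  then show "mult_op \<Phi> f \<in> Hm 1 V"
    unfolding a(2) t(4) by (rule Hm_fun_in[OF order_refl])
  show "Hm_norm 1 (mult_op \<Phi> f) \<le> Hm_norm 1 f"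
    unfolding a(2) t(4) using t(2) a(1) by (simp add: Hm_norm_Hm_fun t(1) wspace_def)
qed

lemma mult_coeff_transfer:
  assumes "v \<in> W"
  shows "mult_coeff \<Phi> \<beta> v = ccoeff (wsingle 0 v) \<beta>"
  using coeffs_Hm_fun[OF order_refl transfer_coeffs(1)[OF wsingle_in[OF W assms, of 0 1]]]
  by (simp add: mult_coeff_def transfer_coeffs(4)[OF wsingle_in[OF W assms, of 0 1]])

text \<open>
  If the colligation maps \<open>(p k, (\<delta> s\<^sub>i k)\<^sub>i)\<close> to \<open>(p' k, \<delta> k)\<close>, then
  \<open>\<langle>p s\<^sup>\<beta> k, \<Phi>\<^sub>\<beta> v\<rangle> = \<langle>p' s\<^sup>\<beta> k, a\<^sub>\<beta>\<rangle> + \<langle>\<delta> s\<^sup>\<beta> k, y\<^sub>\<beta>\<rangle>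
      - \<Sum>\<^sub>i \<langle>\<delta> s\<^sup>\<beta>\<^sup>+\<^sup>e\<^sup>i k, u\<^sub>\<beta>\<^sub>i\<rangle>\<close>, which telescopes over the degree.
\<close>

lemma transfer_telescope:
  fixes \<delta> :: "'k \<Rightarrow> 'r" and p :: "'k \<Rightarrow> 'a" and p' :: "'k \<Rightarrow> 'b" and \<kappa> :: "('n \<Rightarrow> nat) \<Rightarrow> 'k"
  assumes p: "\<And>k. p k \<in> V" and \<delta>: "\<And>k. \<delta> k \<in> R"
    and U_eq: "\<And>\<beta>. block_op A B C D (p (\<kappa> \<beta>), \<chi> i. \<delta> (\<kappa> (\<beta> + unit_index i))) = (p' (\<kappa> \<beta>), \<delta> (\<kappa> \<beta>))"
    and v: "v \<in> W"
    and lim: "(\<lambda>d. \<Sum>\<gamma> | deg \<gamma> = d. rho 1 \<gamma> * (norm (\<delta> (\<kappa> \<gamma>)))\<^sup>2) \<longlonglongrightarrow> 0"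
  shows "(\<lambda>N. \<Sum>\<beta> | deg \<beta> \<le> N. cinner (mult_coeff \<Phi> \<beta> v) (p (\<kappa> \<beta>))) \<longlonglongrightarrow> cinner v (p' (\<kappa> 0))"
proof -
  define a where "a = (wsingle 0 v :: ('n \<Rightarrow> nat) \<Rightarrow> 'b)"
  have a: "a \<in> wspace 1 W"
    unfolding a_def by (rule wsingle_in[OF W v])
  have aW: "a \<alpha> \<in> W" for \<alpha>
    using a by (auto simp: wspace_def)
  define E where "E d = (\<Sum>\<gamma> | deg \<gamma> = d. cinner (ycoeff a \<gamma>) (\<delta> (\<kappa> \<gamma>)))" for d
  have term_eq: "cinner (ccoeff a \<beta>) (p (\<kappa> \<beta>)) = cinner (a \<beta>) (p' (\<kappa> \<beta>))
      + cinner (ycoeff a \<beta>) (\<delta> (\<kappa> \<beta>))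
      - (\<Sum>i\<in>UNIV. cinner (ucoeff a \<beta> $ i) (\<delta> (\<kappa> (\<beta> + unit_index i))))" for \<beta>
  proof -
    have vR: "(\<chi> i. \<delta> (\<kappa> (\<beta> + unit_index i))) \<in> vec_space R"
      using \<delta> by (simp add: vec_space_def)
    have "cinner (p' (\<kappa> \<beta>), \<delta> (\<kappa> \<beta>)) (a \<beta>, ycoeff a \<beta>)
        = cinner (p (\<kappa> \<beta>), \<chi> i. \<delta> (\<kappa> (\<beta> + unit_index i))) (ccoeff a \<beta>, ucoeff a \<beta>)"
      using cinner_block_op[OF p vR, of "\<kappa> \<beta>" "a \<beta>" "ycoeff a \<beta>"]
          by (simp add: U_eq ccoeff_def ucoeff_def)
    then have "cinner (a \<beta>, ycoeff a \<beta>) (p' (\<kappa> \<beta>), \<delta> (\<kappa> \<beta>))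
        = cinner (ccoeff a \<beta>, ucoeff a \<beta>) (p (\<kappa> \<beta>), \<chi> i. \<delta> (\<kappa> (\<beta> + unit_index i)))"
      by (metis cinner_commute)
    then show ?thesis
      by (simp add: cinner_prod_def cinner_vec_def)
  qed
  have E_Suc: "(\<Sum>\<beta> | deg \<beta> = d. \<Sum>i\<in>UNIV. cinner (ucoeff a \<beta> $ i) (\<delta> (\<kappa> (\<beta> + unit_index i))))
      = E (Suc d)" for d
  proof -
    have "E (Suc d) = (\<Sum>\<gamma> | deg \<gamma> = Suc d. \<Sum>i | 0 < \<gamma> i. cinner (ucoeff a (\<gamma> - unit_index i) $ i)
        (\<delta> (\<kappa> \<gamma>)))"
      unfolding E_def by (subst ycoeff_rec) (simp add: cinner_sum_left)
    then show ?thesis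
      unfolding sum_deg_Suc by simp
  qed
  have deg_d: "(\<Sum>\<beta> | deg \<beta> = d. cinner (ccoeff a \<beta>) (p (\<kappa> \<beta>)))
      = (\<Sum>\<beta> | deg \<beta> = d. cinner (a \<beta>) (p' (\<kappa> \<beta>))) + E d - E (Suc d)" for d
    unfolding term_eq sum_subtractf sum.distrib E_Suc by (simp add: E_def)
  \<comment> \<open>The input is constant, so only the index \<open>0\<close> contributes.\<close>
  have a_sum: "(\<Sum>\<beta> | deg \<beta> \<le> N. cinner (a \<beta>) (p' (\<kappa> \<beta>))) = cinner v (p' (\<kappa> 0))" for N
  proof -
    have "deg (0 :: 'n \<Rightarrow> nat) = 0"
      by simp
    then have "(\<Sum>\<beta> | deg \<beta> \<le> N. cinner (a \<beta>) (p' (\<kappa> \<beta>))) = (\<Sum>\<beta>\<in>{0}. cinner (a \<beta>) (p' (\<kappa> \<beta>)))"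
      by (intro sum.mono_neutral_right) (auto simp: a_def wsingle_def simp del: deg_eq_0_iff)
    then show ?thesis
      by (simp add: a_def wsingle_def)
  qed
  have "E 0 = 0"
    unfolding E_def deg_eq_0 by (simp add: ycoeff_0)
  have partial: "(\<Sum>\<beta> | deg \<beta> \<le> N. cinner (ccoeff a \<beta>) (p (\<kappa> \<beta>))) = cinner v (p' (\<kappa> 0)) - E (Suc N)"
      for N
  proof -
    have "(\<Sum>\<beta> | deg \<beta> \<le> N. cinner (ccoeff a \<beta>) (p (\<kappa> \<beta>)))
        = (\<Sum>\<beta> | deg \<beta> \<le> N. cinner (a \<beta>) (p' (\<kappa> \<beta>))) - (\<Sum>d\<le>N. E (Suc d) - E d)"
      unfolding sum_deg_le deg_d by (simp add: sum.distrib sum_subtractf)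
    also have "(\<Sum>d\<le>N. E (Suc d) - E d) = E (Suc N)"
      using sum_lessThan_telescope[of E "Suc N"] \<open>E 0 = 0\<close> by (simp add: lessThan_Suc_atMost)
    finally show ?thesis by (simp add: a_sum)
  qed
  have E_le: "cmod (E d) \<le> norm (wseq 1 a) * sqrt (\<Sum>\<gamma> | deg \<gamma> = d. rho 1 \<gamma> * (norm (\<delta> (\<kappa> \<gamma>)))\<^sup>2)"
      for d
  proof -
    let ?F = "{\<gamma> :: 'n \<Rightarrow> nat. deg \<gamma> = d}"
    have "cmod (E d) \<le> (\<Sum>\<gamma>\<in>?F. \<bar>norm (ycoeff a \<gamma>) / sqrt (rho 1 \<gamma>)\<bar> * \<bar>sqrt (rho 1 \<gamma>)
        * norm (\<delta> (\<kappa> \<gamma>))\<bar>)"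
      unfolding E_def
      by (rule order_trans[OF norm_sum]) (auto intro!: sum_mono cauchy_schwarz simp: abs_mult)
    also have "\<dots> \<le> L2_set (\<lambda>\<gamma>. norm (ycoeff a \<gamma>) / sqrt (rho 1 \<gamma>)) ?F * L2_set (\<lambda>\<gamma>. sqrt (rho 1 \<gamma>)
        * norm (\<delta> (\<kappa> \<gamma>))) ?F"
      by (rule L2_set_mult_ineq)
    also have "\<dots> \<le> norm (wseq 1 a) * L2_set (\<lambda>\<gamma>. sqrt (rho 1 \<gamma>) * norm (\<delta> (\<kappa> \<gamma>))) ?F"
    proof (rule mult_right_mono)
      show "L2_set (\<lambda>\<gamma>. norm (ycoeff a \<gamma>) / sqrt (rho 1 \<gamma>)) ?F \<le> norm (wseq 1 a)"
        unfolding L2_set_def using transfer_coeffs(3)[OF a, of d]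
        by (intro real_le_lsqrt) (auto simp: power_divide sum_nonneg)
    qed (simp add: L2_set_nonneg)
    finally show ?thesis
      by (simp add: L2_set_def power_mult_distrib)
  qed
  have "(\<lambda>d. norm (wseq 1 a) * sqrt (\<Sum>\<gamma> | deg \<gamma> = d. rho 1 \<gamma> * (norm (\<delta> (\<kappa> \<gamma>)))\<^sup>2)) \<longlonglongrightarrow> norm (wseq 1 a)
      * sqrt 0"
    by (intro tendsto_intros lim)
  then have "E \<longlonglongrightarrow> 0"
    by (intro Lim_null_comparison[OF always_eventually[OF allI[OF E_le]]]) simp
  then have "(\<lambda>N. cinner v (p' (\<kappa> 0)) - E (Suc N)) \<longlonglongrightarrow> cinner v (p' (\<kappa> 0)) - 0"
    by (intro tendsto_intros LIMSEQ_Suc)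
  then show ?thesis
    using partial by (simp add: mult_coeff_transfer[OF v] a_def)
qed

end

section \<open>Commutant lifting\<close>

lemma unitary_op_blocks:
  assumes V: "closed_csubspace V" and Y: "closed_csubspace Y" and W: "closed_csubspace W"
      and R: "closed_csubspace R"
    and U: "unitary_op (V \<times> Y) (W \<times> R) U"
  obtains A B C D where "bounded_op V W A" "bounded_op Y W B" "bounded_op V R C" "bounded_op Y R D"
    "\<And>x y. x \<in> V \<Longrightarrow> y \<in> Y \<Longrightarrow> block_op A B C D (x, y) = U (x, y)"
    "unitary_op (V \<times> Y) (W \<times> R) (block_op A B C D)"
proof -
  note H = csubspace_Times[OF V Y]
  have bU: "bounded_op (V \<times> Y) (W \<times> R) U"
    using U unitary_op_isometry[OF U]
    by (auto simp: unitary_op_def bij_betw_def isometry_on_def bounded_op_def intro!: exI[of _ 1])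
  have inl: "bounded_op V (V \<times> Y) (\<lambda>x. (x, 0))" and inr: "bounded_op Y (V \<times> Y) (\<lambda>y. (0, y))"
    using csubspace_zero[OF V] csubspace_zero[OF Y]
    by (auto simp: bounded_op_def clinear_on_def scaleC_prod_def intro!: exI[of _ 1])
  have fst: "bounded_op (W \<times> R) W fst" and snd: "bounded_op (W \<times> R) R snd"
    by (auto simp: bounded_op_def clinear_on_def scaleC_prod_def norm_Pair intro!: exI[of _ 1]
        real_sqrt_ge_abs1[THEN order_trans[rotated]] real_sqrt_ge_abs2[THEN order_trans[rotated]])
  define A where "A x = fst (U (x, 0))" for x
  define B where "B y = fst (U (0, y))" for y
  define C where "C x = snd (U (x, 0))" for x
  define D where "D y = snd (U (0, y))" for y
  have bounded: "bounded_op V W A" "bounded_op Y W B" "bounded_op V R C" "bounded_op Y R D"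
    unfolding A_def[abs_def] B_def[abs_def] C_def[abs_def] D_def[abs_def]
    by (rule bounded_op_comp[OF bounded_op_comp[OF inl bU] fst]
        bounded_op_comp[OF bounded_op_comp[OF inr bU] fst]
        bounded_op_comp[OF bounded_op_comp[OF inl bU] snd]
            bounded_op_comp[OF bounded_op_comp[OF inr bU] snd])+
  have eq: "block_op A B C D (x, y) = U (x, y)" if "x \<in> V" "y \<in> Y" for x y
  proof -
    have "U (x, y) = U (x, 0) + U (0, y)"
      using clinear_on_add[OF bounded_op_linear[OF bU], of "(x, 0)" "(0, y)"] that
        csubspace_zero[OF V] csubspace_zero[OF Y] by simp
    then show ?thesis
      by (simp add: block_op_def A_def B_def C_def D_def prod_eq_iff)
  qed
  have "unitary_op (V \<times> Y) (W \<times> R) (block_op A B C D)"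
  proof (rule unitary_opI[OF H])
    show "isometry_on (V \<times> Y) (block_op A B C D)"
      using unitary_op_isometry[OF U] csubspace_add[OF V] csubspace_add[OF Y] csubspace_scaleC[OF V]
          csubspace_scaleC[OF Y]
      by (auto simp: isometry_on_def clinear_on_def eq scaleC_prod_def)
    show "block_op A B C D ` (V \<times> Y) = W \<times> R"
      using U by (auto simp: unitary_op_def bij_betw_def eq image_def)
  qed
  then show ?thesis
    using that bounded eq by blast
qed

context intertwined_hypercontractions
begin

abbreviation \<Delta> :: "'k \<Rightarrow> 'k" where
  "\<Delta> \<equiv> sqrt_op P"

lemma defect_balance:
  assumes "positive_op P"
  shows "(norm (defect_op m S k))\<^sup>2 + (\<Sum>i\<in>UNIV. (norm (\<Delta> (adj (S i) k)))\<^sup>2)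
    = (norm (defect_op m T (adj X k)))\<^sup>2 + (norm (\<Delta> k))\<^sup>2"
  using qform_P_step[of k]
  by (simp add: S.norm_defect_op T.norm_defect_op norm_sqrt_op[OF assms] flip: qform_def)

text \<open>By uniqueness of coefficients it suffices to identify each \<open>x \<alpha>\<close>.
  Both sides lie in the defect space of \<open>T\<close>, so testing against their difference is
  enough, and \<open>transfer_telescope\<close> evaluates the tested series.\<close>

lemma multiplier_relation:
  fixes R :: "('k \<times> 'r::complex_hilbert) set"
  assumes pos: "positive_op P"
    and col: "unitary_colligation (defect_space m S) (defect_space m T) R A B C D"
    and state_in: "\<And>k. (\<Delta> k, 0) \<in> R"
    and U_eq: "\<And>k. block_op A B C D (defect_op m S k, \<chi> i. (\<Delta> (adj (S i) k), 0))
        = (defect_op m T (adj X k), (\<Delta> k, 0))"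
  shows "canonical_dilation m T \<circ> adj X =
    mult_op_adj m (defect_space m T) (adj_transfer (defect_space m S) R A B C D) \<circ>
        canonical_dilation m S"
proof
  fix k
  interpret unitary_colligation "defect_space m S" "defect_space m T" R A B C D
    by (rule col)
  let ?\<Phi> = "adj_transfer (defect_space m S) R A B C D"
  obtain x where x: "(\<lambda>\<alpha>. rho m \<alpha> *\<^sub>R x \<alpha>) \<in> wspace m (defect_space m T)"
    "mult_op_adj m (defect_space m T) ?\<Phi> (Hm_fun (\<lambda>\<gamma>. rho m \<gamma> *\<^sub>R S.dil_coeffs k \<gamma>))
        = Hm_fun (\<lambda>\<alpha>. rho m \<alpha> *\<^sub>R x \<alpha>)"
    "norm (wseq m (\<lambda>\<alpha>. rho m \<alpha> *\<^sub>R x \<alpha>)) \<le> norm (wseq m (\<lambda>\<gamma>. rho m \<gamma> *\<^sub>R S.dil_coeffs k \<gamma>))"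
    "\<And>\<alpha>. x \<alpha> \<in> defect_space m T"
    "\<And>\<alpha> v. v \<in> defect_space m T \<Longrightarrow>
      ((\<lambda>\<beta>. cinner (mult_coeff ?\<Phi> \<beta> v) (S.dil_coeffs k (\<alpha> + \<beta>))) has_sum cinner v (x \<alpha>)) UNIV"
    by (rule mult_op_adj_coeffs[OF W transfer_schur_agler T.m S.dil_coeffs_wsummable[OF T.m
        order_refl, of k]])
      (rule that; assumption)
  have "x \<alpha> = T.dil_coeffs (adj X k) \<alpha>" for \<alpha>
  proof -
    \<comment> \<open>Shifting by \<open>\<alpha>\<close> replaces \<open>k\<close> by
      \<open>k'\<close> and reduces the claim to the index \<open>0\<close>; intertwining moves the
      adjoint of \<open>X\<close> past the powers at the end.\<close>
    define k' where "k' = adj_pow S \<alpha> k"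
    have dil: "S.dil_coeffs k (\<alpha> + \<beta>) = defect_op m S (adj_pow S \<beta> k')" for \<beta>
      unfolding S.dil_coeffs_def k'_def S.adj_pow_add[symmetric] by (simp only: add.commute)
    have eq: "cinner v (x \<alpha>) = cinner v (defect_op m T (adj X k'))" if v: "v \<in> defect_space m T"
        for v
    proof -
      have "(\<lambda>N. \<Sum>\<beta> | deg \<beta> \<le> N. cinner (mult_coeff ?\<Phi> \<beta> v) (defect_op m S (adj_pow S \<beta> k')))
          \<longlonglongrightarrow> cinner v (defect_op m T (adj X (adj_pow S 0 k')))"
      proof (rule transfer_telescope[where \<delta> = "\<lambda>k. (\<Delta> k, 0)"
          and p' = "\<lambda>k. defect_op m T (adj X k)"])
        show "block_op A B C D (defect_op m S (adj_pow S \<beta> k'), \<chi> i.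
            (\<Delta> (adj_pow S (\<beta> + unit_index i) k'), 0))
            = (defect_op m T (adj X (adj_pow S \<beta> k')), (\<Delta> (adj_pow S \<beta> k'), 0))" for \<beta>
          unfolding S.adj_pow_add_unit_index by (rule U_eq)
        have "(norm (\<Delta> h, 0 :: 'r))\<^sup>2 = qform P h" for h
          by (simp add: norm_prod_sq norm_sqrt_op[OF pos] qform_def)
        then show "(\<lambda>d. \<Sum>\<gamma> | deg \<gamma> = d. rho 1 \<gamma> * (norm (\<Delta> (adj_pow S \<gamma> k'), 0 :: 'r))\<^sup>2) \<longlonglongrightarrow> 0"
          using sigma_form_P_tendsto_0[of k'] by (simp add: sigma_form_def)
      qed (use v state_in S.defect_op_in in auto)
      then have "(\<lambda>N. \<Sum>\<beta> | deg \<beta> \<le> N. cinner (mult_coeff ?\<Phi> \<beta> v) (S.dil_coeffs k (\<alpha> + \<beta>)))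
          \<longlonglongrightarrow> cinner v (defect_op m T (adj X k'))"
        by (simp only: dil S.adj_pow_0)
      then show ?thesis
        using has_sum_deg_tendsto[OF x(5)[OF v]] LIMSEQ_unique by blast
    qed
    have "x \<alpha> - defect_op m T (adj X k') \<in> defect_space m T"
      by (intro csubspace_diff[OF W] x T.defect_op_in)
    from eq[OF this]
    have "cinner (x \<alpha> - defect_op m T (adj X k')) (x \<alpha> - defect_op m T (adj X k')) = 0"
      by (subst cinner_diff_right) simp
    then have "x \<alpha> = defect_op m T (adj X k')"
      by simp
    then show ?thesis
      by (simp add: k'_def adj_pow_intertwine T.dil_coeffs_def)
  qed
  then show "(canonical_dilation m T \<circ> adj X) k
      = (mult_op_adj m (defect_space m T) ?\<Phi> \<circ> canonical_dilation m S) k"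
    using x(2) by (simp add: T.canonical_dilation_eq S.canonical_dilation_eq)
qed

text \<open>\<open>E\<close> is taken to be the whole sequence type, independently of
  \<open>T\<close>, \<open>S\<close> and \<open>X\<close>; \<open>defect_balance\<close> is the
  equality of norms that makes the prescribed map extendable to a unitary.\<close>

lemma transfer_realization:
  assumes pos: "positive_op P"
  shows "\<exists>(E :: ('h \<times> 'k) l2seq set) (R :: ('k \<times> ('h \<times> 'k) l2seq) set) A B C D.
    closed_csubspace E \<and>
    R = closure (range \<Delta>) \<times> E \<and>
    bounded_op (defect_space m S) (defect_space m T) A \<and>
    bounded_op (vec_space R) (defect_space m T) B \<and>
    bounded_op (defect_space m S) R C \<and>
    bounded_op (vec_space R) R D \<and>
    unitary_op (defect_space m S \<times> vec_space R) (defect_space m T \<times> R) (block_op A B C D) \<and>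
    (\<forall>k. block_op A B C D (defect_op m S k, \<chi> i. (\<Delta> (adj (S i) k), 0))
        = (defect_op m T (adj X k), (\<Delta> k, 0))) \<and>
    schur_agler (defect_space m T) (defect_space m S) (adj_transfer (defect_space m S) R A B C D) \<and>
    canonical_dilation m T \<circ> adj X =
      mult_op_adj m (defect_space m T) (adj_transfer (defect_space m S) R A B C D) \<circ>
          canonical_dilation m S"
proof -
  let ?V = "defect_space m S" and ?W = "defect_space m T" and ?Q = "closure (range \<Delta>)"
  let ?R = "?Q \<times> (UNIV :: ('h \<times> 'k) l2seq set)"
  note V = S.csubspace_defect_space and W = T.csubspace_defect_space
  have b\<Delta>: "bounded_op UNIV UNIV \<Delta>"
    by (rule positive_op_bounded[OF sqrt_op_positive[OF pos]])
  have \<Delta>_in: "\<Delta> k \<in> ?Q" for k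
    using closure_subset[of "range \<Delta>"] by auto
  have b\<Delta>R: "bounded_op UNIV ?Q \<Delta>"
    by (rule bounded_op_mono[OF b\<Delta>]) (use \<Delta>_in in auto)
  have R0: "closed_csubspace ?Q"
    by (rule csubspace_closure_range[OF b\<Delta>])
  have R: "closed_csubspace ?R"
    by (intro csubspace_Times R0 csubspace_UNIV)
  have p: "bounded_op UNIV ?V (defect_op m S)"
    by (rule bounded_op_mono[OF S.bounded_defect_op]) (use S.defect_op_in in auto)
  have DT: "bounded_op UNIV ?W (defect_op m T)"
    by (rule bounded_op_mono[OF T.bounded_defect_op]) (use T.defect_op_in in auto)
  have p': "bounded_op UNIV ?W (\<lambda>k. defect_op m T (adj X k))"
    by (rule bounded_op_comp[OF bounded_op_adjoint_on[OF csubspace_UNIV X] DT])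
  have q: "bounded_op UNIV ?Q (\<lambda>k. \<Delta> (adj (S i) k))" for i
    by (rule bounded_op_comp[OF S.bounded_adj b\<Delta>R])
  obtain U where U: "unitary_op (?V \<times> vec_space ?R) (?W \<times> ?R) U"
    and U_eq: "\<And>k. U (defect_op m S k, \<chi> i. (\<Delta> (adj (S i) k), 0))
        = (defect_op m T (adj X k), (\<Delta> k, 0))"
    using colligation_unitary_exists[OF V W R0 p p' q b\<Delta>R defect_balance[OF pos]] by auto
  have Rn: "closed_csubspace (vec_space ?R)"
    by (rule csubspace_vec_space[OF R])
  obtain A B C D where blocks: "bounded_op ?V ?W A" "bounded_op (vec_space ?R) ?W B"
      "bounded_op ?V ?R C"
    "bounded_op (vec_space ?R) ?R D"
    "\<And>x y. x \<in> ?V \<Longrightarrow> y \<in> vec_space ?R \<Longrightarrow> block_op A B C D (x, y) = U (x, y)"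
    "unitary_op (?V \<times> vec_space ?R) (?W \<times> ?R) (block_op A B C D)"
    by (rule unitary_op_blocks[OF V Rn W R U]) (rule that; assumption)
  have col: "unitary_colligation ?V ?W ?R A B C D"
    by (intro unitary_colligation.intro V W R blocks)
  have U_eq': "block_op A B C D (defect_op m S k, \<chi> i. (\<Delta> (adj (S i) k), 0))
      = (defect_op m T (adj X k), (\<Delta> k, 0))" for k
    using blocks(5)[OF S.defect_op_in, of "\<chi> i. (\<Delta> (adj (S i) k), 0)"] \<Delta>_in U_eq[of k]
    by (simp add: vec_space_def)
  have "(\<Delta> k, 0) \<in> ?R" for k
    using \<Delta>_in by simp
  note rel = multiplier_relation[OF pos col this U_eq']
  show ?thesis
    by (rule exI[of _ UNIV], rule exI[of _ ?R], rule exI[of _ A], rule exI[of _ B],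
        rule exI[of _ C], rule exI[of _ D])
      (intro conjI allI csubspace_UNIV refl blocks(1-4,6) U_eq' rel
        unitary_colligation.transfer_schur_agler[OF col])
qed

end

theorem theorem3p3:
  fixes m :: nat
    and T :: "'n::finite \<Rightarrow> 'h::complex_hilbert \<Rightarrow> 'h"
    and S :: "'n \<Rightarrow> 'k::complex_hilbert \<Rightarrow> 'k"
    and X :: "'h \<Rightarrow> 'k"
    and \<Delta> :: "'k \<Rightarrow> 'k"
  assumes m: "m \<ge> 1"
    and T: "hypercontraction m T" "pure_tuple T"
    and S: "hypercontraction m S" "pure_tuple S"
    and X: "contraction X" "\<forall>i. X \<circ> T i = S i \<circ> X"
  defines "\<Delta> \<equiv> sqrt_op ((one_minus_sigma S ^^ (m - 1)) (\<lambda>k. k - X (adj X k)))"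
  shows
    "((\<exists>\<Phi>. schur_agler (defect_space m T) (defect_space m S) \<Phi> \<and>
         canonical_dilation m T \<circ> adj X =
           mult_op_adj m (defect_space m T) \<Phi> \<circ> canonical_dilation m S)
      \<longleftrightarrow> positive_op ((one_minus_sigma S ^^ (m - 1)) (\<lambda>k. k - X (adj X k)))) \<and>
     (positive_op ((one_minus_sigma S ^^ (m - 1)) (\<lambda>k. k - X (adj X k))) \<longrightarrow>
       (\<exists>(E :: ('h \<times> 'k) l2seq set) (R :: ('k \<times> ('h \<times> 'k) l2seq) set) A B C D.
         closed_csubspace E \<and>
         R = closure (range \<Delta>) \<times> E \<and>
         bounded_op (defect_space m S) (defect_space m T) A \<and>
         bounded_op (vec_space R) (defect_space m T) B \<and>
         bounded_op (defect_space m S) R C \<and>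
         bounded_op (vec_space R) R D \<and>
         unitary_op (defect_space m S \<times> vec_space R) (defect_space m T \<times> R) (block_op A B C D) \<and>
         (\<forall>k. block_op A B C D (defect_op m S k, \<chi> i. (\<Delta> (adj (S i) k), 0)) =
            (defect_op m T (adj X k), (\<Delta> k, 0))) \<and>
         schur_agler (defect_space m T) (defect_space m S)
           (adj_transfer (defect_space m S) R A B C D) \<and>
         canonical_dilation m T \<circ> adj X =
           mult_op_adj m (defect_space m T) (adj_transfer (defect_space m S) R A B C D) \<circ>
             canonical_dilation m S))"
proof -
  have Xb: "bounded_op UNIV UNIV X"
    using X(1) by (simp add: contraction_def)
  have XT: "X (T i h) = S i (X h)" for i h
    using X(2) by (metis comp_apply)
  interpret T: pure_hypercontraction T m
    by (rule pure_hypercontractionI[OF m T])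
  interpret S: pure_hypercontraction S m
    by (rule pure_hypercontractionI[OF m S])
  interpret intertwined_hypercontractions T S m X
    by unfold_locales (fact Xb, fact XT)
  show ?thesis
    unfolding \<Delta>_def using transfer_realization positive_if_multiplier by blast
qed

end
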